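(* Let $R$ be a ring with unity, let $\mathcal{X}$ be a semibrick of left $R$-modules and let $Y$ be a left $R$-module. Then all $\mathcal{X}$-universal short exact sequences starting from $Y$ are isomorphic: if $0\to Y\xrightarrow{\alpha}Z\xrightarrow{\beta}\bigoplus_{X\in\mathcal{X}}X^{(I_X)}\to0$ and $0\to Y\xrightarrow{\alpha'}Z'\xrightarrow{\beta'}\bigoplus_{X\in\mathcal{X}}X^{(I_X)}\to0$ are $\mathcal{X}$-universal, then there exist isomorphisms $f:Z'\to Z$ and $g:\bigoplus_{X\in\mathcal{X}}X^{(I_X)}\to\bigoplus_{X\in\mathcal{X}}X^{(I_X)}$ which together with the identity of $Y$ form a commutative diagram between the two sequences.
   Context: A brick is a finitely presented left $R$-module whose endomorphism ring is a division ring. A semibrick is a class $\mathcal{X}$ of pairwise non-isomorphic bricks with $\mathrm{Hom}(X,X')=0$ for distinct $X,X'\in\mathcal{X}$. $\mathcal{X}$-universal sequences: for each $X\in\mathcal{X}$, $\mathrm{Ext}^1(X,Y)$ is a left $\mathrm{End}(X)$-module (endomorphisms act by pull-back; compositions are written from left to right). Choose a basis $(0\to Y\to M_{X,i}\to X\to 0)_{i\in I_X}$ of it over the division ring $\mathrm{End}(X)$. The $\mathcal{X}$-universal short exact sequence $0\to Y\to M\to\bigoplus_{X\in\mathcal{X}}X^{(I_X)}\to 0$ starting from $Y$ (for this choice of bases) is the push-out of the direct sum sequence $0\to\bigoplus_{X}Y^{(I_X)}\to\bigoplus_{X,i}M_{X,i}\to\bigoplus_{X}X^{(I_X)}\to 0$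 along the summation map $\bigoplus_X Y^{(I_X)}\to Y$. The two bases of $\mathrm{Ext}^1(X,Y)$ used for the two sequences are indexed by the same set $I_X$ (all bases have the same cardinality). *)

theory Defs
  imports "HOL-Algebra.Module" "HOL-Algebra.AbelCoset"
begin

section \<open>Left modules over a not necessarily commutative ring\<close>

text \<open>
  The library locale \<^locale>\<open>module\<close> requires a commutative ring of scalars, so left modules are
  introduced here, on the same record type.  The ring fields \<^const>\<open>monoid.mult\<close> and \<^const>\<open>one\<close>
  of that record carry no meaning for a module.
\<close>

locale left_module = R?: ring R + M?: abelian_group M
  for R :: "('r, 's) ring_scheme" (structure) and M :: "('r, 'm) module" (structure) +
  assumes smult_closed [simp, intro]:
      "\<lbrakk>a \<in> carrier R; x \<in> carrier M\<rbrakk> \<Longrightarrow> a \<odot>\<^bsub>M\<^esub> x \<in> carrier M"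
    and smult_l_distr:
      "\<lbrakk>a \<in> carrier R; b \<in> carrier R; x \<in> carrier M\<rbrakk>
       \<Longrightarrow> (a \<oplus>\<^bsub>R\<^esub> b) \<odot>\<^bsub>M\<^esub> x = a \<odot>\<^bsub>M\<^esub> x \<oplus>\<^bsub>M\<^esub> b \<odot>\<^bsub>M\<^esub> x"
    and smult_r_distr:
      "\<lbrakk>a \<in> carrier R; x \<in> carrier M; y \<in> carrier M\<rbrakk>
       \<Longrightarrow> a \<odot>\<^bsub>M\<^esub> (x \<oplus>\<^bsub>M\<^esub> y) = a \<odot>\<^bsub>M\<^esub> x \<oplus>\<^bsub>M\<^esub> a \<odot>\<^bsub>M\<^esub> y"
    and smult_assoc1:
      "\<lbrakk>a \<in> carrier R; b \<in> carrier R; x \<in> carrier M\<rbrakk>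
       \<Longrightarrow> (a \<otimes>\<^bsub>R\<^esub> b) \<odot>\<^bsub>M\<^esub> x = a \<odot>\<^bsub>M\<^esub> (b \<odot>\<^bsub>M\<^esub> x)"
    and smult_one [simp]:
      "x \<in> carrier M \<Longrightarrow> \<one>\<^bsub>R\<^esub> \<odot>\<^bsub>M\<^esub> x = x"

definition mod_hom ::
    "('r, 's) ring_scheme \<Rightarrow> ('r, 'm) module \<Rightarrow> ('r, 'n) module \<Rightarrow> ('m \<Rightarrow> 'n) set"
  where "mod_hom R M N =
    {h \<in> carrier M \<rightarrow> carrier N.
       (\<forall>x\<in>carrier M. \<forall>y\<in>carrier M. h (x \<oplus>\<^bsub>M\<^esub> y) = h x \<oplus>\<^bsub>N\<^esub> h y) \<and>
       (\<forall>a\<in>carrier R. \<forall>x\<in>carrier M. h (a \<odot>\<^bsub>M\<^esub> x) = a \<odot>\<^bsub>N\<^esub> h x)}"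

definition mod_iso ::
    "('r, 's) ring_scheme \<Rightarrow> ('r, 'm) module \<Rightarrow> ('r, 'n) module \<Rightarrow> ('m \<Rightarrow> 'n) set"
  where "mod_iso R M N = {h \<in> mod_hom R M N. bij_betw h (carrier M) (carrier N)}"

definition regular_module :: "('r, 's) ring_scheme \<Rightarrow> ('r, 'r) module"
  where "regular_module R =
    \<lparr>carrier = carrier R, monoid.mult = (\<otimes>\<^bsub>R\<^esub>), one = \<one>\<^bsub>R\<^esub>,
     zero = \<zero>\<^bsub>R\<^esub>, add = (\<oplus>\<^bsub>R\<^esub>), smult = (\<otimes>\<^bsub>R\<^esub>)\<rparr>"

definition prod_module :: "('r, 'm) module \<Rightarrow> ('r, 'n) module \<Rightarrow> ('r, 'm \<times> 'n) module"
  where "prod_module M N =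
    \<lparr>carrier = carrier M \<times> carrier N, monoid.mult = undefined, one = undefined,
     zero = (\<zero>\<^bsub>M\<^esub>, \<zero>\<^bsub>N\<^esub>),
     add = (\<lambda>(x, y) (x', y'). (x \<oplus>\<^bsub>M\<^esub> x', y \<oplus>\<^bsub>N\<^esub> y')),
     smult = (\<lambda>a (x, y). (a \<odot>\<^bsub>M\<^esub> x, a \<odot>\<^bsub>N\<^esub> y))\<rparr>"

definition direct_sum :: "'i set \<Rightarrow> ('i \<Rightarrow> ('r, 'm) module) \<Rightarrow> ('r, 'i \<Rightarrow> 'm) module"
  where "direct_sum I M =
    \<lparr>carrier = {u \<in> \<Pi>\<^sub>E i\<in>I. carrier (M i). finite {i \<in> I. u i \<noteq> \<zero>\<^bsub>M i\<^esub>}},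
     monoid.mult = undefined, one = undefined,
     zero = (\<lambda>i\<in>I. \<zero>\<^bsub>M i\<^esub>),
     add = (\<lambda>u v. \<lambda>i\<in>I. u i \<oplus>\<^bsub>M i\<^esub> v i),
     smult = (\<lambda>a u. \<lambda>i\<in>I. a \<odot>\<^bsub>M i\<^esub> u i)\<rparr>"

definition quot_module :: "('r, 'm) module \<Rightarrow> 'm set \<Rightarrow> ('r, 'm set) module"
  where "quot_module M N =
    \<lparr>carrier = a_rcosets\<^bsub>M\<^esub> N, monoid.mult = undefined, one = undefined,
     zero = N, add = (<+>\<^bsub>M\<^esub>),
     smult = (\<lambda>a C. \<Union>c\<in>C. N +>\<^bsub>M\<^esub> (a \<odot>\<^bsub>M\<^esub> c))\<rparr>"

definition finitely_presented :: "('r, 's) ring_scheme \<Rightarrow> ('r, 'm) module \<Rightarrow> bool"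
  where "finitely_presented R X \<longleftrightarrow>
    (\<exists>(m::nat) (n::nat) \<phi> \<pi>.
       \<phi> \<in> mod_hom R (direct_sum {..<m} (\<lambda>_. regular_module R))
                     (direct_sum {..<n} (\<lambda>_. regular_module R)) \<and>
       \<pi> \<in> mod_hom R (direct_sum {..<n} (\<lambda>_. regular_module R)) X \<and>
       \<phi> ` carrier (direct_sum {..<m} (\<lambda>_. regular_module R)) =
         a_kernel (direct_sum {..<n} (\<lambda>_. regular_module R)) X \<pi> \<and>
       \<pi> ` carrier (direct_sum {..<n} (\<lambda>_. regular_module R)) = carrier X)"

text \<open>Linear independence and spanning for a family indexed by \<open>I\<close> in a left \<open>D\<close>-module.\<close>

definition module_basis ::
    "('d, 's) ring_scheme \<Rightarrow> ('d, 'm) module \<Rightarrow> 'i set \<Rightarrow> ('i \<Rightarrow> 'm) \<Rightarrow> bool"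
  where "module_basis D M I b \<longleftrightarrow>
    b \<in> I \<rightarrow> carrier M \<and>
    (\<forall>a \<in> I \<rightarrow> carrier D. finite {i \<in> I. a i \<noteq> \<zero>\<^bsub>D\<^esub>} \<longrightarrow>
       (\<Oplus>\<^bsub>M\<^esub>i\<in>{i \<in> I. a i \<noteq> \<zero>\<^bsub>D\<^esub>}. a i \<odot>\<^bsub>M\<^esub> b i) = \<zero>\<^bsub>M\<^esub> \<longrightarrow>
       (\<forall>i\<in>I. a i = \<zero>\<^bsub>D\<^esub>)) \<and>
    (\<forall>x \<in> carrier M. \<exists>a \<in> I \<rightarrow> carrier D. finite {i \<in> I. a i \<noteq> \<zero>\<^bsub>D\<^esub>} \<and>
       x = (\<Oplus>\<^bsub>M\<^esub>i\<in>{i \<in> I. a i \<noteq> \<zero>\<^bsub>D\<^esub>}. a i \<odot>\<^bsub>M\<^esub> b i))"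


section \<open>Bricks and semibricks\<close>

text \<open>
  Endomorphisms are taken extensional, so that two of them are equal iff they agree on the carrier.
  Compositions are written from left to right: \<open>f \<otimes> g\<close> is ``first \<open>f\<close>, then \<open>g\<close>''.
\<close>

definition End_ring :: "('r, 's) ring_scheme \<Rightarrow> ('r, 'm) module \<Rightarrow> ('m \<Rightarrow> 'm) ring"
  where "End_ring R X =
    \<lparr>carrier = mod_hom R X X \<inter> extensional (carrier X),
     monoid.mult = (\<lambda>f g. compose (carrier X) g f),
     one = (\<lambda>x\<in>carrier X. x),
     zero = (\<lambda>x\<in>carrier X. \<zero>\<^bsub>X\<^esub>),
     add = (\<lambda>f g. \<lambda>x\<in>carrier X. f x \<oplus>\<^bsub>X\<^esub> g x)\<rparr>"

definition division_ring :: "('d, 's) ring_scheme \<Rightarrow> bool"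
  where "division_ring D \<longleftrightarrow>
    ring D \<and> \<one>\<^bsub>D\<^esub> \<noteq> \<zero>\<^bsub>D\<^esub> \<and> Units D = carrier D - {\<zero>\<^bsub>D\<^esub>}"

definition brick :: "('r, 's) ring_scheme \<Rightarrow> ('r, 'm) module \<Rightarrow> bool"
  where "brick R X \<longleftrightarrow>
    left_module R X \<and> finitely_presented R X \<and> division_ring (End_ring R X)"

definition semibrick :: "('r, 's) ring_scheme \<Rightarrow> ('r, 'm) module set \<Rightarrow> bool"
  where "semibrick R \<X> \<longleftrightarrow>
    (\<forall>X\<in>\<X>. brick R X) \<and>
    (\<forall>X\<in>\<X>. \<forall>X'\<in>\<X>. X \<noteq> X' \<longrightarrow>
       mod_iso R X X' = {} \<and>
       (\<forall>h \<in> mod_hom R X X'. \<forall>x\<in>carrier X. h x = \<zero>\<^bsub>X'\<^esub>))"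


section \<open>Short exact sequences and \<open>Ext\<^sup>1\<close>\<close>

text \<open>A diagram \<open>Y \<rightarrow> M \<rightarrow> X\<close>, the outer terms being supplied separately.\<close>

record ('r, 'y, 'e, 'x) extension =
  inc :: "'y \<Rightarrow> 'e"
  mid :: "('r, 'e) module"
  prj :: "'e \<Rightarrow> 'x"

text \<open>\<open>0 \<rightarrow> Y \<rightarrow> M \<rightarrow> X \<rightarrow> 0\<close> is a short exact sequence of left \<open>R\<close>-modules.\<close>

definition short_exact ::
    "('r, 's) ring_scheme \<Rightarrow> ('r, 'x) module \<Rightarrow> ('r, 'y) module
      \<Rightarrow> ('r, 'y, 'e, 'x) extension \<Rightarrow> bool"
  where "short_exact R X Y E \<longleftrightarrow>
    left_module R X \<and> left_module R Y \<and> left_module R (mid E) \<and>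
    inc E \<in> mod_hom R Y (mid E) \<and> prj E \<in> mod_hom R (mid E) X \<and>
    inj_on (inc E) (carrier Y) \<and>
    inc E ` carrier Y = a_kernel (mid E) X (prj E) \<and>
    prj E ` carrier (mid E) = carrier X"

text \<open>Isomorphic with identities on both outer terms.\<close>

definition ext_equiv ::
    "('r, 's) ring_scheme \<Rightarrow> ('r, 'y) module
      \<Rightarrow> ('r, 'y, 'e, 'x) extension \<Rightarrow> ('r, 'y, 'f, 'x) extension \<Rightarrow> bool"
  where "ext_equiv R Y E F \<longleftrightarrow>
    (\<exists>h \<in> mod_iso R (mid E) (mid F).
       (\<forall>y\<in>carrier Y. h (inc E y) = inc F y) \<and>
       (\<forall>e\<in>carrier (mid E). prj F (h e) = prj E e))"

text \<open>
  Classes consist of sequences whose middle term lives on the type \<open>'y \<times> 'x\<close>.  This loses nothing: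
  the middle term of any extension of \<open>X\<close> by \<open>Y\<close> is in bijection with \<open>Y \<times> X\<close>.
\<close>

definition ext_class ::
    "('r, 's) ring_scheme \<Rightarrow> ('r, 'x) module \<Rightarrow> ('r, 'y) module
      \<Rightarrow> ('r, 'y, 'e, 'x) extension \<Rightarrow> ('r, 'y, 'y \<times> 'x, 'x) extension set"
  where "ext_class R X Y E = {F. short_exact R X Y F \<and> ext_equiv R Y E F}"

definition split_ext ::
    "('r, 'x) module \<Rightarrow> ('r, 'y) module \<Rightarrow> ('r, 'y, 'y \<times> 'x, 'x) extension"
  where "split_ext X Y = \<lparr>inc = (\<lambda>y. (y, \<zero>\<^bsub>X\<^esub>)), mid = prod_module Y X, prj = snd\<rparr>"

text \<open>Pull-back along \<open>\<phi> : W \<rightarrow> X\<close>.\<close>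

definition pullback_ext ::
    "('r, 'w) module \<Rightarrow> ('w \<Rightarrow> 'x) \<Rightarrow> ('r, 'y, 'e, 'x) extension
      \<Rightarrow> ('r, 'y, 'e \<times> 'w, 'w) extension"
  where "pullback_ext W \<phi> E =
    \<lparr>inc = (\<lambda>y. (inc E y, \<zero>\<^bsub>W\<^esub>)),
     mid = (prod_module (mid E) W)
       \<lparr>carrier := {(e, w). e \<in> carrier (mid E) \<and> w \<in> carrier W \<and> prj E e = \<phi> w}\<rparr>,
     prj = snd\<rparr>"

text \<open>
  Push-out along \<open>\<sigma> : A \<rightarrow> Y\<close> of a sequence starting from \<open>A\<close>, formed as the quotient of
  \<open>Y \<oplus> M\<close> by the submodule of all \<open>(\<sigma> a, - inc a)\<close>.
\<close>

definition pushout_ext ::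
    "('r, 'a) module \<Rightarrow> ('r, 'y) module \<Rightarrow> ('a \<Rightarrow> 'y) \<Rightarrow> ('r, 'a, 'e, 'x) extension
      \<Rightarrow> ('r, 'y, ('y \<times> 'e) set, 'x) extension"
  where "pushout_ext A Y \<sigma> E =
    (let P = prod_module Y (mid E);
         N = (\<lambda>a. (\<sigma> a, \<ominus>\<^bsub>mid E\<^esub> inc E a)) ` carrier A
     in \<lparr>inc = (\<lambda>y. N +>\<^bsub>P\<^esub> (y, \<zero>\<^bsub>mid E\<^esub>)),
         mid = quot_module P N,
         prj = (\<lambda>C. the_elem ((\<lambda>(y, e). prj E e) ` C))\<rparr>)"

text \<open>
  Baer sum: the fibre product of the middle terms over \<open>X\<close>, modulo the skew diagonal copy of \<open>Y\<close>.
\<close>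

definition baer_sum ::
    "('r, 'y) module \<Rightarrow> ('r, 'y, 'e, 'x) extension \<Rightarrow> ('r, 'y, 'f, 'x) extension
      \<Rightarrow> ('r, 'y, ('e \<times> 'f) set, 'x) extension"
  where "baer_sum Y E F =
    (let P = (prod_module (mid E) (mid F))
           \<lparr>carrier := {(e, f). e \<in> carrier (mid E) \<and> f \<in> carrier (mid F) \<and> prj E e = prj F f}\<rparr>;
         N = (\<lambda>y. (inc E y, \<ominus>\<^bsub>mid F\<^esub> inc F y)) ` carrier Y
     in \<lparr>inc = (\<lambda>y. N +>\<^bsub>P\<^esub> (inc E y, \<zero>\<^bsub>mid F\<^esub>)),
         mid = quot_module P N,
         prj = (\<lambda>C. the_elem ((\<lambda>(e, f). prj E e) ` C))\<rparr>)"

text \<open>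
  \<open>Ext\<^sup>1(X, Y)\<close> as a left module over \<open>End(X)\<close>: addition is the Baer sum and an endomorphism acts
  by pull-back.  The unions run over all representatives, the result being independent of them.
\<close>

definition Ext1 ::
    "('r, 's) ring_scheme \<Rightarrow> ('r, 'x) module \<Rightarrow> ('r, 'y) module
      \<Rightarrow> ('x \<Rightarrow> 'x, ('r, 'y, 'y \<times> 'x, 'x) extension set) module"
  where "Ext1 R X Y =
    \<lparr>carrier = ext_class R X Y ` {E :: ('r, 'y, 'y \<times> 'x, 'x) extension. short_exact R X Y E},
     monoid.mult = undefined, one = undefined,
     zero = ext_class R X Y (split_ext X Y),
     add = (\<lambda>c d. \<Union>E\<in>c. \<Union>F\<in>d. ext_class R X Y (baer_sum Y E F)),
     smult = (\<lambda>\<phi> c. \<Union>E\<in>c. ext_class R X Y (pullback_ext X \<phi> E))\<rparr>"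


section \<open>Universal sequences\<close>

definition direct_sum_ext ::
    "'p set \<Rightarrow> ('p \<Rightarrow> ('r, 'y, 'e, 'x) extension)
      \<Rightarrow> ('r, 'p \<Rightarrow> 'y, 'p \<Rightarrow> 'e, 'p \<Rightarrow> 'x) extension"
  where "direct_sum_ext P E =
    \<lparr>inc = (\<lambda>u. \<lambda>p\<in>P. inc (E p) (u p)),
     mid = direct_sum P (\<lambda>p. mid (E p)),
     prj = (\<lambda>v. \<lambda>p\<in>P. prj (E p) (v p))\<rparr>"

definition summation_map :: "'p set \<Rightarrow> ('r, 'y) module \<Rightarrow> ('p \<Rightarrow> 'y) \<Rightarrow> 'y"
  where "summation_map P Y u = (\<Oplus>\<^bsub>Y\<^esub>p\<in>{p \<in> P. u p \<noteq> \<zero>\<^bsub>Y\<^esub>}. u p)"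

text \<open>\<open>\<Oplus>\<^bsub>X \<in> \<X>\<^esub> X\<^bsup>(I X)\<^esup>\<close>\<close>

definition semibrick_sum ::
    "('r, 'x) module set \<Rightarrow> (('r, 'x) module \<Rightarrow> 'i set)
      \<Rightarrow> ('r, ('r, 'x) module \<times> 'i \<Rightarrow> 'x) module"
  where "semibrick_sum \<X> I = direct_sum (SIGMA X:\<X>. I X) fst"

text \<open>
  \<open>E\<close> is an \<open>\<X>\<close>-universal sequence starting from \<open>Y\<close> for the bases \<open>B X\<close> of \<open>Ext\<^sup>1(X, Y)\<close>.
  As a push-out is determined up to isomorphism only, \<open>E\<close> is asked to be equivalent to the
  explicitly constructed one.
\<close>

definition universal_sequence ::
    "('r, 's) ring_scheme \<Rightarrow> ('r, 'x) module set \<Rightarrow> ('r, 'y) module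
      \<Rightarrow> (('r, 'x) module \<Rightarrow> 'i set)
      \<Rightarrow> (('r, 'x) module \<Rightarrow> 'i \<Rightarrow> ('r, 'y, 'e, 'x) extension)
      \<Rightarrow> ('r, 'y, 'z, ('r, 'x) module \<times> 'i \<Rightarrow> 'x) extension \<Rightarrow> bool"
  where "universal_sequence R \<X> Y I B E \<longleftrightarrow>
    (\<forall>X\<in>\<X>. (\<forall>i\<in>I X. short_exact R X Y (B X i)) \<and>
       module_basis (End_ring R X) (Ext1 R X Y) (I X) (\<lambda>i. ext_class R X Y (B X i))) \<and>
    short_exact R (semibrick_sum \<X> I) Y E \<and>
    (let P = (SIGMA X:\<X>. I X)
     in ext_equiv R Y
          (pushout_ext (direct_sum P (\<lambda>_. Y)) Y (summation_map P Y)
             (direct_sum_ext P (\<lambda>(X, i). B X i)))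
          E)"

end

theory Submission
  imports Defs
begin

text \<open>
  Say that an extension of \<open>X\<close> by \<open>Y\<close> lies over a map \<open>h : X \<rightarrow> S\<close> into the right-hand term of an
  extension \<open>U\<close> of \<open>S\<close> by \<open>Y\<close> if it is the pull-back of \<open>U\<close> along \<open>h\<close>; by exactness it suffices that
  it maps to \<open>U\<close> over \<open>h\<close> and the identity of \<open>Y\<close>.  Classes over \<open>h\<close> and \<open>k\<close> have Baer sum over
  \<open>h + k\<close>, so a class \<open>\<Sum> a\<^sub>j [M\<^sub>j]\<close> lies over \<open>(a\<^sub>j)\<^sub>j\<close> with respect to a universal sequence.  As \<open>X\<close> is
  finitely generated and \<open>Hom(X, X') = 0\<close>, every map from \<open>X\<close> to the sum of bricks is such a finite family.
  Hence spanning yields morphisms between two universal sequences in both directions, while linear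
  independence shows that an endomorphism of a universal sequence over the identity of \<open>Y\<close> is the
  identity on the right-hand term, so that both composites are isomorphisms by the five lemma.
\<close>

section \<open>Left modules and their homomorphisms\<close>

text \<open>What matters about a basis is only its effect on the connecting map Hom(X, S) ->
  Ext^1(X, Y), h being sent to the pull-back of the universal sequence along h: spanning makes this
  map surjective, linear independence makes its kernel zero. The two given bases are never compared
  with each other. The obstacle lies in the finite sums of the basis condition. They are formed in
  \<open>Ext1\<close>, whose operations are unions over representatives living on one fixed type, so
  the independence of representatives and the laws of addition must be settled before any such sum
  can be unfolded. Iterated Baer sums would make this a long diagram chase. Instead, given classes
  are realised as pull-backs of one common extension U, and Baer sums turn into sums of maps into
  its right-hand term. Such a U comes from the same push-out that defines universal sequences,
  applied to the classes themselves in place of a basis. For this reason the push-out is developed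
  for arbitrary families of extensions by Y.\<close>

lemma left_module_abelian_group: "left_module R M \<Longrightarrow> abelian_group M"
  by (rule left_module.axioms(2))

lemma left_module_ring: "left_module R M \<Longrightarrow> ring R"
  by (rule left_module.axioms(1))

context left_module
begin

lemma smult_r_zero [simp]:
  assumes "a \<in> carrier R" shows "a \<odot>\<^bsub>M\<^esub> \<zero>\<^bsub>M\<^esub> = \<zero>\<^bsub>M\<^esub>"
proof -
  have "a \<odot>\<^bsub>M\<^esub> \<zero>\<^bsub>M\<^esub> \<oplus>\<^bsub>M\<^esub> a \<odot>\<^bsub>M\<^esub> \<zero>\<^bsub>M\<^esub> = a \<odot>\<^bsub>M\<^esub> \<zero>\<^bsub>M\<^esub> \<oplus>\<^bsub>M\<^esub> \<zero>\<^bsub>M\<^esub>"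
    using assms smult_r_distr[of a "\<zero>\<^bsub>M\<^esub>" "\<zero>\<^bsub>M\<^esub>"] by simp
  then show ?thesis
    using assms by (metis M.zero_closed M.add.l_cancel_one smult_closed M.r_zero)
qed

lemma smult_l_zero [simp]:
  assumes "x \<in> carrier M" shows "\<zero>\<^bsub>R\<^esub> \<odot>\<^bsub>M\<^esub> x = \<zero>\<^bsub>M\<^esub>"
proof -
  have "\<zero>\<^bsub>R\<^esub> \<odot>\<^bsub>M\<^esub> x \<oplus>\<^bsub>M\<^esub> \<zero>\<^bsub>R\<^esub> \<odot>\<^bsub>M\<^esub> x = \<zero>\<^bsub>R\<^esub> \<odot>\<^bsub>M\<^esub> x \<oplus>\<^bsub>M\<^esub> \<zero>\<^bsub>M\<^esub>"
    using assms smult_l_distr[of "\<zero>\<^bsub>R\<^esub>" "\<zero>\<^bsub>R\<^esub>" x] by simp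
  then show ?thesis
    using assms by (metis M.zero_closed M.add.l_cancel_one R.zero_closed smult_closed M.r_zero)
qed

lemma uminus_zero [simp]: "\<ominus>\<^bsub>M\<^esub> \<zero>\<^bsub>M\<^esub> = \<zero>\<^bsub>M\<^esub>"
  by (rule M.minus_equality) simp_all

text \<open>With negation expressed as a scalar multiple, homomorphisms preserve it and a subset
  closed under scalars is closed under it.\<close>

lemma minus_eq_smult:
  assumes "x \<in> carrier M" shows "\<ominus>\<^bsub>M\<^esub> x = (\<ominus>\<^bsub>R\<^esub> \<one>\<^bsub>R\<^esub>) \<odot>\<^bsub>M\<^esub> x"
proof -
  have "(\<ominus>\<^bsub>R\<^esub> \<one>\<^bsub>R\<^esub>) \<odot>\<^bsub>M\<^esub> x \<oplus>\<^bsub>M\<^esub> \<one>\<^bsub>R\<^esub> \<odot>\<^bsub>M\<^esub> x = \<zero>\<^bsub>M\<^esub>"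
    using assms smult_l_distr[of "\<ominus>\<^bsub>R\<^esub> \<one>\<^bsub>R\<^esub>" "\<one>\<^bsub>R\<^esub>" x] by (simp add: R.l_neg)
  then show ?thesis
    using assms by (simp add: M.minus_equality)
qed

end

section \<open>Homomorphisms of left modules\<close>

lemma mod_homI:
  assumes "\<And>x. x \<in> carrier M \<Longrightarrow> h x \<in> carrier N"
    and "\<And>x y. x \<in> carrier M \<Longrightarrow> y \<in> carrier M \<Longrightarrow> h (x \<oplus>\<^bsub>M\<^esub> y) = h x \<oplus>\<^bsub>N\<^esub> h y"
    and "\<And>a x. a \<in> carrier R \<Longrightarrow> x \<in> carrier M \<Longrightarrow> h (a \<odot>\<^bsub>M\<^esub> x) = a \<odot>\<^bsub>N\<^esub> h x"
  shows "h \<in> mod_hom R M N"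
  using assms by (auto simp: mod_hom_def)

lemma mod_hom_closed: "h \<in> mod_hom R M N \<Longrightarrow> x \<in> carrier M \<Longrightarrow> h x \<in> carrier N"
  by (auto simp: mod_hom_def)

lemma mod_hom_add:
  "h \<in> mod_hom R M N \<Longrightarrow> x \<in> carrier M \<Longrightarrow> y \<in> carrier M \<Longrightarrow> h (x \<oplus>\<^bsub>M\<^esub> y) = h x \<oplus>\<^bsub>N\<^esub> h y"
  by (auto simp: mod_hom_def)

lemma mod_hom_smult:
  "h \<in> mod_hom R M N \<Longrightarrow> a \<in> carrier R \<Longrightarrow> x \<in> carrier M \<Longrightarrow> h (a \<odot>\<^bsub>M\<^esub> x) = a \<odot>\<^bsub>N\<^esub> h x"
  by (auto simp: mod_hom_def)

lemma mod_hom_zero: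
  assumes "left_module R M" "left_module R N" "h \<in> mod_hom R M N"
  shows "h \<zero>\<^bsub>M\<^esub> = \<zero>\<^bsub>N\<^esub>"
proof -
  interpret M: left_module R M by fact
  interpret N: left_module R N by fact
  have "h (\<zero>\<^bsub>R\<^esub> \<odot>\<^bsub>M\<^esub> \<zero>\<^bsub>M\<^esub>) = \<zero>\<^bsub>R\<^esub> \<odot>\<^bsub>N\<^esub> h \<zero>\<^bsub>M\<^esub>"
    using assms(3) by (rule mod_hom_smult) auto
  then show ?thesis
    using mod_hom_closed[OF assms(3)] by simp
qed

lemma mod_hom_minus:
  assumes "left_module R M" "left_module R N" "h \<in> mod_hom R M N" "x \<in> carrier M"
  shows "h (\<ominus>\<^bsub>M\<^esub> x) = \<ominus>\<^bsub>N\<^esub> h x"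
proof -
  interpret M: left_module R M by fact
  interpret N: left_module R N by fact
  show ?thesis
    using assms(4) mod_hom_closed[OF assms(3,4)] mod_hom_smult[OF assms(3) _ assms(4)]
    by (simp add: M.minus_eq_smult N.minus_eq_smult)
qed

lemma mod_hom_compose:
  "f \<in> mod_hom R L M \<Longrightarrow> g \<in> mod_hom R M N \<Longrightarrow> (\<lambda>x. g (f x)) \<in> mod_hom R L N"
  by (auto simp: mod_hom_def Pi_iff)

lemma mod_hom_cong:
  assumes "left_module R M" "h \<in> mod_hom R M N" "\<And>x. x \<in> carrier M \<Longrightarrow> h' x = h x"
  shows "h' \<in> mod_hom R M N"
proof -
  interpret M: left_module R M by fact
  show ?thesis using assms(2,3) by (auto simp: mod_hom_def Pi_iff)
qed

lemma mod_hom_id: "(\<lambda>x. x) \<in> mod_hom R M M"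
  by (auto simp: mod_hom_def)

lemma mod_hom_const_zero:
  assumes "left_module R N" shows "(\<lambda>x. \<zero>\<^bsub>N\<^esub>) \<in> mod_hom R M N"
proof -
  interpret N: left_module R N by fact
  show ?thesis by (auto simp: mod_hom_def)
qed

lemma mod_hom_uminus:
  assumes "left_module R N" "f \<in> mod_hom R M N"
  shows "(\<lambda>x. \<ominus>\<^bsub>N\<^esub> f x) \<in> mod_hom R M N"
proof -
  interpret N: left_module R N by fact
  note c = mod_hom_closed[OF assms(2)]
  have "a \<odot>\<^bsub>N\<^esub> \<ominus>\<^bsub>N\<^esub> x = \<ominus>\<^bsub>N\<^esub> (a \<odot>\<^bsub>N\<^esub> x)" if "a \<in> carrier R" "x \<in> carrier N" for a x
    using that by (simp add: N.minus_eq_smult flip: N.smult_assoc1) (simp add: N.R.r_minus N.R.l_minus)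
  then show ?thesis
    using c by (intro mod_homI)
      (auto simp: mod_hom_add[OF assms(2)] mod_hom_smult[OF assms(2)] N.minus_add)
qed

lemma mod_hom_inj_on:
  assumes "left_module R M" "left_module R N" "h \<in> mod_hom R M N"
    and "\<And>x. x \<in> carrier M \<Longrightarrow> h x = \<zero>\<^bsub>N\<^esub> \<Longrightarrow> x = \<zero>\<^bsub>M\<^esub>"
  shows "inj_on h (carrier M)"
proof (rule inj_onI)
  fix x y assume xy: "x \<in> carrier M" "y \<in> carrier M" "h x = h y"
  interpret M: left_module R M by fact
  interpret N: left_module R N by fact
  have "h (x \<oplus>\<^bsub>M\<^esub> \<ominus>\<^bsub>M\<^esub> y) = \<zero>\<^bsub>N\<^esub>"
    using xy mod_hom_closed[OF assms(3)]
    by (simp add: mod_hom_add[OF assms(3)] mod_hom_minus[OF assms(1-3)] N.r_neg)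
  then have "x \<oplus>\<^bsub>M\<^esub> \<ominus>\<^bsub>M\<^esub> y = \<zero>\<^bsub>M\<^esub>" using xy assms(4) by simp
  then show "x = y" using xy by (metis M.add.inv_closed M.add.inv_inv M.minus_equality)
qed

text \<open>Every module axiom is an equation that can be checked on preimages, so nothing is
  assumed of Q beforehand; the value at zero is a separate premise because Q is not yet known to be
  a group. This serves quotients as well as structures transported to another type.\<close>

lemma left_module_surj:
  fixes Q :: "('r, 'q) module"
  assumes "left_module R P" "\<pi> \<in> mod_hom R P Q" "\<pi> ` carrier P = carrier Q" "\<pi> \<zero>\<^bsub>P\<^esub> = \<zero>\<^bsub>Q\<^esub>"
  shows "left_module R Q"
proof -
  interpret P: left_module R P by fact
  have ex: "\<exists>p. p \<in> carrier P \<and> x = \<pi> p" if "x \<in> carrier Q" for x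
    using that assms(3) by auto
  have cl: "\<pi> p \<in> carrier Q" if "p \<in> carrier P" for p
    using that mod_hom_closed[OF assms(2)] by auto
  have ad: "\<pi> p \<oplus>\<^bsub>Q\<^esub> \<pi> q = \<pi> (p \<oplus>\<^bsub>P\<^esub> q)" if "p \<in> carrier P" "q \<in> carrier P" for p q
    using that mod_hom_add[OF assms(2)] by auto
  have sm: "a \<odot>\<^bsub>Q\<^esub> \<pi> p = \<pi> (a \<odot>\<^bsub>P\<^esub> p)" if "a \<in> carrier R" "p \<in> carrier P" for a p
    using that mod_hom_smult[OF assms(2)] by auto
  have "abelian_group Q"
  proof (rule abelian_groupI)
    fix x y z assume "x \<in> carrier Q" "y \<in> carrier Q" "z \<in> carrier Q"
    then obtain p q r where "p \<in> carrier P" "q \<in> carrier P" "r \<in> carrier P"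
      "x = \<pi> p" "y = \<pi> q" "z = \<pi> r" using ex by metis
    then show "(x \<oplus>\<^bsub>Q\<^esub> y) \<oplus>\<^bsub>Q\<^esub> z = x \<oplus>\<^bsub>Q\<^esub> (y \<oplus>\<^bsub>Q\<^esub> z)" by (simp add: ad P.a_assoc)
  next
    fix x y assume "x \<in> carrier Q" "y \<in> carrier Q"
    then obtain p q where *: "p \<in> carrier P" "q \<in> carrier P" "x = \<pi> p" "y = \<pi> q" using ex by metis
    then show "x \<oplus>\<^bsub>Q\<^esub> y = y \<oplus>\<^bsub>Q\<^esub> x" by (simp add: ad P.a_comm)
    show "x \<oplus>\<^bsub>Q\<^esub> y \<in> carrier Q" using * by (simp add: ad cl)
  next
    fix x assume "x \<in> carrier Q"
    then obtain p where *: "p \<in> carrier P" "x = \<pi> p" using ex by metis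
    then show "\<zero>\<^bsub>Q\<^esub> \<oplus>\<^bsub>Q\<^esub> x = x" using assms(4) by (metis P.l_zero P.zero_closed ad)
    show "\<exists>y\<in>carrier Q. y \<oplus>\<^bsub>Q\<^esub> x = \<zero>\<^bsub>Q\<^esub>"
      using * assms(4) by (intro bexI[of _ "\<pi> (\<ominus>\<^bsub>P\<^esub> p)"]) (auto simp: ad cl P.l_neg)
  next
    show "\<zero>\<^bsub>Q\<^esub> \<in> carrier Q" using cl[of "\<zero>\<^bsub>P\<^esub>"] assms(4) by simp
  qed
  moreover have "left_module_axioms R Q"
  proof
    fix a x assume a: "a \<in> carrier R" and "x \<in> carrier Q"
    then obtain p where *: "p \<in> carrier P" "x = \<pi> p" using ex by metis
    show "a \<odot>\<^bsub>Q\<^esub> x \<in> carrier Q" using a * by (simp add: sm cl)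
    {
      fix b assume "b \<in> carrier R"
      then show "(a \<oplus>\<^bsub>R\<^esub> b) \<odot>\<^bsub>Q\<^esub> x = a \<odot>\<^bsub>Q\<^esub> x \<oplus>\<^bsub>Q\<^esub> b \<odot>\<^bsub>Q\<^esub> x"
        "(a \<otimes>\<^bsub>R\<^esub> b) \<odot>\<^bsub>Q\<^esub> x = a \<odot>\<^bsub>Q\<^esub> (b \<odot>\<^bsub>Q\<^esub> x)"
        using a * by (simp_all add: sm ad P.smult_l_distr P.smult_assoc1)
    next
      fix y assume "y \<in> carrier Q"
      then obtain q where "q \<in> carrier P" "y = \<pi> q" using ex by metis
      then show "a \<odot>\<^bsub>Q\<^esub> (x \<oplus>\<^bsub>Q\<^esub> y) = a \<odot>\<^bsub>Q\<^esub> x \<oplus>\<^bsub>Q\<^esub> a \<odot>\<^bsub>Q\<^esub> y"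
        using a * by (simp add: sm ad P.smult_r_distr)
    }
  next
    fix x assume "x \<in> carrier Q"
    then obtain p where *: "p \<in> carrier P" "x = \<pi> p" using ex by metis
    then show "\<one>\<^bsub>R\<^esub> \<odot>\<^bsub>Q\<^esub> x = x" by (simp add: sm)
  qed
  ultimately show ?thesis
    using P.R.ring_axioms by (intro left_module.intro)
qed

lemma left_module_submodule:
  fixes M :: "('r, 'm) module"
  assumes "left_module R M" "K \<subseteq> carrier M" "\<zero>\<^bsub>M\<^esub> \<in> K"
    and "\<And>x y. x \<in> K \<Longrightarrow> y \<in> K \<Longrightarrow> x \<oplus>\<^bsub>M\<^esub> y \<in> K"
    and "\<And>a x. a \<in> carrier R \<Longrightarrow> x \<in> K \<Longrightarrow> a \<odot>\<^bsub>M\<^esub> x \<in> K"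
  shows "left_module R (M\<lparr>carrier := K\<rparr>)"
proof -
  interpret M: left_module R M by fact
  have sub: "x \<in> carrier M" if "x \<in> K" for x using that assms(2) by auto
  have "abelian_group (M\<lparr>carrier := K\<rparr>)"
  proof (rule abelian_groupI)
    fix x assume "x \<in> carrier (M\<lparr>carrier := K\<rparr>)"
    then have "x \<in> K" by simp
    then have "\<ominus>\<^bsub>M\<^esub> x \<in> K"
      using assms(5) sub by (simp add: M.minus_eq_smult)
    then show "\<exists>y\<in>carrier (M\<lparr>carrier := K\<rparr>). y \<oplus>\<^bsub>M\<lparr>carrier := K\<rparr>\<^esub> x = \<zero>\<^bsub>M\<lparr>carrier := K\<rparr>\<^esub>"
      using sub \<open>x \<in> K\<close> by (auto intro!: bexI[of _ "\<ominus>\<^bsub>M\<^esub> x"] simp: M.l_neg)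
  qed (auto simp: assms(3,4) sub M.a_ac)
  then show ?thesis
    using M.R.ring_axioms
    by (intro left_module.intro left_module_axioms.intro)
      (auto simp: sub assms(5) M.smult_l_distr M.smult_r_distr M.smult_assoc1)
qed

section \<open>Products and fibre products\<close>

lemma prod_module_simps [simp]:
  "carrier (prod_module M N) = carrier M \<times> carrier N"
  "zero (prod_module M N) = (\<zero>\<^bsub>M\<^esub>, \<zero>\<^bsub>N\<^esub>)"
  "(x, y) \<oplus>\<^bsub>prod_module M N\<^esub> (x', y') = (x \<oplus>\<^bsub>M\<^esub> x', y \<oplus>\<^bsub>N\<^esub> y')"
  "a \<odot>\<^bsub>prod_module M N\<^esub> (x, y) = (a \<odot>\<^bsub>M\<^esub> x, a \<odot>\<^bsub>N\<^esub> y)"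
  by (auto simp: prod_module_def)

lemma left_module_prod:
  assumes "left_module R M" "left_module R N"
  shows "left_module R (prod_module M N)"
proof -
  interpret M: left_module R M by fact
  interpret N: left_module R N by fact
  have "abelian_group (prod_module M N)"
  proof (rule abelian_groupI)
    fix x assume "x \<in> carrier (prod_module M N)"
    then obtain m n where "x = (m, n)" "m \<in> carrier M" "n \<in> carrier N" by auto
    then show "\<exists>y\<in>carrier (prod_module M N). y \<oplus>\<^bsub>prod_module M N\<^esub> x = \<zero>\<^bsub>prod_module M N\<^esub>"
      by (intro bexI[of _ "(\<ominus>\<^bsub>M\<^esub> m, \<ominus>\<^bsub>N\<^esub> n)"]) (auto simp: M.l_neg N.l_neg)
  qed (auto simp: M.a_ac N.a_ac)
  then show ?thesis
    using M.R.ring_axioms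
    by (intro left_module.intro left_module_axioms.intro)
      (auto simp: M.smult_l_distr M.smult_r_distr M.smult_assoc1
         N.smult_l_distr N.smult_r_distr N.smult_assoc1)
qed

abbreviation fibre_product ::
    "('r, 'm) module \<Rightarrow> ('r, 'n) module \<Rightarrow> ('m \<Rightarrow> 'x) \<Rightarrow> ('n \<Rightarrow> 'x) \<Rightarrow> ('r, 'm \<times> 'n) module"
  where "fibre_product M N p q \<equiv>
    (prod_module M N)\<lparr>carrier := {(m, n). m \<in> carrier M \<and> n \<in> carrier N \<and> p m = q n}\<rparr>"

lemma left_module_fibre_product:
  assumes "left_module R M" "left_module R N" "left_module R X"
    and "p \<in> mod_hom R M X" "q \<in> mod_hom R N X"
  shows "left_module R (fibre_product M N p q)"
proof -
  interpret M: left_module R M by fact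
  interpret N: left_module R N by fact
  show ?thesis
    using assms
    by (intro left_module_submodule left_module_prod)
      (auto simp: mod_hom_zero[of R _ X] mod_hom_add[of _ R _ X] mod_hom_smult[of _ R _ X])
qed

section \<open>Quotients\<close>

text \<open>Baer sums and push-outs both divide a module by the image of an explicit homomorphism.
  Keeping \<nu> and not only its image makes the difference of two representatives of a coset a
  value \<open>\<nu> a\<close>.\<close>

locale quotient_by_image =
  fixes R :: "('r, 's) ring_scheme" and A :: "('r, 'a) module" and P :: "('r, 'p) module"
    and \<nu> :: "'a \<Rightarrow> 'p" and N :: "'p set"
  assumes A: "left_module R A" and P: "left_module R P"
    and \<nu>: "\<nu> \<in> mod_hom R A P" and N_eq: "N = \<nu> ` carrier A"
begin

sublocale A: left_module R A by (rule A)
sublocale P: left_module R P by (rule P)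

lemma additive_subgroup_image: "additive_subgroup N P"
proof (rule additive_subgroupI, rule P.add.subgroupI)
  show "N \<subseteq> carrier P" "N \<noteq> {}"
    using mod_hom_closed[OF \<nu>] A.zero_closed by (auto simp: N_eq)
  fix x assume "x \<in> N"
  then obtain a where a: "a \<in> carrier A" "x = \<nu> a" by (auto simp: N_eq)
  then have "\<ominus>\<^bsub>P\<^esub> x = \<nu> (\<ominus>\<^bsub>A\<^esub> a)" by (simp add: mod_hom_minus[OF A P \<nu>])
  then show "\<ominus>\<^bsub>P\<^esub> x \<in> N" using a by (auto simp: N_eq)
  fix y assume "y \<in> N"
  then obtain b where b: "b \<in> carrier A" "y = \<nu> b" by (auto simp: N_eq)
  then have "x \<oplus>\<^bsub>P\<^esub> y = \<nu> (a \<oplus>\<^bsub>A\<^esub> b)" using a by (simp add: mod_hom_add[OF \<nu>])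
  then show "x \<oplus>\<^bsub>P\<^esub> y \<in> N" using a b by (auto simp: N_eq)
qed

sublocale N: abelian_subgroup N P
  by (rule abelian_subgroupI3[OF additive_subgroup_image P.abelian_group_axioms])

lemma coset_eq_iff:
  assumes "p \<in> carrier P" "q \<in> carrier P"
  shows "N +>\<^bsub>P\<^esub> p = N +>\<^bsub>P\<^esub> q \<longleftrightarrow> (\<exists>a\<in>carrier A. p = \<nu> a \<oplus>\<^bsub>P\<^esub> q)"
proof -
  have "N +>\<^bsub>P\<^esub> p = N +>\<^bsub>P\<^esub> q \<longleftrightarrow> p \<in> N +>\<^bsub>P\<^esub> q"
    using assms N.a_repr_independence' N.a_rcos_self by metis
  then show ?thesis by (auto simp: a_r_coset_def' N_eq)
qed

lemma smult_coset:
  assumes "a \<in> carrier R" "p \<in> carrier P"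
  shows "a \<odot>\<^bsub>quot_module P N\<^esub> (N +>\<^bsub>P\<^esub> p) = N +>\<^bsub>P\<^esub> (a \<odot>\<^bsub>P\<^esub> p)"
proof -
  have "N +>\<^bsub>P\<^esub> (a \<odot>\<^bsub>P\<^esub> c) = N +>\<^bsub>P\<^esub> (a \<odot>\<^bsub>P\<^esub> p)" if c: "c \<in> N +>\<^bsub>P\<^esub> p" for c
  proof -
    obtain b where b: "b \<in> carrier A" "c = \<nu> b \<oplus>\<^bsub>P\<^esub> p"
      using c by (auto simp: a_r_coset_def' N_eq)
    have "a \<odot>\<^bsub>P\<^esub> c = \<nu> (a \<odot>\<^bsub>A\<^esub> b) \<oplus>\<^bsub>P\<^esub> a \<odot>\<^bsub>P\<^esub> p"
      using assms b mod_hom_closed[OF \<nu>] by (simp add: P.smult_r_distr mod_hom_smult[OF \<nu>])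
    then show ?thesis
      using assms b mod_hom_closed[OF \<nu>]
      by (subst coset_eq_iff) (auto intro!: bexI[of _ "a \<odot>\<^bsub>A\<^esub> b"])
  qed
  moreover have "p \<in> N +>\<^bsub>P\<^esub> p" using assms N.a_rcos_self by simp
  ultimately have "(\<Union>c\<in>N +>\<^bsub>P\<^esub> p. N +>\<^bsub>P\<^esub> (a \<odot>\<^bsub>P\<^esub> c)) = N +>\<^bsub>P\<^esub> (a \<odot>\<^bsub>P\<^esub> p)"
    by blast
  then show ?thesis by (simp add: quot_module_def)
qed

lemma coset_hom: "(\<lambda>p. N +>\<^bsub>P\<^esub> p) \<in> mod_hom R P (quot_module P N)"
proof (rule mod_homI)
  fix x y assume "x \<in> carrier P" "y \<in> carrier P"
  then show "N +>\<^bsub>P\<^esub> (x \<oplus>\<^bsub>P\<^esub> y) = (N +>\<^bsub>P\<^esub> x) \<oplus>\<^bsub>quot_module P N\<^esub> (N +>\<^bsub>P\<^esub> y)"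
    by (simp add: quot_module_def N.a_rcos_sum)
qed (simp_all add: smult_coset, auto simp: quot_module_def A_RCOSETS_def')

lemma carrier_quot: "carrier (quot_module P N) = (\<lambda>p. N +>\<^bsub>P\<^esub> p) ` carrier P"
  by (auto simp: quot_module_def A_RCOSETS_def')

lemma zero_quot: "\<zero>\<^bsub>quot_module P N\<^esub> = N +>\<^bsub>P\<^esub> \<zero>\<^bsub>P\<^esub>"
  using N.a_rcos_const[of "\<zero>\<^bsub>P\<^esub>"] by (simp add: quot_module_def)

lemma left_module_quot: "left_module R (quot_module P N)"
  by (rule left_module_surj[OF P coset_hom]) (simp_all add: carrier_quot zero_quot)

text \<open>Since \<phi> kills the image of \<nu>, it is constant on cosets and its image of a coset
  is a singleton. The form with \<open>the_elem\<close> is the one in which projections of Baer sums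
  and push-outs are defined.\<close>

lemma quot_map_coset:
  assumes "left_module R M" "\<phi> \<in> mod_hom R P M" "\<And>a. a \<in> carrier A \<Longrightarrow> \<phi> (\<nu> a) = \<zero>\<^bsub>M\<^esub>"
    and "p \<in> carrier P"
  shows "the_elem (\<phi> ` (N +>\<^bsub>P\<^esub> p)) = \<phi> p"
proof -
  interpret M: left_module R M by fact
  have "\<phi> c = \<phi> p" if "c \<in> N +>\<^bsub>P\<^esub> p" for c
    using that assms(3,4) mod_hom_closed[OF \<nu>] mod_hom_closed[OF assms(2)]
    by (auto simp: a_r_coset_def' N_eq mod_hom_add[OF assms(2)])
  moreover have "p \<in> N +>\<^bsub>P\<^esub> p" using assms N.a_rcos_self by simp
  ultimately have "\<phi> ` (N +>\<^bsub>P\<^esub> p) = {\<phi> p}" by blast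
  then show ?thesis by simp
qed

lemma quot_map_hom:
  assumes "left_module R M" "\<phi> \<in> mod_hom R P M" "\<And>a. a \<in> carrier A \<Longrightarrow> \<phi> (\<nu> a) = \<zero>\<^bsub>M\<^esub>"
  shows "(\<lambda>C. the_elem (\<phi> ` C)) \<in> mod_hom R (quot_module P N) M"
proof (rule mod_homI)
  fix C assume "C \<in> carrier (quot_module P N)"
  then show "the_elem (\<phi> ` C) \<in> carrier M"
    using mod_hom_closed[OF assms(2)] by (auto simp: carrier_quot quot_map_coset[OF assms])
next
  fix C D assume "C \<in> carrier (quot_module P N)" "D \<in> carrier (quot_module P N)"
  then obtain p q where "p \<in> carrier P" "q \<in> carrier P" "C = N +>\<^bsub>P\<^esub> p" "D = N +>\<^bsub>P\<^esub> q"
    by (auto simp: carrier_quot)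
  then show "the_elem (\<phi> ` (C \<oplus>\<^bsub>quot_module P N\<^esub> D)) = the_elem (\<phi> ` C) \<oplus>\<^bsub>M\<^esub> the_elem (\<phi> ` D)"
    by (simp add: quot_map_coset[OF assms] mod_hom_add[OF assms(2)]
        flip: mod_hom_add[OF coset_hom])
next
  fix a C assume "a \<in> carrier R" "C \<in> carrier (quot_module P N)"
  then show "the_elem (\<phi> ` (a \<odot>\<^bsub>quot_module P N\<^esub> C)) = a \<odot>\<^bsub>M\<^esub> the_elem (\<phi> ` C)"
    by (auto simp: carrier_quot quot_map_coset[OF assms] mod_hom_smult[OF assms(2)] smult_coset)
qed

text \<open>The common exactness criterion for Baer sums and push-outs: Y embeds into the quotient
  because \<open>i\<close> meets the image of \<nu> only in zero, and exactness in the middle holds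
  because the kernel of \<open>q\<close> is the sum of the images of \<nu> and
  \<open>i\<close>.\<close>

lemma short_exact_quot:
  assumes "left_module R Y" "left_module R X" "i \<in> mod_hom R Y P" "q \<in> mod_hom R P X"
    and surj: "q ` carrier P = carrier X"
    and q\<nu>: "\<And>a. a \<in> carrier A \<Longrightarrow> q (\<nu> a) = \<zero>\<^bsub>X\<^esub>"
    and qi: "\<And>y. y \<in> carrier Y \<Longrightarrow> q (i y) = \<zero>\<^bsub>X\<^esub>"
    and ker: "\<And>p. p \<in> carrier P \<Longrightarrow> q p = \<zero>\<^bsub>X\<^esub> \<Longrightarrow> \<exists>a\<in>carrier A. \<exists>y\<in>carrier Y. p = \<nu> a \<oplus>\<^bsub>P\<^esub> i y"
    and inj: "\<And>a y. a \<in> carrier A \<Longrightarrow> y \<in> carrier Y \<Longrightarrow> i y = \<nu> a \<Longrightarrow> y = \<zero>\<^bsub>Y\<^esub>"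
  shows "short_exact R X Y
    \<lparr>inc = (\<lambda>y. N +>\<^bsub>P\<^esub> i y), mid = quot_module P N, prj = (\<lambda>C. the_elem (q ` C))\<rparr>"
proof -
  note qc = quot_map_coset[OF assms(2,4) q\<nu>]
  have hom: "(\<lambda>y. N +>\<^bsub>P\<^esub> i y) \<in> mod_hom R Y (quot_module P N)"
    using assms(3) coset_hom by (rule mod_hom_compose)
  have "inj_on (\<lambda>y. N +>\<^bsub>P\<^esub> i y) (carrier Y)"
  proof (rule mod_hom_inj_on[OF assms(1) left_module_quot hom])
    fix y assume y: "y \<in> carrier Y" "N +>\<^bsub>P\<^esub> i y = \<zero>\<^bsub>quot_module P N\<^esub>"
    then obtain a where "a \<in> carrier A" "i y = \<nu> a"
      using mod_hom_closed[OF assms(3)] mod_hom_closed[OF \<nu>]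
      by (auto simp: zero_quot coset_eq_iff)
    then show "y = \<zero>\<^bsub>Y\<^esub>" using y inj by auto
  qed
  moreover have "(\<lambda>y. N +>\<^bsub>P\<^esub> i y) ` carrier Y
      = a_kernel (quot_module P N) X (\<lambda>C. the_elem (q ` C))"
  proof (intro equalityI subsetI)
    fix C assume "C \<in> a_kernel (quot_module P N) X (\<lambda>C. the_elem (q ` C))"
    then obtain p where p: "p \<in> carrier P" "q p = \<zero>\<^bsub>X\<^esub>" "C = N +>\<^bsub>P\<^esub> p"
      by (auto simp: a_kernel_def' carrier_quot qc)
    then obtain a y where ay: "a \<in> carrier A" "y \<in> carrier Y" "p = \<nu> a \<oplus>\<^bsub>P\<^esub> i y"
      using ker by blast
    then have "C = N +>\<^bsub>P\<^esub> i y"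
      using p mod_hom_closed[OF assms(3)] by (auto simp: coset_eq_iff)
    then show "C \<in> (\<lambda>y. N +>\<^bsub>P\<^esub> i y) ` carrier Y" using ay by auto
  qed (use mod_hom_closed[OF assms(3)] in \<open>auto simp: a_kernel_def' carrier_quot qc qi\<close>)
  moreover have "(\<lambda>C. the_elem (q ` C)) ` carrier (quot_module P N) = carrier X"
    using surj by (auto simp: carrier_quot qc image_image cong: image_cong)
  ultimately show ?thesis
    using assms(1,2) left_module_quot hom quot_map_hom[OF assms(2,4) q\<nu>]
    by (simp add: short_exact_def)
qed

end

section \<open>Morphisms of extensions\<close>

lemma short_exactD:
  assumes "short_exact R X Y E"
  shows "left_module R X" "left_module R Y" "left_module R (mid E)"
    and "inc E \<in> mod_hom R Y (mid E)" "prj E \<in> mod_hom R (mid E) X" "inj_on (inc E) (carrier Y)"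
    and "\<And>y. y \<in> carrier Y \<Longrightarrow> prj E (inc E y) = \<zero>\<^bsub>X\<^esub>"
    and "\<And>e. e \<in> carrier (mid E) \<Longrightarrow> prj E e = \<zero>\<^bsub>X\<^esub> \<Longrightarrow> \<exists>y\<in>carrier Y. e = inc E y"
    and "\<And>x. x \<in> carrier X \<Longrightarrow> \<exists>e\<in>carrier (mid E). prj E e = x"
  using assms unfolding short_exact_def a_kernel_def' by (simp_all add: set_eq_iff image_iff) metis+

lemma short_exact_inc_zero:
  assumes "short_exact R X Y E" "y \<in> carrier Y" "inc E y = \<zero>\<^bsub>mid E\<^esub>"
  shows "y = \<zero>\<^bsub>Y\<^esub>"
proof -
  note E = short_exactD[OF assms(1)]
  interpret Y: left_module R Y by (rule E(2))
  show ?thesis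
    using inj_onD[OF E(6), of y "\<zero>\<^bsub>Y\<^esub>"] mod_hom_zero[OF E(2,3,4)] assms(2,3) by simp
qed

text \<open>Apply exactness to the difference of the two elements: each nonempty fibre of the
  projection is a translate of the image of Y.\<close>

lemma short_exact_diff:
  assumes "short_exact R X Y E" "e \<in> carrier (mid E)" "e' \<in> carrier (mid E)" "prj E e = prj E e'"
  shows "\<exists>y\<in>carrier Y. e = inc E y \<oplus>\<^bsub>mid E\<^esub> e'"
proof -
  note E = short_exactD[OF assms(1)]
  interpret X: left_module R X by (rule E(1))
  interpret M: left_module R "mid E" by (rule E(3))
  have "prj E (e \<oplus>\<^bsub>mid E\<^esub> \<ominus>\<^bsub>mid E\<^esub> e') = \<zero>\<^bsub>X\<^esub>"
    using assms(2-4) mod_hom_closed[OF E(5)]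
    by (simp add: mod_hom_add[OF E(5)] mod_hom_minus[OF E(3,1,5)] X.r_neg)
  then obtain y where y: "y \<in> carrier Y" "e \<oplus>\<^bsub>mid E\<^esub> \<ominus>\<^bsub>mid E\<^esub> e' = inc E y"
    using E(8) assms(2,3) by (metis M.a_closed M.a_inv_closed)
  then have "e = inc E y \<oplus>\<^bsub>mid E\<^esub> e'"
    using assms(2,3) by (metis M.a_assoc M.a_inv_closed M.l_neg M.r_zero)
  then show ?thesis using y by auto
qed

text \<open>Here \<open>h\<close> may be any function; that it is a homomorphism follows for short
  exact sequences from the surjectivity of \<open>prj E\<close>, see
  \<open>ext_over_hom\<close>.\<close>

definition ext_map ::
    "('r, 's) ring_scheme \<Rightarrow> ('r, 'y) module \<Rightarrow> ('r, 'y, 'e, 'x) extension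
      \<Rightarrow> ('r, 'y, 'f, 'w) extension \<Rightarrow> ('x \<Rightarrow> 'w) \<Rightarrow> ('e \<Rightarrow> 'f) \<Rightarrow> bool"
  where "ext_map R Y E U h m \<longleftrightarrow>
    m \<in> mod_hom R (mid E) (mid U) \<and> (\<forall>y\<in>carrier Y. m (inc E y) = inc U y) \<and>
    (\<forall>e\<in>carrier (mid E). prj U (m e) = h (prj E e))"

definition ext_over ::
    "('r, 's) ring_scheme \<Rightarrow> ('r, 'y) module \<Rightarrow> ('r, 'y, 'e, 'x) extension
      \<Rightarrow> ('r, 'y, 'f, 'w) extension \<Rightarrow> ('x \<Rightarrow> 'w) \<Rightarrow> bool"
  where "ext_over R Y E U h \<longleftrightarrow> (\<exists>m. ext_map R Y E U h m)"

lemma ext_map_compose: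
  "ext_map R Y E F h m \<Longrightarrow> ext_map R Y F G k n \<Longrightarrow> ext_map R Y E G (\<lambda>x. k (h x)) (\<lambda>x. n (m x))"
  by (auto simp: ext_map_def intro: mod_hom_compose dest: mod_hom_closed)

lemma ext_over_trans:
  "ext_over R Y E F h \<Longrightarrow> ext_over R Y F G k \<Longrightarrow> ext_over R Y E G (\<lambda>x. k (h x))"
  by (auto simp: ext_over_def intro: ext_map_compose)

lemma ext_over_refl: "ext_over R Y E E (\<lambda>x. x)"
  by (auto simp: ext_over_def ext_map_def intro!: exI[of _ "\<lambda>x. x"] mod_hom_id)

lemma ext_map_cong:
  assumes "short_exact R X Y E" "ext_map R Y E U h m" "\<And>x. x \<in> carrier X \<Longrightarrow> h x = h' x"
  shows "ext_map R Y E U h' m"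
  using assms mod_hom_closed[OF short_exactD(5)[OF assms(1)]] by (auto simp: ext_map_def)

lemma ext_over_cong:
  assumes "short_exact R X Y E" "ext_over R Y E U h" "\<And>x. x \<in> carrier X \<Longrightarrow> h x = h' x"
  shows "ext_over R Y E U h'"
  using assms ext_map_cong[OF assms(1)] unfolding ext_over_def by blast

text \<open>The short five lemma. Injectivity: an element of the kernel projects to zero, hence
  comes from Y, where \<open>inc F\<close> is injective. Surjectivity: a lift of
  \<open>prj F f\<close> to \<open>mid E\<close> can be corrected by an element of Y.\<close>

lemma ext_map_id_imp_iso:
  assumes "short_exact R X Y E" "short_exact R X Y F" "ext_map R Y E F (\<lambda>x. x) m"
  shows "m \<in> mod_iso R (mid E) (mid F)"
proof -
  note E = short_exactD[OF assms(1)] and F = short_exactD[OF assms(2)]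
  interpret ME: left_module R "mid E" by (rule E(3))
  have m: "m \<in> mod_hom R (mid E) (mid F)"
    and mi: "\<And>y. y \<in> carrier Y \<Longrightarrow> m (inc E y) = inc F y"
    and mp: "\<And>e. e \<in> carrier (mid E) \<Longrightarrow> prj F (m e) = prj E e"
    using assms(3) by (auto simp: ext_map_def)
  have "inj_on m (carrier (mid E))"
  proof (rule mod_hom_inj_on[OF E(3) F(3) m])
    fix e assume e: "e \<in> carrier (mid E)" "m e = \<zero>\<^bsub>mid F\<^esub>"
    then have "prj E e = \<zero>\<^bsub>X\<^esub>" using mp mod_hom_zero[OF F(3,1,5)] by metis
    then obtain y where y: "y \<in> carrier Y" "e = inc E y" using E(8) e by blast
    then have "y = \<zero>\<^bsub>Y\<^esub>" using e mi short_exact_inc_zero[OF assms(2)] by metis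
    then show "e = \<zero>\<^bsub>mid E\<^esub>" using y mod_hom_zero[OF E(2,3,4)] by simp
  qed
  moreover have "f \<in> m ` carrier (mid E)" if f: "f \<in> carrier (mid F)" for f
  proof -
    obtain e where e: "e \<in> carrier (mid E)" "prj E e = prj F f"
      using E(9) mod_hom_closed[OF F(5) f] by blast
    then obtain y where "y \<in> carrier Y" "f = inc F y \<oplus>\<^bsub>mid F\<^esub> m e"
      using short_exact_diff[OF assms(2) f, of "m e"] mod_hom_closed[OF m] mp by auto
    then have "f = m (inc E y \<oplus>\<^bsub>mid E\<^esub> e)" "inc E y \<oplus>\<^bsub>mid E\<^esub> e \<in> carrier (mid E)"
      using e mi mod_hom_closed[OF E(4)] by (auto simp: mod_hom_add[OF m])
    then show ?thesis by blast
  qed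
  ultimately show ?thesis
    using m mod_hom_closed[OF m] by (auto simp: mod_iso_def bij_betw_def)
qed

lemma ext_equiv_iff_over:
  assumes "short_exact R X Y E" "short_exact R X Y F"
  shows "ext_equiv R Y E F \<longleftrightarrow> ext_over R Y E F (\<lambda>x. x)"
  using ext_map_id_imp_iso[OF assms]
  by (auto simp: ext_equiv_def ext_over_def ext_map_def mod_iso_def)

text \<open>An extension over \<open>h\<close> is the pull-back along \<open>h\<close>: its elements
  are determined by their projection to X together with their image in \<open>mid U\<close>.
  Matching these two data identifies E with F.\<close>

lemma ext_over_unique:
  assumes "short_exact R X Y E" "short_exact R X Y F" "short_exact R S Y U"
    and "ext_over R Y E U h" "ext_over R Y F U h"
  shows "ext_over R Y E F (\<lambda>x. x)"
proof -
  note E = short_exactD[OF assms(1)] and F = short_exactD[OF assms(2)]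
    and U = short_exactD[OF assms(3)]
  interpret ME: left_module R "mid E" by (rule E(3))
  interpret MF: left_module R "mid F" by (rule F(3))
  interpret MU: left_module R "mid U" by (rule U(3))
  interpret Y: left_module R Y by (rule E(2))
  obtain m n where "ext_map R Y E U h m" "ext_map R Y F U h n"
    using assms(4,5) by (auto simp: ext_over_def)
  then have m: "m \<in> mod_hom R (mid E) (mid U)"
    and mi: "\<And>y. y \<in> carrier Y \<Longrightarrow> m (inc E y) = inc U y"
    and mp: "\<And>e. e \<in> carrier (mid E) \<Longrightarrow> prj U (m e) = h (prj E e)"
    and n: "n \<in> mod_hom R (mid F) (mid U)"
    and ni: "\<And>y. y \<in> carrier Y \<Longrightarrow> n (inc F y) = inc U y"
    and np: "\<And>f. f \<in> carrier (mid F) \<Longrightarrow> prj U (n f) = h (prj F f)"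
    by (auto simp: ext_map_def)
  \<comment> \<open>The graph of the comparison map: \<open>f\<close> corresponds to
    \<open>e\<close> if both have the same projection and the same image in
    \<open>mid U\<close>.\<close>
  define G where "G e f \<longleftrightarrow> f \<in> carrier (mid F) \<and> prj F f = prj E e \<and> n f = m e" for e f
  have ex: "\<exists>f. G e f" if e: "e \<in> carrier (mid E)" for e
  proof -
    obtain f where f: "f \<in> carrier (mid F)" "prj F f = prj E e"
      using F(9) mod_hom_closed[OF E(5) e] by blast
    then obtain y where y: "y \<in> carrier Y" "m e = inc U y \<oplus>\<^bsub>mid U\<^esub> n f"
      using short_exact_diff[OF assms(3), of "m e" "n f"] mp[OF e] np[OF f(1)]
        mod_hom_closed[OF m e] mod_hom_closed[OF n f(1)] by auto
    \<comment> \<open>Adding \<open>inc F y\<close> leaves the projection of \<open>f\<close>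
      unchanged and moves \<open>n f\<close> to \<open>m e\<close>.\<close>
    have "G e (inc F y \<oplus>\<^bsub>mid F\<^esub> f)"
      using f y e mod_hom_closed[OF F(4)] mod_hom_closed[OF E(5) e] E(1)
      by (auto simp: G_def mod_hom_add[OF n] mod_hom_add[OF F(5)] F(7) ni
          abelian_monoid.l_zero[OF abelian_group.axioms(1)[OF left_module_abelian_group]])
    then show ?thesis by blast
  qed
  have uniq: "f = f'" if "G e f" "G e f'" for e f f'
  proof -
    have f: "f \<in> carrier (mid F)" "f' \<in> carrier (mid F)" "prj F f = prj F f'" "n f = n f'"
      using that by (auto simp: G_def)
    obtain y where y: "y \<in> carrier Y" "f = inc F y \<oplus>\<^bsub>mid F\<^esub> f'"
      using short_exact_diff[OF assms(2) f(1-3)] by blast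
    then have "n f = inc U y \<oplus>\<^bsub>mid U\<^esub> n f'"
      using f mod_hom_closed[OF F(4)] by (simp add: mod_hom_add[OF n] ni)
    then have "inc U y = \<zero>\<^bsub>mid U\<^esub>"
      using f y mod_hom_closed[OF n] mod_hom_closed[OF U(4)] by (metis MU.add.r_cancel_one)
    then have "y = \<zero>\<^bsub>Y\<^esub>" using short_exact_inc_zero[OF assms(3)] y by simp
    then show ?thesis using y f mod_hom_zero[OF F(2,3,4)] by simp
  qed
  define \<phi> where "\<phi> e = (THE f. G e f)" for e
  have \<phi>: "G e (\<phi> e)" if "e \<in> carrier (mid E)" for e
    unfolding \<phi>_def using ex[OF that] uniq by (metis theI)
  have \<phi>_eq: "\<phi> e = f" if "e \<in> carrier (mid E)" "G e f" for e f
    using \<phi> uniq that by blast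
  have "\<phi> \<in> mod_hom R (mid E) (mid F)"
  proof (rule mod_homI)
    fix e e' assume e: "e \<in> carrier (mid E)" "e' \<in> carrier (mid E)"
    then show "\<phi> (e \<oplus>\<^bsub>mid E\<^esub> e') = \<phi> e \<oplus>\<^bsub>mid F\<^esub> \<phi> e'"
      using \<phi>[OF e(1)] \<phi>[OF e(2)]
      by (intro \<phi>_eq) (auto simp: G_def mod_hom_add[OF n] mod_hom_add[OF m]
          mod_hom_add[OF F(5)] mod_hom_add[OF E(5)])
  next
    fix a e assume "a \<in> carrier R" "e \<in> carrier (mid E)"
    then show "\<phi> (a \<odot>\<^bsub>mid E\<^esub> e) = a \<odot>\<^bsub>mid F\<^esub> \<phi> e"
      using \<phi>[of e]
      by (intro \<phi>_eq) (auto simp: G_def mod_hom_smult[OF n] mod_hom_smult[OF m]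
          mod_hom_smult[OF F(5)] mod_hom_smult[OF E(5)])
  qed (use \<phi> in \<open>auto simp: G_def\<close>)
  moreover have "\<phi> (inc E y) = inc F y" if "y \<in> carrier Y" for y
    using that mod_hom_closed[OF E(4)] mod_hom_closed[OF F(4)]
    by (intro \<phi>_eq) (auto simp: G_def mi ni E(7) F(7))
  moreover have "prj F (\<phi> e) = prj E e" if "e \<in> carrier (mid E)" for e
    using \<phi>[OF that] by (simp add: G_def)
  ultimately show ?thesis by (auto simp: ext_over_def ext_map_def)
qed

text \<open>Both F and E lie over the identity with respect to F, so uniqueness of pull-backs
  supplies the reverse morphism without inverting the given one.\<close>

lemma ext_over_id_sym:
  assumes "short_exact R X Y E" "short_exact R X Y F" "ext_over R Y E F (\<lambda>x. x)"
  shows "ext_over R Y F E (\<lambda>x. x)"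
  using ext_over_unique[OF assms(2,1,2) ext_over_refl assms(3)] .

text \<open>A set-theoretic section of the projection gives each element of the middle term
  coordinates in Y and X. This coordinate map is injective, and the module structure is carried over
  to its image.\<close>

lemma ex_equiv_on_product_type:
  fixes E :: "('r, 'y, 'e, 'x) extension"
  assumes "short_exact R X Y E"
  shows "\<exists>F :: ('r, 'y, 'y \<times> 'x, 'x) extension. short_exact R X Y F \<and> ext_over R Y E F (\<lambda>x. x)"
proof -
  note E = short_exactD[OF assms(1)]
  interpret ME: left_module R "mid E" by (rule E(3))
  define s where "s x = (SOME e. e \<in> carrier (mid E) \<and> prj E e = x)" for x
  have s: "s x \<in> carrier (mid E)" "prj E (s x) = x" if "x \<in> carrier X" for x
    using someI_ex[of "\<lambda>e. e \<in> carrier (mid E) \<and> prj E e = x"] E(9)[OF that]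
    unfolding s_def by blast+
  \<comment> \<open>The Y-coordinate of \<open>e\<close>, measured from the chosen point
    \<open>s (prj E e)\<close> of its fibre.\<close>
  define t where "t e = (SOME y. y \<in> carrier Y \<and> e = inc E y \<oplus>\<^bsub>mid E\<^esub> s (prj E e))" for e
  have t: "e = inc E (t e) \<oplus>\<^bsub>mid E\<^esub> s (prj E e)" if e: "e \<in> carrier (mid E)" for e
    using short_exact_diff[OF assms e s(1)[OF mod_hom_closed[OF E(5) e]]]
      s(2)[OF mod_hom_closed[OF E(5) e]]
      someI_ex[of "\<lambda>y. y \<in> carrier Y \<and> e = inc E y \<oplus>\<^bsub>mid E\<^esub> s (prj E e)"]
    unfolding t_def by fastforce
  define j where "j e = (t e, prj E e)" for e
  have inj: "inj_on j (carrier (mid E))"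
  proof (rule inj_onI)
    fix e e' assume "e \<in> carrier (mid E)" "e' \<in> carrier (mid E)" "j e = j e'"
    then show "e = e'" using t[of e] t[of e'] by (simp add: j_def)
  qed
  define j' where "j' = the_inv_into (carrier (mid E)) j"
  have j': "j' (j e) = e" if "e \<in> carrier (mid E)" for e
    unfolding j'_def by (rule the_inv_into_f_f[OF inj that])
  define N :: "('r, 'y \<times> 'x) module" where "N = \<lparr>carrier = j ` carrier (mid E),
     monoid.mult = undefined, one = undefined, zero = j \<zero>\<^bsub>mid E\<^esub>,
     add = (\<lambda>a b. j (j' a \<oplus>\<^bsub>mid E\<^esub> j' b)), smult = (\<lambda>r a. j (r \<odot>\<^bsub>mid E\<^esub> j' a))\<rparr>"
  have jh: "j \<in> mod_hom R (mid E) N"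
    by (rule mod_homI) (auto simp: N_def j')
  have N: "left_module R N"
    by (rule left_module_surj[OF E(3) jh]) (auto simp: N_def)
  interpret N: left_module R N by (rule N)
  define F where "F = \<lparr>inc = (\<lambda>y. j (inc E y)), mid = N, prj = (\<lambda>a. prj E (j' a))\<rparr>"
  have ih: "inc F \<in> mod_hom R Y N"
    using mod_hom_compose[OF E(4) jh] by (simp add: F_def)
  have ph: "prj F \<in> mod_hom R N X"
    by (rule mod_homI) (auto simp: F_def N_def j' mod_hom_add[OF E(5)] mod_hom_smult[OF E(5)] mod_hom_closed[OF E(5)])
  have "inj_on (inc F) (carrier Y)"
    using comp_inj_on[OF E(6) inj_on_subset[OF inj]] mod_hom_closed[OF E(4)]
    by (auto simp: F_def o_def)
  moreover have "inc F ` carrier Y = a_kernel N X (prj F)"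
  proof (intro equalityI subsetI)
    fix b assume "b \<in> a_kernel N X (prj F)"
    then obtain e where "e \<in> carrier (mid E)" "b = j e" "prj E e = \<zero>\<^bsub>X\<^esub>"
      by (auto simp: a_kernel_def' N_def F_def j')
    then show "b \<in> inc F ` carrier Y" using E(8) by (force simp: F_def)
  qed (use E(7) mod_hom_closed[OF E(4)] in \<open>auto simp: a_kernel_def' N_def F_def j'\<close>)
  moreover have "prj F ` carrier N = carrier X"
    using E(9) mod_hom_closed[OF E(5)] by (force simp: F_def N_def image_image j')
  ultimately have "short_exact R X Y F"
    using E(1,2) N ih ph by (simp add: short_exact_def) (simp add: F_def)
  moreover have "ext_map R Y E F (\<lambda>x. x) j"
    using jh by (auto simp: ext_map_def F_def j')
  ultimately show ?thesis by (auto simp: ext_over_def)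
qed

section \<open>Pull-backs, Baer sums and push-outs\<close>

lemma short_exact_pullback:
  assumes "short_exact R X Y E" "left_module R W" "\<phi> \<in> mod_hom R W X"
  shows "short_exact R W Y (pullback_ext W \<phi> E)"
proof -
  note E = short_exactD[OF assms(1)]
  interpret W: left_module R W by fact
  let ?P = "fibre_product (mid E) W (prj E) \<phi>"
  have P: "left_module R ?P"
    using E assms by (intro left_module_fibre_product)
  have "inj_on (\<lambda>y. (inc E y, \<zero>\<^bsub>W\<^esub>)) (carrier Y)"
    using E(6) by (auto simp: inj_on_def)
  moreover have "(\<lambda>y. (inc E y, \<zero>\<^bsub>W\<^esub>)) \<in> mod_hom R Y ?P"
    using mod_hom_closed[OF E(4)] mod_hom_zero[OF assms(2) E(1) assms(3)] E(7)
    by (intro mod_homI) (auto simp: mod_hom_add[OF E(4)] mod_hom_smult[OF E(4)])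
  moreover have "snd \<in> mod_hom R ?P W"
    by (intro mod_homI) auto
  moreover have "(\<lambda>y. (inc E y, \<zero>\<^bsub>W\<^esub>)) ` carrier Y = a_kernel ?P W snd"
    using mod_hom_closed[OF E(4)] mod_hom_zero[OF assms(2) E(1) assms(3)] E(7,8)
    by (auto simp: a_kernel_def' image_iff)
  moreover have "snd ` carrier ?P = carrier W"
    using E(9) mod_hom_closed[OF assms(3)] by force
  ultimately show ?thesis
    using E(2) assms(2) P by (simp add: short_exact_def pullback_ext_def)
qed

lemma pullback_over: "ext_over R Y (pullback_ext W \<phi> E) E \<phi>"
  by (auto simp: ext_over_def ext_map_def pullback_ext_def intro!: exI[of _ fst] mod_homI)

lemma short_exact_split:
  assumes "left_module R X" "left_module R Y"
  shows "short_exact R X Y (split_ext X Y)"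
proof -
  interpret X: left_module R X by fact
  interpret Y: left_module R Y by fact
  have "snd ` carrier (prod_module Y X) = carrier X"
    using Y.zero_closed by force
  moreover have "(\<lambda>y. (y, \<zero>\<^bsub>X\<^esub>)) ` carrier Y = a_kernel (prod_module Y X) X snd"
    by (auto simp: a_kernel_def')
  moreover have "(\<lambda>y. (y, \<zero>\<^bsub>X\<^esub>)) \<in> mod_hom R Y (prod_module Y X)"
    by (rule mod_homI) auto
  moreover have "snd \<in> mod_hom R (prod_module Y X) X"
    by (rule mod_homI) auto
  ultimately show ?thesis
    using assms left_module_prod[OF assms(2,1)]
    by (simp add: short_exact_def split_ext_def inj_on_def)
qed

text \<open>The split sequence retracts onto Y; following the retraction by \<open>inc U\<close>
  gives a morphism whose image lies in the kernel of \<open>prj U\<close>.\<close>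

lemma split_over_zero:
  assumes "left_module R X" "short_exact R S Y U"
  shows "ext_over R Y (split_ext X Y) U (\<lambda>x. \<zero>\<^bsub>S\<^esub>)"
proof -
  note U = short_exactD[OF assms(2)]
  have "(\<lambda>p. inc U (fst p)) \<in> mod_hom R (prod_module Y X) (mid U)"
    using mod_hom_closed[OF U(4)]
    by (intro mod_homI) (auto simp: mod_hom_add[OF U(4)] mod_hom_smult[OF U(4)])
  then show ?thesis
    using U(7) by (auto simp: ext_over_def ext_map_def split_ext_def)
qed

section \<open>Baer sums\<close>

lemma baer_quotient:
  assumes "short_exact R X Y E" "short_exact R X Y F"
  shows "quotient_by_image R Y (fibre_product (mid E) (mid F) (prj E) (prj F))
    (\<lambda>y. (inc E y, \<ominus>\<^bsub>mid F\<^esub> inc F y)) ((\<lambda>y. (inc E y, \<ominus>\<^bsub>mid F\<^esub> inc F y)) ` carrier Y)"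
proof -
  note E = short_exactD[OF assms(1)] and F = short_exactD[OF assms(2)]
  interpret ME: left_module R "mid E" by (rule E(3))
  interpret MF: left_module R "mid F" by (rule F(3))
  interpret X: left_module R X by (rule E(1))
  have n: "(\<lambda>y. \<ominus>\<^bsub>mid F\<^esub> inc F y) \<in> mod_hom R Y (mid F)"
    by (rule mod_hom_uminus[OF F(3,4)])
  have "(\<lambda>y. (inc E y, \<ominus>\<^bsub>mid F\<^esub> inc F y)) \<in> mod_hom R Y (fibre_product (mid E) (mid F) (prj E) (prj F))"
    using mod_hom_closed[OF E(4)] mod_hom_closed[OF F(4)] E(7) F(7)
    by (intro mod_homI) (auto simp: mod_hom_add[OF E(4)] mod_hom_smult[OF E(4)]
        mod_hom_add[OF n] mod_hom_smult[OF n] mod_hom_minus[OF F(3,1,5)] X.uminus_zero)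
  then show ?thesis
    using E F by (intro quotient_by_image.intro left_module_fibre_product) auto
qed

lemma short_exact_baer_sum:
  assumes "short_exact R X Y E" "short_exact R X Y F"
  shows "short_exact R X Y (baer_sum Y E F)"
proof -
  note E = short_exactD[OF assms(1)] and F = short_exactD[OF assms(2)]
  interpret Y: left_module R Y by (rule E(2))
  interpret ME: left_module R "mid E" by (rule E(3))
  interpret MF: left_module R "mid F" by (rule F(3))
  interpret X: left_module R X by (rule E(1))
  let ?P = "fibre_product (mid E) (mid F) (prj E) (prj F)"
  let ?\<nu> = "\<lambda>y. (inc E y, \<ominus>\<^bsub>mid F\<^esub> inc F y)"
  interpret Q: quotient_by_image R Y ?P ?\<nu> "?\<nu> ` carrier Y"
    using assms by (rule baer_quotient)
  have "short_exact R X Y \<lparr>inc = (\<lambda>y. ?\<nu> ` carrier Y +>\<^bsub>?P\<^esub> (inc E y, \<zero>\<^bsub>mid F\<^esub>)),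
    mid = quot_module ?P (?\<nu> ` carrier Y), prj = (\<lambda>C. the_elem ((\<lambda>(e, f). prj E e) ` C))\<rparr>"
  proof (rule Q.short_exact_quot[OF E(2,1)])
    show "(\<lambda>y. (inc E y, \<zero>\<^bsub>mid F\<^esub>)) \<in> mod_hom R Y ?P"
      using mod_hom_closed[OF E(4)] E(7) mod_hom_zero[OF F(3,1,5)]
      by (intro mod_homI) (auto simp: mod_hom_add[OF E(4)] mod_hom_smult[OF E(4)])
    show "(\<lambda>(e, f). prj E e) \<in> mod_hom R ?P X"
      using mod_hom_closed[OF E(5)]
      by (intro mod_homI) (auto simp: mod_hom_add[OF E(5)] mod_hom_smult[OF E(5)])
    show "(\<lambda>(e, f). prj E e) ` carrier ?P = carrier X"
    proof (intro equalityI subsetI)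
      fix x assume x: "x \<in> carrier X"
      then obtain e f where "e \<in> carrier (mid E)" "f \<in> carrier (mid F)" "prj E e = x" "prj F f = x"
        using E(9)[OF x] F(9)[OF x] by auto
      then show "x \<in> (\<lambda>(e, f). prj E e) ` carrier ?P" by (auto intro!: image_eqI[of _ _ "(e, f)"])
    qed (use mod_hom_closed[OF E(5)] in auto)
    show "\<exists>a\<in>carrier Y. \<exists>y\<in>carrier Y. p = ?\<nu> a \<oplus>\<^bsub>?P\<^esub> (inc E y, \<zero>\<^bsub>mid F\<^esub>)"
      if p0: "p \<in> carrier ?P" "(case p of (e, f) \<Rightarrow> prj E e) = \<zero>\<^bsub>X\<^esub>" for p
    proof -
      obtain e f where p: "p = (e, f)" "e \<in> carrier (mid E)" "f \<in> carrier (mid F)"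
        "prj E e = \<zero>\<^bsub>X\<^esub>" "prj F f = \<zero>\<^bsub>X\<^esub>" using p0 by (cases p) auto
      then obtain y z where "y \<in> carrier Y" "z \<in> carrier Y" "e = inc E y" "f = inc F z"
        using E(8) F(8) by metis
      \<comment> \<open>The value of \<open>?\<nu>\<close> at the negative of \<open>z\<close> has
        second component \<open>inc F z\<close>; its first component, the negative of
        \<open>inc E z\<close>, is compensated by taking the sum of \<open>z\<close> and
        \<open>y\<close> as the element of Y.\<close>
      then show ?thesis
        using p mod_hom_closed[OF E(4)] mod_hom_closed[OF F(4)]
        by (intro bexI[of _ "\<ominus>\<^bsub>Y\<^esub> z"] bexI[of _ "z \<oplus>\<^bsub>Y\<^esub> y"])
          (auto simp: mod_hom_add[OF E(4)] mod_hom_minus[OF F(2,3,4)] mod_hom_minus[OF E(2,3,4)]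
            ME.r_neg1)
    qed
    show "y = \<zero>\<^bsub>Y\<^esub>" if "a \<in> carrier Y" "y \<in> carrier Y" "(inc E y, \<zero>\<^bsub>mid F\<^esub>) = ?\<nu> a" for a y
    proof -
      have "\<ominus>\<^bsub>mid F\<^esub> inc F a = \<zero>\<^bsub>mid F\<^esub>" "y = a"
        using that inj_onD[OF E(6), of y a] by auto
      then show ?thesis
        using that short_exact_inc_zero[OF assms(2)] mod_hom_closed[OF F(4)]
        by (metis MF.minus_minus MF.uminus_zero)
    qed
  qed (use E(7) in auto)
  then show ?thesis by (simp add: baer_sum_def Let_def)
qed

text \<open>The map \<open>m e + n f\<close> on the fibre product kills the skew diagonal, as
  \<open>m\<close> and \<open>n\<close> both restrict to \<open>inc U\<close> on Y. Its projection
  is \<open>h + k\<close> because the two components have equal projections to X.\<close>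

lemma baer_sum_over:
  assumes "short_exact R X Y E" "short_exact R X Y F" "short_exact R S Y U"
    and "ext_over R Y E U h" "ext_over R Y F U k"
  shows "ext_over R Y (baer_sum Y E F) U (\<lambda>x. h x \<oplus>\<^bsub>S\<^esub> k x)"
proof -
  note E = short_exactD[OF assms(1)] and F = short_exactD[OF assms(2)]
    and U = short_exactD[OF assms(3)]
  interpret ME: left_module R "mid E" by (rule E(3))
  interpret MF: left_module R "mid F" by (rule F(3))
  interpret MU: left_module R "mid U" by (rule U(3))
  obtain m n where "ext_map R Y E U h m" "ext_map R Y F U k n"
    using assms(4,5) by (auto simp: ext_over_def)
  then have m: "m \<in> mod_hom R (mid E) (mid U)"
    and mi: "\<And>y. y \<in> carrier Y \<Longrightarrow> m (inc E y) = inc U y"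
    and mp: "\<And>e. e \<in> carrier (mid E) \<Longrightarrow> prj U (m e) = h (prj E e)"
    and n: "n \<in> mod_hom R (mid F) (mid U)"
    and ni: "\<And>y. y \<in> carrier Y \<Longrightarrow> n (inc F y) = inc U y"
    and np: "\<And>f. f \<in> carrier (mid F) \<Longrightarrow> prj U (n f) = k (prj F f)"
    by (auto simp: ext_map_def)
  note cl = mod_hom_closed[OF m] mod_hom_closed[OF n] mod_hom_closed[OF U(4)]
    mod_hom_closed[OF E(4)] mod_hom_closed[OF F(4)]
  let ?P = "fibre_product (mid E) (mid F) (prj E) (prj F)"
  let ?\<nu> = "\<lambda>y. (inc E y, \<ominus>\<^bsub>mid F\<^esub> inc F y)"
  interpret Q: quotient_by_image R Y ?P ?\<nu> "?\<nu> ` carrier Y"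
    using assms(1,2) by (rule baer_quotient)
  let ?\<phi> = "\<lambda>(e, f). m e \<oplus>\<^bsub>mid U\<^esub> n f"
  have \<phi>: "?\<phi> \<in> mod_hom R ?P (mid U)"
    using cl by (intro mod_homI) (auto simp: mod_hom_add[OF m] mod_hom_smult[OF m]
        mod_hom_add[OF n] mod_hom_smult[OF n] MU.smult_r_distr MU.a_ac)
  have \<phi>\<nu>: "?\<phi> (?\<nu> y) = \<zero>\<^bsub>mid U\<^esub>" if "y \<in> carrier Y" for y
    using that cl by (simp add: mod_hom_minus[OF F(3) U(3) n] mi ni MU.r_neg)
  note \<phi>c = Q.quot_map_coset[OF U(3) \<phi> \<phi>\<nu>]
  have q: "(\<lambda>(e, f). prj E e) \<in> mod_hom R ?P X"
    using mod_hom_closed[OF E(5)]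
    by (intro mod_homI) (auto simp: mod_hom_add[OF E(5)] mod_hom_smult[OF E(5)])
  have qc: "the_elem ((\<lambda>(e, f). prj E e) ` (?\<nu> ` carrier Y +>\<^bsub>?P\<^esub> p)) = (\<lambda>(e, f). prj E e) p"
    if "p \<in> carrier ?P" for p
    using E(7) that by (intro Q.quot_map_coset[OF E(1) q]) auto
  have "ext_map R Y (baer_sum Y E F) U (\<lambda>x. h x \<oplus>\<^bsub>S\<^esub> k x) (\<lambda>C. the_elem (?\<phi> ` C))"
    unfolding ext_map_def
  proof (intro conjI ballI)
    show "(\<lambda>C. the_elem (?\<phi> ` C)) \<in> mod_hom R (mid (baer_sum Y E F)) (mid U)"
      using Q.quot_map_hom[OF U(3) \<phi> \<phi>\<nu>] by (simp add: baer_sum_def Let_def)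
    show "the_elem (?\<phi> ` inc (baer_sum Y E F) y) = inc U y" if "y \<in> carrier Y" for y
    proof -
      have "(inc E y, \<zero>\<^bsub>mid F\<^esub>) \<in> carrier ?P"
        using that cl E(7) mod_hom_zero[OF F(3,1,5)] by simp
      then show ?thesis
        using that cl mod_hom_zero[OF F(3) U(3) n] by (simp add: baer_sum_def Let_def \<phi>c mi)
    qed
    fix C assume "C \<in> carrier (mid (baer_sum Y E F))"
    then have "C \<in> carrier (quot_module ?P (?\<nu> ` carrier Y))"
      by (simp add: baer_sum_def Let_def)
    then obtain e f where C: "C = ?\<nu> ` carrier Y +>\<^bsub>?P\<^esub> (e, f)" and ef: "(e, f) \<in> carrier ?P"
      unfolding Q.carrier_quot by auto
    then show "prj U (the_elem (?\<phi> ` C)) = h (prj (baer_sum Y E F) C) \<oplus>\<^bsub>S\<^esub> k (prj (baer_sum Y E F) C)"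
      using cl by (simp add: baer_sum_def Let_def \<phi>c qc C mod_hom_add[OF U(5)] mp np)
  qed
  then show ?thesis by (auto simp: ext_over_def)
qed

section \<open>Push-outs and their universal property\<close>

locale pushout_situation =
  fixes R :: "('r, 's) ring_scheme" and A :: "('r, 'a) module" and X :: "('r, 'x) module"
    and E :: "('r, 'a, 'e, 'x) extension" and Y :: "('r, 'y) module" and \<sigma> :: "'a \<Rightarrow> 'y"
  assumes short_exact: "short_exact R X A E" and Y: "left_module R Y" and \<sigma>: "\<sigma> \<in> mod_hom R A Y"
begin

lemmas E = short_exactD[OF short_exact]

sublocale Y: left_module R Y by (rule Y)
sublocale A: left_module R A by (rule E(2))
sublocale ME: left_module R "mid E" by (rule E(3))

abbreviation "P \<equiv> prod_module Y (mid E)"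
abbreviation "\<nu> \<equiv> \<lambda>a. (\<sigma> a, \<ominus>\<^bsub>mid E\<^esub> inc E a)"

sublocale Q: quotient_by_image R A P \<nu> "\<nu> ` carrier A"
proof (rule quotient_by_image.intro)
  have n: "(\<lambda>a. \<ominus>\<^bsub>mid E\<^esub> inc E a) \<in> mod_hom R A (mid E)"
    by (rule mod_hom_uminus[OF E(3,4)])
  show "\<nu> \<in> mod_hom R A P"
    using mod_hom_closed[OF \<sigma>] mod_hom_closed[OF n]
    by (intro mod_homI) (auto simp: mod_hom_add[OF \<sigma>] mod_hom_smult[OF \<sigma>]
        mod_hom_add[OF n] mod_hom_smult[OF n])
qed (use E Y in \<open>auto intro: left_module_prod\<close>)

lemma q_hom: "(\<lambda>(y, e). prj E e) \<in> mod_hom R P X"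
  using mod_hom_closed[OF E(5)]
  by (intro mod_homI) (auto simp: mod_hom_add[OF E(5)] mod_hom_smult[OF E(5)])

lemma q_\<nu>: "a \<in> carrier A \<Longrightarrow> (\<lambda>(y, e). prj E e) (\<nu> a) = \<zero>\<^bsub>X\<^esub>"
  using mod_hom_closed[OF E(4)] E(7)
    left_module.uminus_zero[OF E(1)]
  by (simp add: mod_hom_minus[OF E(3,1,5)])

lemma short_exact_pushout: "short_exact R X Y (pushout_ext A Y \<sigma> E)"
proof -
  have "short_exact R X Y \<lparr>inc = (\<lambda>y. \<nu> ` carrier A +>\<^bsub>P\<^esub> (y, \<zero>\<^bsub>mid E\<^esub>)),
    mid = quot_module P (\<nu> ` carrier A), prj = (\<lambda>C. the_elem ((\<lambda>(y, e). prj E e) ` C))\<rparr>"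
  proof (rule Q.short_exact_quot[OF Y E(1) _ q_hom _ q_\<nu>])
    show "(\<lambda>y. (y, \<zero>\<^bsub>mid E\<^esub>)) \<in> mod_hom R Y P"
      by (intro mod_homI) auto
    show "(\<lambda>(y, e). prj E e) ` carrier P = carrier X"
    proof (intro equalityI subsetI)
      fix x assume "x \<in> carrier X"
      then obtain e where "e \<in> carrier (mid E)" "prj E e = x" using E(9) by blast
      then show "x \<in> (\<lambda>(y, e). prj E e) ` carrier P" by (auto intro!: image_eqI[of _ _ "(\<zero>\<^bsub>Y\<^esub>, e)"])
    qed (use mod_hom_closed[OF E(5)] in auto)
    show "\<exists>a\<in>carrier A. \<exists>y\<in>carrier Y. p = \<nu> a \<oplus>\<^bsub>P\<^esub> (y, \<zero>\<^bsub>mid E\<^esub>)"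
      if p0: "p \<in> carrier P" "(case p of (y, e) \<Rightarrow> prj E e) = \<zero>\<^bsub>X\<^esub>" for p
    proof -
      obtain y e where p: "p = (y, e)" "y \<in> carrier Y" "e \<in> carrier (mid E)" "prj E e = \<zero>\<^bsub>X\<^esub>"
        using p0 by (cases p) auto
      then obtain a where "a \<in> carrier A" "e = inc E a" using E(8) by blast
      \<comment> \<open>The value of \<nu> at the negative of \<open>a\<close> has second component
        \<open>inc E a\<close>, and adding \<open>\<sigma> a\<close> to \<open>y\<close> cancels its
        first component.\<close>
      then show ?thesis
        using p mod_hom_closed[OF E(4)] mod_hom_closed[OF \<sigma>]
        by (intro bexI[of _ "\<ominus>\<^bsub>A\<^esub> a"] bexI[of _ "\<sigma> a \<oplus>\<^bsub>Y\<^esub> y"])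
          (auto simp: mod_hom_minus[OF E(2,3,4)] mod_hom_minus[OF E(2) Y \<sigma>] Y.r_neg1)
    qed
    show "y = \<zero>\<^bsub>Y\<^esub>" if "a \<in> carrier A" "y \<in> carrier Y" "(y, \<zero>\<^bsub>mid E\<^esub>) = \<nu> a" for a y
    proof -
      have "\<ominus>\<^bsub>mid E\<^esub> inc E a = \<zero>\<^bsub>mid E\<^esub>" "y = \<sigma> a" using that by auto
      then show ?thesis
        using that short_exact_inc_zero[OF short_exact] mod_hom_closed[OF E(4)]
          mod_hom_zero[OF E(2) Y \<sigma>] by (metis ME.minus_minus ME.uminus_zero)
    qed
  qed (use mod_hom_zero[OF E(3,1,5)] in auto)
  then show ?thesis by (simp add: pushout_ext_def Let_def)
qed

text \<open>The second leg of the push-out square. It agrees with \<sigma> on the starting term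
  because the classes of \<open>(\<sigma> a, 0)\<close> and \<open>(0, inc E a)\<close> differ by
  \<open>\<nu> a\<close>.\<close>

lemma pushout_map:
  obtains \<kappa> where "\<kappa> \<in> mod_hom R (mid E) (mid (pushout_ext A Y \<sigma> E))"
    and "\<And>a. a \<in> carrier A \<Longrightarrow> \<kappa> (inc E a) = inc (pushout_ext A Y \<sigma> E) (\<sigma> a)"
    and "\<And>e. e \<in> carrier (mid E) \<Longrightarrow> prj (pushout_ext A Y \<sigma> E) (\<kappa> e) = prj E e"
proof
  let ?\<kappa> = "\<lambda>e. \<nu> ` carrier A +>\<^bsub>P\<^esub> (\<zero>\<^bsub>Y\<^esub>, e)"
  have "(\<lambda>e. (\<zero>\<^bsub>Y\<^esub>, e)) \<in> mod_hom R (mid E) P"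
    by (intro mod_homI) auto
  from mod_hom_compose[OF this Q.coset_hom]
  show "?\<kappa> \<in> mod_hom R (mid E) (mid (pushout_ext A Y \<sigma> E))"
    by (simp add: pushout_ext_def Let_def)
  show "?\<kappa> (inc E a) = inc (pushout_ext A Y \<sigma> E) (\<sigma> a)" if "a \<in> carrier A" for a
  proof -
    have "inc (pushout_ext A Y \<sigma> E) (\<sigma> a) = ?\<kappa> (inc E a)"
      using that mod_hom_closed[OF E(4)] mod_hom_closed[OF \<sigma>]
      unfolding pushout_ext_def Let_def extension.simps
      by (subst Q.coset_eq_iff) (auto intro!: bexI[of _ a] simp: ME.l_neg)
    then show ?thesis by simp
  qed
  show "prj (pushout_ext A Y \<sigma> E) (?\<kappa> e) = prj E e" if "e \<in> carrier (mid E)" for e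
    using Q.quot_map_coset[OF E(1) q_hom q_\<nu>, of "(\<zero>\<^bsub>Y\<^esub>, e)"] that
    by (simp add: pushout_ext_def Let_def)
qed

text \<open>The universal property: \<open>inc V y + m e\<close> vanishes on the relations exactly
  because \<open>m\<close> restricts to \<open>inc V\<close> after \<sigma>.\<close>

lemma pushout_over:
  assumes "short_exact R S Y V" "m \<in> mod_hom R (mid E) (mid V)"
    and "\<And>a. a \<in> carrier A \<Longrightarrow> m (inc E a) = inc V (\<sigma> a)"
    and "\<And>e. e \<in> carrier (mid E) \<Longrightarrow> prj V (m e) = h (prj E e)"
    and "h \<in> mod_hom R X S"
  shows "ext_over R Y (pushout_ext A Y \<sigma> E) V h"
proof -
  note V = short_exactD[OF assms(1)] and m = assms(2)
  interpret MV: left_module R "mid V" by (rule V(3))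
  interpret S: left_module R S by (rule V(1))
  note cl = mod_hom_closed[OF m] mod_hom_closed[OF V(4)] mod_hom_closed[OF E(4)]
    mod_hom_closed[OF \<sigma>]
  let ?\<phi> = "\<lambda>(y, e). inc V y \<oplus>\<^bsub>mid V\<^esub> m e"
  have \<phi>: "?\<phi> \<in> mod_hom R P (mid V)"
    using cl by (intro mod_homI) (auto simp: mod_hom_add[OF m] mod_hom_smult[OF m]
        mod_hom_add[OF V(4)] mod_hom_smult[OF V(4)] MV.smult_r_distr MV.a_ac)
  have \<phi>\<nu>: "?\<phi> (\<nu> a) = \<zero>\<^bsub>mid V\<^esub>" if "a \<in> carrier A" for a
    using that cl by (simp add: mod_hom_minus[OF E(3) V(3) m] assms(3) MV.r_neg)
  note \<phi>c = Q.quot_map_coset[OF V(3) \<phi> \<phi>\<nu>]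
  have "ext_map R Y (pushout_ext A Y \<sigma> E) V h (\<lambda>C. the_elem (?\<phi> ` C))"
    unfolding ext_map_def
  proof (intro conjI ballI)
    show "(\<lambda>C. the_elem (?\<phi> ` C)) \<in> mod_hom R (mid (pushout_ext A Y \<sigma> E)) (mid V)"
      using Q.quot_map_hom[OF V(3) \<phi> \<phi>\<nu>] by (simp add: pushout_ext_def Let_def)
    show "the_elem (?\<phi> ` inc (pushout_ext A Y \<sigma> E) y) = inc V y" if "y \<in> carrier Y" for y
      using that cl mod_hom_zero[OF E(3) V(3) m] by (simp add: pushout_ext_def Let_def \<phi>c)
    fix C assume "C \<in> carrier (mid (pushout_ext A Y \<sigma> E))"
    then have "C \<in> carrier (quot_module P (\<nu> ` carrier A))"
      by (simp add: pushout_ext_def Let_def)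
    then obtain y e where C: "C = \<nu> ` carrier A +>\<^bsub>P\<^esub> (y, e)" and ye: "(y, e) \<in> carrier P"
      unfolding Q.carrier_quot by auto
    then have "prj (pushout_ext A Y \<sigma> E) C = prj E e"
      using Q.quot_map_coset[OF E(1) q_hom q_\<nu>, of "(y, e)"]
      by (simp add: pushout_ext_def Let_def)
    moreover have "prj V (the_elem (?\<phi> ` C)) = h (prj E e)"
      using ye cl V(7) mod_hom_closed[OF assms(5)] mod_hom_closed[OF E(5)]
      by (simp add: C \<phi>c mod_hom_add[OF V(5)] assms(4))
    ultimately show "prj V (the_elem (?\<phi> ` C)) = h (prj (pushout_ext A Y \<sigma> E) C)" by simp
  qed
  then show ?thesis by (auto simp: ext_over_def)
qed

end

section \<open>Direct sums\<close>

lemma direct_sum_simps: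
  "u \<in> carrier (direct_sum I M) \<longleftrightarrow>
    u \<in> (\<Pi>\<^sub>E i\<in>I. carrier (M i)) \<and> finite {i \<in> I. u i \<noteq> \<zero>\<^bsub>M i\<^esub>}"
  "\<zero>\<^bsub>direct_sum I M\<^esub> = (\<lambda>i\<in>I. \<zero>\<^bsub>M i\<^esub>)"
  "u \<oplus>\<^bsub>direct_sum I M\<^esub> v = (\<lambda>i\<in>I. u i \<oplus>\<^bsub>M i\<^esub> v i)"
  "a \<odot>\<^bsub>direct_sum I M\<^esub> u = (\<lambda>i\<in>I. a \<odot>\<^bsub>M i\<^esub> u i)"
  by (auto simp: direct_sum_def)

lemma direct_sum_apply_closed: "u \<in> carrier (direct_sum I M) \<Longrightarrow> i \<in> I \<Longrightarrow> u i \<in> carrier (M i)"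
  by (auto simp: direct_sum_simps)

lemma direct_sum_eqI:
  assumes "u \<in> carrier (direct_sum I M)" "v \<in> carrier (direct_sum I M)" "\<And>i. i \<in> I \<Longrightarrow> u i = v i"
  shows "u = v"
  using assms by (auto simp: direct_sum_simps intro: PiE_ext)

lemma left_module_direct_sum:
  fixes M :: "'i \<Rightarrow> ('r, 'm) module"
  assumes "ring R" "\<And>i. i \<in> I \<Longrightarrow> left_module R (M i)"
  shows "left_module R (direct_sum I M)"
proof -
  let ?D = "direct_sum I M"
  have ab: "abelian_group (M i)" if "i \<in> I" for i
    using assms(2)[OF that] by (rule left_module_abelian_group)
  note G = abelian_groupE[OF ab]
  have z: "\<zero>\<^bsub>M i\<^esub> \<oplus>\<^bsub>M i\<^esub> \<zero>\<^bsub>M i\<^esub> = \<zero>\<^bsub>M i\<^esub>" if "i \<in> I" for i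
    using G(2,5) that by blast
  have add_closed: "u \<oplus>\<^bsub>?D\<^esub> v \<in> carrier ?D" if "u \<in> carrier ?D" "v \<in> carrier ?D" for u v
  proof -
    have "finite ({i \<in> I. u i \<noteq> \<zero>\<^bsub>M i\<^esub>} \<union> {i \<in> I. v i \<noteq> \<zero>\<^bsub>M i\<^esub>})"
      using that by (simp add: direct_sum_simps)
    then have "finite {i \<in> I. u i \<oplus>\<^bsub>M i\<^esub> v i \<noteq> \<zero>\<^bsub>M i\<^esub>}"
      by (rule rev_finite_subset) (auto simp: z)
    then show ?thesis
      using that G(1) by (auto simp: direct_sum_simps PiE_iff cong: conj_cong)
  qed
  have smult_closed: "a \<odot>\<^bsub>?D\<^esub> u \<in> carrier ?D" if "a \<in> carrier R" "u \<in> carrier ?D" for a u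
  proof -
    have "finite {i \<in> I. u i \<noteq> \<zero>\<^bsub>M i\<^esub>}"
      using that by (simp add: direct_sum_simps)
    then have "finite {i \<in> I. a \<odot>\<^bsub>M i\<^esub> u i \<noteq> \<zero>\<^bsub>M i\<^esub>}"
      by (rule rev_finite_subset) (auto simp: left_module.smult_r_zero[OF assms(2)] that)
    then show ?thesis
      using that left_module.smult_closed[OF assms(2)]
      by (auto simp: direct_sum_simps PiE_iff cong: conj_cong)
  qed
  have zero_closed: "\<zero>\<^bsub>?D\<^esub> \<in> carrier ?D"
    using G(2) by (auto simp: direct_sum_simps PiE_iff cong: conj_cong)
  have "abelian_group ?D"
  proof (rule abelian_groupI)
    \<comment> \<open>Scaling by -1 provides the additive inverse, so its finite support is already
      covered by \<open>smult_closed\<close>.\<close>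
    fix u assume u: "u \<in> carrier ?D"
    have "\<ominus>\<^bsub>R\<^esub> \<one>\<^bsub>R\<^esub> \<in> carrier R"
      by (simp add: assms(1) abelian_group.a_inv_closed ring.is_abelian_group ring.ring_simprules(6))
    then have c: "(\<ominus>\<^bsub>R\<^esub> \<one>\<^bsub>R\<^esub>) \<odot>\<^bsub>?D\<^esub> u \<in> carrier ?D" using u smult_closed by blast
    have "((\<ominus>\<^bsub>R\<^esub> \<one>\<^bsub>R\<^esub>) \<odot>\<^bsub>M i\<^esub> u i) \<oplus>\<^bsub>M i\<^esub> u i = \<zero>\<^bsub>M i\<^esub>" if i: "i \<in> I" for i
    proof -
      interpret left_module R "M i" using assms(2) i .
      show ?thesis
        using direct_sum_apply_closed[OF u i] by (metis minus_eq_smult M.l_neg)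
    qed
    then have "((\<ominus>\<^bsub>R\<^esub> \<one>\<^bsub>R\<^esub>) \<odot>\<^bsub>?D\<^esub> u) \<oplus>\<^bsub>?D\<^esub> u = \<zero>\<^bsub>?D\<^esub>"
      by (auto simp: direct_sum_simps)
    then show "\<exists>y\<in>carrier ?D. y \<oplus>\<^bsub>?D\<^esub> u = \<zero>\<^bsub>?D\<^esub>" using c by blast
  next
    fix u v w assume *: "u \<in> carrier ?D" "v \<in> carrier ?D" "w \<in> carrier ?D"
    then show "u \<oplus>\<^bsub>?D\<^esub> v \<oplus>\<^bsub>?D\<^esub> w = u \<oplus>\<^bsub>?D\<^esub> (v \<oplus>\<^bsub>?D\<^esub> w)"
      using direct_sum_apply_closed[OF *(1)] direct_sum_apply_closed[OF *(2)]
        direct_sum_apply_closed[OF *(3)]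
      by (auto simp: direct_sum_simps(3) fun_eq_iff G(3))
  next
    fix u v assume *: "u \<in> carrier ?D" "v \<in> carrier ?D"
    then show "u \<oplus>\<^bsub>?D\<^esub> v = v \<oplus>\<^bsub>?D\<^esub> u"
      using direct_sum_apply_closed[OF *(1)] direct_sum_apply_closed[OF *(2)]
      by (auto simp: direct_sum_simps(3) fun_eq_iff intro: G(4))
  next
    fix u assume *: "u \<in> carrier ?D"
    show "\<zero>\<^bsub>?D\<^esub> \<oplus>\<^bsub>?D\<^esub> u = u"
      using direct_sum_apply_closed[OF *]
      by (intro direct_sum_eqI[OF add_closed[OF zero_closed *] *])
        (auto simp: direct_sum_simps(2,3) G(5))
  qed (use add_closed zero_closed in auto)
  moreover have "left_module_axioms R ?D"
  proof
    fix u assume *: "u \<in> carrier ?D"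
    have "\<one>\<^bsub>R\<^esub> \<in> carrier R" using assms(1) by (rule ring.ring_simprules(6))
    then show "\<one>\<^bsub>R\<^esub> \<odot>\<^bsub>?D\<^esub> u = u"
      using direct_sum_apply_closed[OF *] left_module.smult_one[OF assms(2)]
      by (intro direct_sum_eqI[OF smult_closed[OF _ *] *]) (auto simp: direct_sum_simps(4))
  next
    fix a b u assume a: "a \<in> carrier R" "b \<in> carrier R" and *: "u \<in> carrier ?D"
    show "(a \<oplus>\<^bsub>R\<^esub> b) \<odot>\<^bsub>?D\<^esub> u = a \<odot>\<^bsub>?D\<^esub> u \<oplus>\<^bsub>?D\<^esub> b \<odot>\<^bsub>?D\<^esub> u"
      "(a \<otimes>\<^bsub>R\<^esub> b) \<odot>\<^bsub>?D\<^esub> u = a \<odot>\<^bsub>?D\<^esub> (b \<odot>\<^bsub>?D\<^esub> u)"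
      using direct_sum_apply_closed[OF *] a
      by (auto simp: direct_sum_simps(3,4) fun_eq_iff left_module.smult_l_distr[OF assms(2)]
          left_module.smult_assoc1[OF assms(2)])
  next
    fix a u v assume a: "a \<in> carrier R" and *: "u \<in> carrier ?D" "v \<in> carrier ?D"
    show "a \<odot>\<^bsub>?D\<^esub> (u \<oplus>\<^bsub>?D\<^esub> v) = a \<odot>\<^bsub>?D\<^esub> u \<oplus>\<^bsub>?D\<^esub> a \<odot>\<^bsub>?D\<^esub> v"
      using direct_sum_apply_closed[OF *(1)] direct_sum_apply_closed[OF *(2)] a
      by (auto simp: direct_sum_simps(3,4) fun_eq_iff left_module.smult_r_distr[OF assms(2)])
  qed (use smult_closed in auto)
  ultimately show ?thesis
    using assms(1) by (intro left_module.intro)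
qed

text \<open>The canonical injection of the summand \<open>p\<close>, extensional on \<open>I\<close>
  like all elements of the direct sum; of the family \<open>M\<close> only the zeros enter.\<close>

definition ds_inj :: "'i set \<Rightarrow> ('i \<Rightarrow> ('r, 'm) module) \<Rightarrow> 'i \<Rightarrow> 'm \<Rightarrow> 'i \<Rightarrow> 'm"
  where "ds_inj I M p x = (\<lambda>q\<in>I. if q = p then x else \<zero>\<^bsub>M q\<^esub>)"

section \<open>Homomorphisms into and out of a direct sum\<close>

locale module_family =
  fixes R :: "('r, 's) ring_scheme" and I :: "'i set" and M :: "'i \<Rightarrow> ('r, 'm) module"
  assumes R: "ring R" and M: "\<And>i. i \<in> I \<Longrightarrow> left_module R (M i)"
begin

lemma left_module_sum: "left_module R (direct_sum I M)"
  using R M by (rule left_module_direct_sum)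

sublocale D: left_module R "direct_sum I M"
  by (rule left_module_sum)

lemmas G = abelian_groupE[OF left_module_abelian_group[OF M]]

lemma proj_hom:
  assumes "p \<in> I" shows "(\<lambda>u. u p) \<in> mod_hom R (direct_sum I M) (M p)"
  using assms by (intro mod_homI) (auto simp: direct_sum_apply_closed, auto simp: direct_sum_simps)

lemma ds_inj_hom:
  assumes p: "p \<in> I" shows "ds_inj I M p \<in> mod_hom R (M p) (direct_sum I M)"
proof (rule mod_homI)
  fix x assume "x \<in> carrier (M p)"
  moreover have "finite {i \<in> I. ds_inj I M p x i \<noteq> \<zero>\<^bsub>M i\<^esub>}"
    by (rule finite_subset[of _ "{p}"]) (auto simp: ds_inj_def)
  ultimately show "ds_inj I M p x \<in> carrier (direct_sum I M)"
    using G(2) by (auto simp: direct_sum_simps ds_inj_def PiE_iff)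
next
  fix x y show "ds_inj I M p (x \<oplus>\<^bsub>M p\<^esub> y) = ds_inj I M p x \<oplus>\<^bsub>direct_sum I M\<^esub> ds_inj I M p y"
    using G(2,5) by (auto simp: direct_sum_simps ds_inj_def fun_eq_iff)
next
  fix a x assume "a \<in> carrier R"
  then show "ds_inj I M p (a \<odot>\<^bsub>M p\<^esub> x) = a \<odot>\<^bsub>direct_sum I M\<^esub> ds_inj I M p x"
    by (auto simp: direct_sum_simps ds_inj_def fun_eq_iff left_module.smult_r_zero[OF M])
qed

lemmas ds_inj_closed = mod_hom_closed[OF ds_inj_hom]

text \<open>Induction on a finite set that bounds the support: setting the coordinate
  \<open>p\<close> to zero removes \<open>p\<close> from the bound, and the injection of that
  coordinate restores the element.\<close>

lemma direct_sum_induct [consumes 1, case_names zero add]: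
  assumes "u \<in> carrier (direct_sum I M)" "Q \<zero>\<^bsub>direct_sum I M\<^esub>"
    and add: "\<And>p x v. p \<in> I \<Longrightarrow> x \<in> carrier (M p) \<Longrightarrow> v \<in> carrier (direct_sum I M) \<Longrightarrow> Q v \<Longrightarrow>
      Q (ds_inj I M p x \<oplus>\<^bsub>direct_sum I M\<^esub> v)"
  shows "Q u"
proof -
  have "\<forall>u\<in>carrier (direct_sum I M). {i \<in> I. u i \<noteq> \<zero>\<^bsub>M i\<^esub>} \<subseteq> S \<longrightarrow> Q u" if "finite S" for S
    using that
  proof induction
    case empty
    show ?case
    proof (intro ballI impI)
      fix u assume u: "u \<in> carrier (direct_sum I M)" "{i \<in> I. u i \<noteq> \<zero>\<^bsub>M i\<^esub>} \<subseteq> {}"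
      then have "u = \<zero>\<^bsub>direct_sum I M\<^esub>"
        by (intro direct_sum_eqI[OF u(1) D.zero_closed]) (auto simp: direct_sum_simps)
      then show "Q u" using assms(2) by simp
    qed
  next
    case (insert p S)
    show ?case
    proof (intro ballI impI)
      fix u assume u: "u \<in> carrier (direct_sum I M)" "{i \<in> I. u i \<noteq> \<zero>\<^bsub>M i\<^esub>} \<subseteq> insert p S"
      show "Q u"
      proof (cases "p \<in> I")
        case False
        then show ?thesis using u insert.IH by auto
      next
        case p: True
        define v where "v = (\<lambda>i\<in>I. if i = p then \<zero>\<^bsub>M i\<^esub> else u i)"
        have "finite {i \<in> I. u i \<noteq> \<zero>\<^bsub>M i\<^esub>}" using u by (simp add: direct_sum_simps)
        then have "finite {i \<in> I. v i \<noteq> \<zero>\<^bsub>M i\<^esub>}"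
          by (rule rev_finite_subset) (auto simp: v_def)
        then have v: "v \<in> carrier (direct_sum I M)"
          using u(1) G(2) by (auto simp: v_def direct_sum_simps PiE_iff)
        moreover have "{i \<in> I. v i \<noteq> \<zero>\<^bsub>M i\<^esub>} \<subseteq> S" using u(2) by (auto simp: v_def)
        ultimately have "Q v" using insert.IH by blast
        moreover have up: "u p \<in> carrier (M p)" using u(1) p by (rule direct_sum_apply_closed)
        moreover have "u = ds_inj I M p (u p) \<oplus>\<^bsub>direct_sum I M\<^esub> v"
          using direct_sum_apply_closed[OF u(1)] G(2,4,5) up p
          by (intro direct_sum_eqI[OF u(1) D.a_closed[OF ds_inj_closed[OF p up] v]])
            (auto simp: direct_sum_simps ds_inj_def v_def)
        ultimately show ?thesis using add[OF p up v] by simp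
      qed
    qed
  qed
  then show ?thesis using assms(1) by (auto simp: direct_sum_simps)
qed

lemma direct_sum_hom_eq:
  assumes "left_module R N" "f \<in> mod_hom R (direct_sum I M) N" "g \<in> mod_hom R (direct_sum I M) N"
    and "\<And>p x. p \<in> I \<Longrightarrow> x \<in> carrier (M p) \<Longrightarrow> f (ds_inj I M p x) = g (ds_inj I M p x)"
    and "u \<in> carrier (direct_sum I M)"
  shows "f u = g u"
  using assms(5)
proof (induction rule: direct_sum_induct)
  case zero
  then show ?case
    using mod_hom_zero[OF left_module_sum assms(1,2)] mod_hom_zero[OF left_module_sum assms(1,3)]
    by simp
next
  case (add p x v)
  then show ?case
    using ds_inj_closed[of p x] assms(4)
    by (simp add: mod_hom_add[OF assms(2)] mod_hom_add[OF assms(3)])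
qed

text \<open>The homomorphism out of the direct sum with components \<open>h p\<close>. The sum runs
  over the support of \<open>u\<close>, so that identity components yield
  \<open>summation_map\<close> literally.\<close>

definition ds_lift :: "('r, 'n) module \<Rightarrow> ('i \<Rightarrow> 'm \<Rightarrow> 'n) \<Rightarrow> ('i \<Rightarrow> 'm) \<Rightarrow> 'n"
  where "ds_lift N h u = (\<Oplus>\<^bsub>N\<^esub>p\<in>{p \<in> I. u p \<noteq> \<zero>\<^bsub>M p\<^esub>}. h p (u p))"

context
  fixes N :: "('r, 'n) module" and h :: "'i \<Rightarrow> 'm \<Rightarrow> 'n"
  assumes N: "left_module R N" and h: "\<And>p. p \<in> I \<Longrightarrow> h p \<in> mod_hom R (M p) N"
begin

interpretation N: left_module R N by (rule N)

text \<open>Terms outside the support vanish. With a common larger index set, sums over the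
  different supports of \<open>u\<close>, \<open>v\<close> and their sum can be compared.\<close>

lemma ds_lift_superset:
  assumes "u \<in> carrier (direct_sum I M)" "finite S" "{p \<in> I. u p \<noteq> \<zero>\<^bsub>M p\<^esub>} \<subseteq> S" "S \<subseteq> I"
  shows "ds_lift N h u = (\<Oplus>\<^bsub>N\<^esub>p\<in>S. h p (u p))"
  unfolding ds_lift_def
  using assms direct_sum_apply_closed[OF assms(1)] mod_hom_closed[OF h] mod_hom_zero[OF M N h]
  by (intro N.add.finprod_mono_neutral_cong_left) auto

lemma smult_finsum:
  assumes "finite S" "a \<in> carrier R" "f \<in> S \<rightarrow> carrier N"
  shows "a \<odot>\<^bsub>N\<^esub> (\<Oplus>\<^bsub>N\<^esub>p\<in>S. f p) = (\<Oplus>\<^bsub>N\<^esub>p\<in>S. a \<odot>\<^bsub>N\<^esub> f p)"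
  using assms(1,3)
proof induction
  case (insert p S)
  then show ?case
    using assms(2) by (simp add: N.finsum_insert Pi_iff N.smult_r_distr)
qed (use assms(2) in simp)

lemma ds_lift_hom: "ds_lift N h \<in> mod_hom R (direct_sum I M) N"
proof (rule mod_homI)
  fix u assume u: "u \<in> carrier (direct_sum I M)"
  let ?S = "{p \<in> I. u p \<noteq> \<zero>\<^bsub>M p\<^esub>}"
  have fin: "finite ?S" using u by (simp add: direct_sum_simps)
  have hu: "h p (u p) \<in> carrier N" if "p \<in> I" for p
    using direct_sum_apply_closed[OF u that] mod_hom_closed[OF h[OF that]] by blast
  show "ds_lift N h u \<in> carrier N"
    using hu unfolding ds_lift_def by (intro N.finsum_closed) auto
  {
    fix a assume a: "a \<in> carrier R"
    have au: "a \<odot>\<^bsub>direct_sum I M\<^esub> u \<in> carrier (direct_sum I M)" using a u by simp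
    have "ds_lift N h (a \<odot>\<^bsub>direct_sum I M\<^esub> u) = (\<Oplus>\<^bsub>N\<^esub>p\<in>?S. h p ((a \<odot>\<^bsub>direct_sum I M\<^esub> u) p))"
      using fin a by (intro ds_lift_superset[OF au])
        (auto simp: direct_sum_simps left_module.smult_r_zero[OF M])
    also have "\<dots> = (\<Oplus>\<^bsub>N\<^esub>p\<in>?S. a \<odot>\<^bsub>N\<^esub> h p (u p))"
      using a hu direct_sum_apply_closed[OF u]
      by (intro N.add.finprod_cong') (auto simp: direct_sum_simps mod_hom_smult[OF h])
    also have "\<dots> = a \<odot>\<^bsub>N\<^esub> ds_lift N h u"
      using fin a hu by (simp add: ds_lift_def smult_finsum)
    finally show "ds_lift N h (a \<odot>\<^bsub>direct_sum I M\<^esub> u) = a \<odot>\<^bsub>N\<^esub> ds_lift N h u" .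
  }
  fix v assume v: "v \<in> carrier (direct_sum I M)"
  have hv: "h p (v p) \<in> carrier N" if "p \<in> I" for p
    using direct_sum_apply_closed[OF v that] mod_hom_closed[OF h[OF that]] by blast
  let ?T = "?S \<union> {p \<in> I. v p \<noteq> \<zero>\<^bsub>M p\<^esub>}"
  have T: "finite ?T" using fin v by (simp add: direct_sum_simps)
  have uv: "u \<oplus>\<^bsub>direct_sum I M\<^esub> v \<in> carrier (direct_sum I M)" using u v by simp
  have "ds_lift N h (u \<oplus>\<^bsub>direct_sum I M\<^esub> v) = (\<Oplus>\<^bsub>N\<^esub>p\<in>?T. h p ((u \<oplus>\<^bsub>direct_sum I M\<^esub> v) p))"
    using T G(2,5) by (intro ds_lift_superset[OF uv]) (auto simp: direct_sum_simps)
  also have "\<dots> = (\<Oplus>\<^bsub>N\<^esub>p\<in>?T. h p (u p) \<oplus>\<^bsub>N\<^esub> h p (v p))"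
    using hu hv direct_sum_apply_closed[OF u] direct_sum_apply_closed[OF v]
    by (intro N.add.finprod_cong') (auto simp: direct_sum_simps mod_hom_add[OF h])
  also have "\<dots> = (\<Oplus>\<^bsub>N\<^esub>p\<in>?T. h p (u p)) \<oplus>\<^bsub>N\<^esub> (\<Oplus>\<^bsub>N\<^esub>p\<in>?T. h p (v p))"
    using hu hv by (intro N.finsum_addf) auto
  also have "\<dots> = ds_lift N h u \<oplus>\<^bsub>N\<^esub> ds_lift N h v"
    using T by (subst (1 2) ds_lift_superset[where S = ?T]) (use u v in auto)
  finally show "ds_lift N h (u \<oplus>\<^bsub>direct_sum I M\<^esub> v) = ds_lift N h u \<oplus>\<^bsub>N\<^esub> ds_lift N h v" .
qed

lemma ds_lift_ds_inj:
  assumes "p \<in> I" "x \<in> carrier (M p)"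
  shows "ds_lift N h (ds_inj I M p x) = h p x"
proof -
  have "ds_lift N h (ds_inj I M p x) = (\<Oplus>\<^bsub>N\<^esub>q\<in>{p}. h q (ds_inj I M p x q))"
    using assms by (intro ds_lift_superset[OF ds_inj_closed]) (auto simp: ds_inj_def)
  also have "\<dots> = h p x"
    using assms mod_hom_closed[OF h[OF assms(1)] assms(2)]
    by (simp add: N.finsum_insert ds_inj_def)
  finally show ?thesis .
qed

lemma direct_sum_lift:
  "\<exists>g\<in>mod_hom R (direct_sum I M) N. \<forall>p\<in>I. \<forall>x\<in>carrier (M p). g (ds_inj I M p x) = h p x"
  using ds_lift_hom ds_lift_ds_inj by blast

end

end

lemma summation_map_eq: "summation_map P Y = module_family.ds_lift P (\<lambda>_. Y) Y (\<lambda>_ y. y)"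
  if "module_family R P (\<lambda>_. Y)"
  by (rule ext) (simp add: summation_map_def module_family.ds_lift_def[OF that])

lemma ds_map_hom:
  assumes "\<And>p. p \<in> P \<Longrightarrow> left_module R (M p)" "\<And>p. p \<in> P \<Longrightarrow> left_module R (N p)"
    and "\<And>p. p \<in> P \<Longrightarrow> f p \<in> mod_hom R (M p) (N p)"
  shows "(\<lambda>u. \<lambda>p\<in>P. f p (u p)) \<in> mod_hom R (direct_sum P M) (direct_sum P N)"
proof (rule mod_homI)
  fix u assume u: "u \<in> carrier (direct_sum P M)"
  then have "finite {p \<in> P. u p \<noteq> \<zero>\<^bsub>M p\<^esub>}" by (simp add: direct_sum_simps)
  then have "finite {p \<in> P. f p (u p) \<noteq> \<zero>\<^bsub>N p\<^esub>}"
    by (rule rev_finite_subset) (auto simp: mod_hom_zero[OF assms])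
  then show "(\<lambda>p\<in>P. f p (u p)) \<in> carrier (direct_sum P N)"
    using direct_sum_apply_closed[OF u] mod_hom_closed[OF assms(3)]
    by (auto simp: direct_sum_simps cong: conj_cong)
next
  fix u v assume "u \<in> carrier (direct_sum P M)" "v \<in> carrier (direct_sum P M)"
  then show "(\<lambda>p\<in>P. f p ((u \<oplus>\<^bsub>direct_sum P M\<^esub> v) p)) =
    (\<lambda>p\<in>P. f p (u p)) \<oplus>\<^bsub>direct_sum P N\<^esub> (\<lambda>p\<in>P. f p (v p))"
    by (auto simp: direct_sum_simps fun_eq_iff mod_hom_add[OF assms(3)] PiE_iff)
next
  fix a u assume "a \<in> carrier R" "u \<in> carrier (direct_sum P M)"
  then show "(\<lambda>p\<in>P. f p ((a \<odot>\<^bsub>direct_sum P M\<^esub> u) p)) = a \<odot>\<^bsub>direct_sum P N\<^esub> (\<lambda>p\<in>P. f p (u p))"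
    by (auto simp: direct_sum_simps fun_eq_iff mod_hom_smult[OF assms(3)] PiE_iff)
qed

lemma ds_map_ds_inj:
  assumes "\<And>p. p \<in> P \<Longrightarrow> left_module R (M p)" "\<And>p. p \<in> P \<Longrightarrow> left_module R (N p)"
    and "\<And>p. p \<in> P \<Longrightarrow> f p \<in> mod_hom R (M p) (N p)"
  shows "(\<lambda>q\<in>P. f q (ds_inj P M p x q)) = ds_inj P N p (f p x)"
  using mod_hom_zero[OF assms] by (auto simp: ds_inj_def fun_eq_iff)

section \<open>Direct sums of extensions and the universal extension of a family\<close>

locale extension_family =
  fixes R :: "('r, 's) ring_scheme" and P :: "'p set" and Y :: "('r, 'y) module"
    and X :: "'p \<Rightarrow> ('r, 'x) module" and E :: "'p \<Rightarrow> ('r, 'y, 'e, 'x) extension"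
  assumes R: "ring R" and Y: "left_module R Y"
    and E: "\<And>p. p \<in> P \<Longrightarrow> short_exact R (X p) Y (E p)"
begin

lemmas ED = short_exactD[OF E]

sublocale FX: module_family R P X
  using R ED(1) by (rule module_family.intro)

sublocale FY: module_family R P "\<lambda>_. Y"
  using R Y by (rule module_family.intro)

sublocale FM: module_family R P "\<lambda>p. mid (E p)"
  using R ED(3) by (rule module_family.intro)

lemma short_exact_direct_sum:
  "short_exact R (direct_sum P X) (direct_sum P (\<lambda>_. Y)) (direct_sum_ext P E)"
proof -
  let ?F = "direct_sum_ext P E"
  have ih: "inc ?F \<in> mod_hom R (direct_sum P (\<lambda>_. Y)) (mid ?F)"
    using ds_map_hom[of P R "\<lambda>_. Y" "\<lambda>p. mid (E p)" "\<lambda>p. inc (E p)"] ED by (simp add: direct_sum_ext_def)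
  have ph: "prj ?F \<in> mod_hom R (mid ?F) (direct_sum P X)"
    using ds_map_hom[of P R "\<lambda>p. mid (E p)" X "\<lambda>p. prj (E p)"] ED by (simp add: direct_sum_ext_def)
  have mid: "left_module R (mid ?F)"
    using FM.left_module_sum by (simp add: direct_sum_ext_def)
  have zero: "inc (E p) \<zero>\<^bsub>Y\<^esub> = \<zero>\<^bsub>mid (E p)\<^esub>" "prj (E p) \<zero>\<^bsub>mid (E p)\<^esub> = \<zero>\<^bsub>X p\<^esub>" if "p \<in> P" for p
    using mod_hom_zero[OF ED(2,3,4)] mod_hom_zero[OF ED(3,1,5)] that by auto
  have "inj_on (inc ?F) (carrier (direct_sum P (\<lambda>_. Y)))"
  proof (rule inj_onI)
    fix u v assume *: "u \<in> carrier (direct_sum P (\<lambda>_. Y))" "v \<in> carrier (direct_sum P (\<lambda>_. Y))"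
      "inc ?F u = inc ?F v"
    have "u p = v p" if p: "p \<in> P" for p
    proof -
      have "inc (E p) (u p) = inc (E p) (v p)"
        using fun_cong[OF *(3), of p] p by (simp add: direct_sum_ext_def)
      then show ?thesis
        using inj_onD[OF ED(6)[OF p]] direct_sum_apply_closed[OF *(1) p]
          direct_sum_apply_closed[OF *(2) p] by blast
    qed
    then show "u = v" by (rule direct_sum_eqI[OF *(1,2)])
  qed
  moreover have "inc ?F ` carrier (direct_sum P (\<lambda>_. Y)) = a_kernel (mid ?F) (direct_sum P X) (prj ?F)"
  proof (intro equalityI subsetI)
    fix w assume "w \<in> inc ?F ` carrier (direct_sum P (\<lambda>_. Y))"
    then obtain u where u: "u \<in> carrier (direct_sum P (\<lambda>_. Y))" "w = inc ?F u" by blast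
    then show "w \<in> a_kernel (mid ?F) (direct_sum P X) (prj ?F)"
      using mod_hom_closed[OF ih u(1)] direct_sum_apply_closed[OF u(1)] ED(7)
      by (auto simp: a_kernel_def') (auto simp: direct_sum_ext_def direct_sum_simps(2) fun_eq_iff)
  next
    fix w assume "w \<in> a_kernel (mid ?F) (direct_sum P X) (prj ?F)"
    then have w: "w \<in> carrier (direct_sum P (\<lambda>p. mid (E p)))"
      and w0: "prj ?F w = \<zero>\<^bsub>direct_sum P X\<^esub>"
      by (auto simp: a_kernel_def' direct_sum_ext_def)
    have "\<exists>y\<in>carrier Y. w p = inc (E p) y" if p: "p \<in> P" for p
      using ED(8)[OF p direct_sum_apply_closed[OF w p]] fun_cong[OF w0, of p] p
      by (simp add: direct_sum_ext_def direct_sum_simps)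
    then obtain y where y: "\<And>p. p \<in> P \<Longrightarrow> y p \<in> carrier Y" "\<And>p. p \<in> P \<Longrightarrow> w p = inc (E p) (y p)"
      by metis
    \<comment> \<open>Injectivity of the inclusions gives the preimage the same support as
      \<open>w\<close>, hence a finite one.\<close>
    have y0: "y p = \<zero>\<^bsub>Y\<^esub> \<longleftrightarrow> w p = \<zero>\<^bsub>mid (E p)\<^esub>" if "p \<in> P" for p
      using y that zero short_exact_inc_zero[OF E] by metis
    have "finite {p \<in> P. w p \<noteq> \<zero>\<^bsub>mid (E p)\<^esub>}" using w by (simp add: direct_sum_simps)
    then have "restrict y P \<in> carrier (direct_sum P (\<lambda>_. Y))"
      using y(1) y0 by (auto simp: direct_sum_simps cong: conj_cong)
    moreover from mod_hom_closed[OF ih this] have "w = inc ?F (restrict y P)"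
      using y(2) by (intro direct_sum_eqI[OF w]) (simp_all add: direct_sum_ext_def)
    ultimately show "w \<in> inc ?F ` carrier (direct_sum P (\<lambda>_. Y))" by blast
  qed
  moreover have "prj ?F ` carrier (mid ?F) = carrier (direct_sum P X)"
  proof (intro equalityI subsetI)
    fix v assume v: "v \<in> carrier (direct_sum P X)"
    \<comment> \<open>Over a zero coordinate the lift is required to be zero; an arbitrary choice of
      lifts could have infinite support.\<close>
    have "\<exists>e\<in>carrier (mid (E p)). prj (E p) e = v p \<and> (v p = \<zero>\<^bsub>X p\<^esub> \<longrightarrow> e = \<zero>\<^bsub>mid (E p)\<^esub>)"
      if p: "p \<in> P" for p
      using ED(9)[OF p direct_sum_apply_closed[OF v p]] zero[OF p] FM.G(2)[OF p]
      by (cases "v p = \<zero>\<^bsub>X p\<^esub>") auto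
    then obtain e where e: "\<And>p. p \<in> P \<Longrightarrow> e p \<in> carrier (mid (E p))"
      "\<And>p. p \<in> P \<Longrightarrow> prj (E p) (e p) = v p"
      "\<And>p. p \<in> P \<Longrightarrow> v p = \<zero>\<^bsub>X p\<^esub> \<Longrightarrow> e p = \<zero>\<^bsub>mid (E p)\<^esub>"
      by metis
    have "finite {p \<in> P. v p \<noteq> \<zero>\<^bsub>X p\<^esub>}" using v by (simp add: direct_sum_simps)
    then have "finite {p \<in> P. e p \<noteq> \<zero>\<^bsub>mid (E p)\<^esub>}"
      by (rule rev_finite_subset) (use e(3) in auto)
    then have "restrict e P \<in> carrier (mid ?F)"
      using e(1) by (auto simp: direct_sum_ext_def direct_sum_simps cong: conj_cong)
    moreover from mod_hom_closed[OF ph this] have "v = prj ?F (restrict e P)"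
      using e(2) by (intro direct_sum_eqI[OF v]) (simp_all add: direct_sum_ext_def)
    ultimately show "v \<in> prj ?F ` carrier (mid ?F)" by blast
  qed (use mod_hom_closed[OF ph] in auto)
  ultimately show ?thesis
    using FX.left_module_sum FY.left_module_sum mid ih ph by (simp add: short_exact_def)
qed

lemma summation_map_hom: "summation_map P Y \<in> mod_hom R (direct_sum P (\<lambda>_. Y)) Y"
  unfolding summation_map_eq[OF FY.module_family_axioms]
  by (rule FY.ds_lift_hom[OF Y mod_hom_id])

lemma summation_map_ds_inj:
  "p \<in> P \<Longrightarrow> y \<in> carrier Y \<Longrightarrow> summation_map P Y (ds_inj P (\<lambda>_. Y) p y) = y"
  unfolding summation_map_eq[OF FY.module_family_axioms]
  by (rule FY.ds_lift_ds_inj[OF Y mod_hom_id])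

sublocale pushout_situation R "direct_sum P (\<lambda>_. Y)" "direct_sum P X" "direct_sum_ext P E" Y
    "summation_map P Y"
  using short_exact_direct_sum Y summation_map_hom by (rule pushout_situation.intro)

text \<open>The family is arbitrary, since the construction serves twice: for the bases over a
  semibrick, and for sequences of classes with one fixed right-hand term X, where it compares
  elements of Ext^1(X, Y).\<close>

definition "universal = pushout_ext (direct_sum P (\<lambda>_. Y)) Y (summation_map P Y) (direct_sum_ext P E)"

lemma short_exact_universal: "short_exact R (direct_sum P X) Y universal"
  unfolding universal_def by (rule short_exact_pushout)

text \<open>Embed the sequence as the summand \<open>p\<close> and continue into the push-out. On Y
  the composite is the identity, because the summation map adds up a family concentrated at
  \<open>p\<close>.\<close>

lemma over_universal:
  assumes p: "p \<in> P" shows "ext_over R Y (E p) universal (ds_inj P X p)"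
proof -
  obtain \<kappa> where \<kappa>: "\<kappa> \<in> mod_hom R (mid (direct_sum_ext P E)) (mid universal)"
    and \<kappa>i: "\<And>a. a \<in> carrier (direct_sum P (\<lambda>_. Y)) \<Longrightarrow>
      \<kappa> (inc (direct_sum_ext P E) a) = inc universal (summation_map P Y a)"
    and \<kappa>p: "\<And>e. e \<in> carrier (mid (direct_sum_ext P E)) \<Longrightarrow>
      prj universal (\<kappa> e) = prj (direct_sum_ext P E) e"
    using pushout_map unfolding universal_def by blast
  let ?j = "ds_inj P (\<lambda>p. mid (E p)) p"
  have j: "?j \<in> mod_hom R (mid (E p)) (mid (direct_sum_ext P E))"
    using FM.ds_inj_hom[OF p] by (simp add: direct_sum_ext_def)
  have "inc (direct_sum_ext P E) (ds_inj P (\<lambda>_. Y) p y) = ?j (inc (E p) y)" for y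
    using ds_map_ds_inj[of P R "\<lambda>_. Y" "\<lambda>p. mid (E p)" "\<lambda>p. inc (E p)"] ED
    by (simp add: direct_sum_ext_def)
  then have "\<kappa> (?j (inc (E p) y)) = inc universal y" if "y \<in> carrier Y" for y
    using \<kappa>i[OF FY.ds_inj_closed[OF p that]] summation_map_ds_inj[OF p that] by simp
  moreover have "prj (direct_sum_ext P E) (?j e) = ds_inj P X p (prj (E p) e)" for e
    using ds_map_ds_inj[of P R "\<lambda>p. mid (E p)" X "\<lambda>p. prj (E p)"] ED
    by (simp add: direct_sum_ext_def)
  then have "prj universal (\<kappa> (?j e)) = ds_inj P X p (prj (E p) e)" if "e \<in> carrier (mid (E p))" for e
    using \<kappa>p[OF mod_hom_closed[OF j that]] by simp
  ultimately show ?thesis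
    using mod_hom_compose[OF j \<kappa>] by (auto simp: ext_over_def ext_map_def)
qed

text \<open>Morphisms from the single sequences combine to a map on the direct sum of the middle
  terms. Both compatibility conditions for the push-out are equations between homomorphisms on
  direct sums and are checked on the summands.\<close>

lemma universal_over:
  assumes V: "short_exact R S Y V" and h: "h \<in> mod_hom R (direct_sum P X) S"
    and over: "\<And>p. p \<in> P \<Longrightarrow> ext_over R Y (E p) V (\<lambda>x. h (ds_inj P X p x))"
  shows "ext_over R Y universal V h"
proof -
  note VD = short_exactD[OF V]
  obtain m where m: "\<And>p. p \<in> P \<Longrightarrow> ext_map R Y (E p) V (\<lambda>x. h (ds_inj P X p x)) (m p)"
    using over unfolding ext_over_def by metis
  have mh: "m p \<in> mod_hom R (mid (E p)) (mid V)" if "p \<in> P" for p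
    using m[OF that] by (simp add: ext_map_def)
  let ?F = "direct_sum_ext P E"
  let ?m = "FM.ds_lift (mid V) m"
  have mF: "mid ?F = direct_sum P (\<lambda>p. mid (E p))" by (simp add: direct_sum_ext_def)
  have m': "?m \<in> mod_hom R (mid ?F) (mid V)"
    unfolding mF by (rule FM.ds_lift_hom[OF VD(3) mh])
  have "?m (inc ?F a) = inc V (summation_map P Y a)" if "a \<in> carrier (direct_sum P (\<lambda>_. Y))" for a
  proof (rule FY.direct_sum_hom_eq[OF VD(3) _ _ _ that])
    show "(\<lambda>a. ?m (inc ?F a)) \<in> mod_hom R (direct_sum P (\<lambda>_. Y)) (mid V)"
      using short_exactD(4)[OF short_exact_direct_sum] m' by (rule mod_hom_compose)
    show "(\<lambda>a. inc V (summation_map P Y a)) \<in> mod_hom R (direct_sum P (\<lambda>_. Y)) (mid V)"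
      using summation_map_hom VD(4) by (rule mod_hom_compose)
    fix p y assume p: "p \<in> P" and y: "y \<in> carrier Y"
    have "inc ?F (ds_inj P (\<lambda>_. Y) p y) = ds_inj P (\<lambda>p. mid (E p)) p (inc (E p) y)"
      using ds_map_ds_inj[of P R "\<lambda>_. Y" "\<lambda>p. mid (E p)" "\<lambda>p. inc (E p)"] ED
      by (simp add: direct_sum_ext_def)
    then show "?m (inc ?F (ds_inj P (\<lambda>_. Y) p y)) = inc V (summation_map P Y (ds_inj P (\<lambda>_. Y) p y))"
      using FM.ds_lift_ds_inj[OF VD(3) mh p mod_hom_closed[OF ED(4)[OF p] y]] m[OF p] y
      by (simp add: summation_map_ds_inj[OF p y] ext_map_def)
  qed
  moreover have "prj V (?m e) = h (prj ?F e)" if "e \<in> carrier (mid ?F)" for e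
  proof (rule FM.direct_sum_hom_eq[OF VD(1) _ _ _ that[unfolded mF]])
    show "(\<lambda>e. prj V (?m e)) \<in> mod_hom R (direct_sum P (\<lambda>p. mid (E p))) S"
      using m' VD(5) unfolding mF by (rule mod_hom_compose)
    show "(\<lambda>e. h (prj ?F e)) \<in> mod_hom R (direct_sum P (\<lambda>p. mid (E p))) S"
      using short_exactD(5)[OF short_exact_direct_sum] h unfolding mF by (rule mod_hom_compose)
    fix p e assume p: "p \<in> P" and e: "e \<in> carrier (mid (E p))"
    have "prj ?F (ds_inj P (\<lambda>p. mid (E p)) p e) = ds_inj P X p (prj (E p) e)"
      using ds_map_ds_inj[of P R "\<lambda>p. mid (E p)" X "\<lambda>p. prj (E p)"] ED
      by (simp add: direct_sum_ext_def)
    then show "prj V (?m (ds_inj P (\<lambda>p. mid (E p)) p e)) = h (prj ?F (ds_inj P (\<lambda>p. mid (E p)) p e))"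
      using FM.ds_lift_ds_inj[OF VD(3) mh p e] m[OF p] e by (simp add: ext_map_def)
  qed
  ultimately show ?thesis
    unfolding universal_def using pushout_over[OF V m' _ _ h] by blast
qed

end

section \<open>The addition of \<open>Ext\<^sup>1\<close>\<close>

text \<open>After the surjection \<open>prj E\<close> the map \<open>h\<close> equals the
  homomorphism \<open>prj U\<close> after \<open>m\<close>, and its additivity and linearity
  descend.\<close>

lemma ext_over_hom:
  assumes "short_exact R X Y E" "short_exact R S Y U" "ext_over R Y E U h"
  shows "h \<in> mod_hom R X S"
proof -
  note E = short_exactD[OF assms(1)] and U = short_exactD[OF assms(2)]
  interpret ME: left_module R "mid E" by (rule E(3))
  obtain m where m: "m \<in> mod_hom R (mid E) (mid U)"
    and mp: "\<And>e. e \<in> carrier (mid E) \<Longrightarrow> h (prj E e) = prj U (m e)"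
    using assms(3) by (auto simp: ext_over_def ext_map_def)
  show ?thesis
  proof (rule mod_homI)
    fix x assume "x \<in> carrier X"
    then obtain e where e: "e \<in> carrier (mid E)" "x = prj E e" using E(9) by metis
    then show "h x \<in> carrier S" using mod_hom_closed[OF m] mod_hom_closed[OF U(5)] by (simp add: mp)
    {
      fix a assume "a \<in> carrier R"
      then show "h (a \<odot>\<^bsub>X\<^esub> x) = a \<odot>\<^bsub>S\<^esub> h x"
        using e mod_hom_closed[OF m] mp[of "a \<odot>\<^bsub>mid E\<^esub> e"]
        by (simp add: mp mod_hom_smult[OF E(5)] mod_hom_smult[OF m] mod_hom_smult[OF U(5)])
    }
    fix x' assume "x' \<in> carrier X"
    then obtain e' where "e' \<in> carrier (mid E)" "x' = prj E e'" using E(9) by metis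
    then show "h (x \<oplus>\<^bsub>X\<^esub> x') = h x \<oplus>\<^bsub>S\<^esub> h x'"
      using e mod_hom_closed[OF m] mp[of "e \<oplus>\<^bsub>mid E\<^esub> e'"]
      by (simp add: mp mod_hom_add[OF E(5)] mod_hom_add[OF m] mod_hom_add[OF U(5)])
  qed
qed

section \<open>Classes of extensions and pull-backs of a common extension\<close>

lemma mem_ext_class_iff:
  assumes "short_exact R X Y E"
  shows "F \<in> ext_class R X Y E \<longleftrightarrow> short_exact R X Y F \<and> ext_over R Y E F (\<lambda>x. x)"
  using ext_equiv_iff_over[OF assms] by (auto simp: ext_class_def)

lemma ext_class_eq:
  assumes "short_exact R X Y E" "short_exact R X Y F" "ext_over R Y E F (\<lambda>x. x)"
  shows "ext_class R X Y E = ext_class R X Y F"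
  using ext_over_trans[OF assms(3)] ext_over_trans[OF ext_over_id_sym[OF assms]]
  by (auto simp: mem_ext_class_iff[OF assms(1)] mem_ext_class_iff[OF assms(2)])

text \<open>The carrier of \<open>Ext1\<close> is formed from sequences on the product type only; a
  copy of the sequence on that type has the same class.\<close>

lemma ext_class_closed:
  fixes E :: "('r, 'y, 'e, 'x) extension"
  assumes "short_exact R X Y E"
  shows "ext_class R X Y E \<in> carrier (Ext1 R X Y)"
proof -
  obtain F :: "('r, 'y, 'y \<times> 'x, 'x) extension"
    where "short_exact R X Y F" "ext_over R Y E F (\<lambda>x. x)"
    using ex_equiv_on_product_type[OF assms] by blast
  then show ?thesis using ext_class_eq[OF assms] by (auto simp: Ext1_def)
qed

lemma Ext1_memD:
  assumes "c \<in> carrier (Ext1 R X Y)" "F \<in> c"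
  shows "short_exact R X Y F" "c = ext_class R X Y F"
  using assms ext_class_eq mem_ext_class_iff by (auto simp: Ext1_def) blast+

lemma Ext1_ex_mem:
  fixes X :: "('r, 'x) module" and Y :: "('r, 'y) module"
  assumes "c \<in> carrier (Ext1 R X Y)" shows "\<exists>F. F \<in> c"
proof -
  obtain F :: "('r, 'y, 'y \<times> 'x, 'x) extension"
    where "short_exact R X Y F" "c = ext_class R X Y F"
    using assms by (auto simp: Ext1_def)
  then have "F \<in> c" using ext_over_refl by (simp add: mem_ext_class_iff)
  then show ?thesis by blast
qed

text \<open>
  All identities in \<open>Ext\<^sup>1(X, Y)\<close> are obtained from identities in \<open>Hom(X, S)\<close>: a class is determined
  by any map along which it is a pull-back of a fixed extension of \<open>S\<close>.
\<close>

definition class_over ::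
    "('r, 's) ring_scheme \<Rightarrow> ('r, 'y) module \<Rightarrow> ('r, 'y, 'y \<times> 'x, 'x) extension set
      \<Rightarrow> ('r, 'y, 'f, 'w) extension \<Rightarrow> ('x \<Rightarrow> 'w) \<Rightarrow> bool"
  where "class_over R Y c U h \<longleftrightarrow> (\<exists>F\<in>c. ext_over R Y F U h)"

text \<open>The members of a class are equivalent, so one witness over \<open>h\<close> puts all of
  them over \<open>h\<close>.\<close>

lemma class_over_memD:
  assumes "c \<in> carrier (Ext1 R X Y)" "class_over R Y c U h" "F \<in> c"
  shows "ext_over R Y F U h"
proof -
  obtain G where G: "G \<in> c" "ext_over R Y G U h" using assms(2) by (auto simp: class_over_def)
  have "ext_over R Y F G (\<lambda>x. x)"
    using Ext1_memD[OF assms(1,3)] G(1) mem_ext_class_iff by blast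
  from ext_over_trans[OF this G(2)] show ?thesis .
qed

lemma class_over_ext_class_iff:
  fixes E :: "('r, 'y, 'e, 'x) extension"
  assumes "short_exact R X Y E"
  shows "class_over R Y (ext_class R X Y E) U h \<longleftrightarrow> ext_over R Y E U h"
proof
  assume "class_over R Y (ext_class R X Y E) U h"
  then show "ext_over R Y E U h"
    using ext_over_trans[of R Y E _ "\<lambda>x. x" U h] by (auto simp: class_over_def mem_ext_class_iff[OF assms])
next
  assume *: "ext_over R Y E U h"
  obtain F :: "('r, 'y, 'y \<times> 'x, 'x) extension"
    where F: "short_exact R X Y F" "ext_over R Y E F (\<lambda>x. x)"
    using ex_equiv_on_product_type[OF assms] by blast
  from ext_over_trans[OF ext_over_id_sym[OF assms F] *]
  show "class_over R Y (ext_class R X Y E) U h"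
    using F by (auto simp: class_over_def mem_ext_class_iff[OF assms])
qed

lemma class_over_hom:
  assumes "c \<in> carrier (Ext1 R X Y)" "short_exact R S Y U" "class_over R Y c U h"
  shows "h \<in> mod_hom R X S"
  using assms(3) Ext1_memD(1)[OF assms(1)] ext_over_hom[OF _ assms(2)]
  unfolding class_over_def by blast

lemma class_over_cong:
  assumes "c \<in> carrier (Ext1 R X Y)" "class_over R Y c U h" "\<And>x. x \<in> carrier X \<Longrightarrow> h x = h' x"
  shows "class_over R Y c U h'"
proof -
  obtain F where "F \<in> c" "ext_over R Y F U h" using assms(2) by (auto simp: class_over_def)
  then have "ext_over R Y F U h'"
    using ext_over_cong[OF Ext1_memD(1)[OF assms(1)]] assms(3) by blast
  then show ?thesis using \<open>F \<in> c\<close> by (auto simp: class_over_def)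
qed

lemma class_over_unique:
  assumes "c \<in> carrier (Ext1 R X Y)" "d \<in> carrier (Ext1 R X Y)" "short_exact R S Y U"
    and "class_over R Y c U h" "class_over R Y d U h"
  shows "c = d"
proof -
  obtain E F where "E \<in> c" "F \<in> d" "ext_over R Y E U h" "ext_over R Y F U h"
    using assms(4,5) by (auto simp: class_over_def)
  then show ?thesis
    using Ext1_memD[OF assms(1)] Ext1_memD[OF assms(2)] ext_over_unique[OF _ _ assms(3)] ext_class_eq
    by metis
qed

text \<open>Take one representative of each class and form the universal extension of this family:
  the class \<open>c i\<close> lies over the injection of the summand \<open>i\<close>. The index
  type \<open>nat\<close> accommodates pairs and triples of classes alike, by repeating
  entries.\<close>

lemma Ext1_common_extension:
  fixes X :: "('r, 'x) module" and Y :: "('r, 'y) module"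
  assumes "ring R" "left_module R Y" "\<And>i::nat. c i \<in> carrier (Ext1 R X Y)"
  shows "\<exists>(S :: ('r, nat \<Rightarrow> 'x) module)
    (U :: ('r, 'y, ('y \<times> (nat \<Rightarrow> 'y \<times> 'x)) set, nat \<Rightarrow> 'x) extension) h.
    short_exact R S Y U \<and> (\<forall>i. class_over R Y (c i) U (h i))"
proof -
  obtain E where mem: "\<And>i. E i \<in> c i"
    using Ext1_ex_mem[OF assms(3)] by metis
  interpret extension_family R UNIV Y "\<lambda>_. X" E
    using assms(1,2) Ext1_memD(1)[OF assms(3) mem] by (rule extension_family.intro)
  show ?thesis
  proof (intro exI conjI allI)
    show "short_exact R (direct_sum UNIV (\<lambda>_. X)) Y universal"
      by (rule short_exact_universal)
    show "class_over R Y (c i) universal (ds_inj UNIV (\<lambda>_. X) i)" for i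
      unfolding class_over_def using over_universal[OF UNIV_I] mem by blast
  qed
qed

text \<open>Inside a common extension, the Baer sum of any two representatives lies over the same
  map, the sum of the two given ones. All members of the union defining the addition therefore
  coincide.\<close>

lemma Ext1_add_eq:
  fixes X :: "('r, 'x) module" and Y :: "('r, 'y) module"
  assumes "ring R" "left_module R Y"
    and c: "c \<in> carrier (Ext1 R X Y)" and d: "d \<in> carrier (Ext1 R X Y)" and EF: "E \<in> c" "F \<in> d"
  shows "c \<oplus>\<^bsub>Ext1 R X Y\<^esub> d = ext_class R X Y (baer_sum Y E F)"
proof -
  have "(if i = 0 then c else d) \<in> carrier (Ext1 R X Y)" for i :: nat using c d by simp
  note common = Ext1_common_extension[where c = "\<lambda>i. if i = 0 then c else d", OF assms(1,2) this]
  obtain S :: "('r, nat \<Rightarrow> 'x) module"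
    and U :: "('r, 'y, ('y \<times> (nat \<Rightarrow> 'y \<times> 'x)) set, nat \<Rightarrow> 'x) extension" and h
    where U: "short_exact R S Y U" and h: "\<And>i::nat. class_over R Y (if i = 0 then c else d) U (h i)"
    using common by auto
  have "ext_class R X Y (baer_sum Y E' F') = ext_class R X Y (baer_sum Y E F)"
    if "E' \<in> c" "F' \<in> d" for E' F'
  proof -
    have over: "ext_over R Y (baer_sum Y G H) U (\<lambda>x. h 0 x \<oplus>\<^bsub>S\<^esub> h 1 x)"
      and se: "short_exact R X Y (baer_sum Y G H)" if "G \<in> c" "H \<in> d" for G H
      using that h[of 0] h[of 1] Ext1_memD(1)[OF c] Ext1_memD(1)[OF d]
        class_over_memD[OF c] class_over_memD[OF d]
      by (auto intro!: baer_sum_over[OF _ _ U] short_exact_baer_sum)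
    show ?thesis
      by (rule ext_class_eq[OF se[OF that] se[OF EF]
            ext_over_unique[OF se[OF that] se[OF EF] U over[OF that] over[OF EF]]])
  qed
  then have "(\<Union>E'\<in>c. \<Union>F'\<in>d. ext_class R X Y (baer_sum Y E' F')) = ext_class R X Y (baer_sum Y E F)"
    using EF by blast
  then show ?thesis by (simp add: Ext1_def)
qed

lemma class_over_add:
  assumes "ring R" "left_module R Y"
    and "c \<in> carrier (Ext1 R X Y)" "d \<in> carrier (Ext1 R X Y)"
  shows "c \<oplus>\<^bsub>Ext1 R X Y\<^esub> d \<in> carrier (Ext1 R X Y)"
    and "short_exact R S Y U \<Longrightarrow> class_over R Y c U h \<Longrightarrow> class_over R Y d U k \<Longrightarrow>
      class_over R Y (c \<oplus>\<^bsub>Ext1 R X Y\<^esub> d) U (\<lambda>x. h x \<oplus>\<^bsub>S\<^esub> k x)"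
proof -
  obtain E F where EF: "E \<in> c" "F \<in> d" using Ext1_ex_mem assms(3,4) by metis
  note se = Ext1_memD(1)[OF assms(3) EF(1)] Ext1_memD(1)[OF assms(4) EF(2)]
  note eq = Ext1_add_eq[OF assms EF]
  show "c \<oplus>\<^bsub>Ext1 R X Y\<^esub> d \<in> carrier (Ext1 R X Y)"
    unfolding eq by (rule ext_class_closed[OF short_exact_baer_sum[OF se]])
  assume "short_exact R S Y U" "class_over R Y c U h" "class_over R Y d U k"
  then show "class_over R Y (c \<oplus>\<^bsub>Ext1 R X Y\<^esub> d) U (\<lambda>x. h x \<oplus>\<^bsub>S\<^esub> k x)"
    unfolding eq class_over_ext_class_iff[OF short_exact_baer_sum[OF se]]
    using baer_sum_over[OF se] class_over_memD[OF assms(3) _ EF(1)] class_over_memD[OF assms(4) _ EF(2)]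
    by blast
qed

text \<open>The pull-back along \<open>a\<close> of every representative lies over \<open>a\<close>
  with respect to the single representative \<open>E\<close>. This gives independence of
  representatives, and composing with a map from \<open>E\<close> to \<open>U\<close> gives the
  second claim.\<close>

lemma class_over_smult:
  assumes c: "c \<in> carrier (Ext1 R X Y)" and a: "a \<in> mod_hom R X X"
  shows "a \<odot>\<^bsub>Ext1 R X Y\<^esub> c \<in> carrier (Ext1 R X Y)"
    and "class_over R Y c U h \<Longrightarrow> class_over R Y (a \<odot>\<^bsub>Ext1 R X Y\<^esub> c) U (\<lambda>x. h (a x))"
proof -
  obtain E where E: "E \<in> c" using Ext1_ex_mem c by metis
  have se: "short_exact R X Y (pullback_ext X a F)" if "F \<in> c" for F
    using short_exact_pullback[OF Ext1_memD(1)[OF c that] _ a] short_exactD(1)[OF Ext1_memD(1)[OF c that]]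
    by blast
  have over: "ext_over R Y (pullback_ext X a F) E a" if "F \<in> c" for F
  proof -
    have "ext_over R Y F E (\<lambda>x. x)"
      using Ext1_memD[OF c that] E mem_ext_class_iff by blast
    from ext_over_trans[OF pullback_over this] show ?thesis .
  qed
  have "ext_class R X Y (pullback_ext X a F) = ext_class R X Y (pullback_ext X a E)" if "F \<in> c" for F
    using ext_class_eq[OF se[OF that] se[OF E]]
      ext_over_unique[OF se[OF that] se[OF E] Ext1_memD(1)[OF c E] over[OF that] over[OF E]] .
  then have "(\<Union>F\<in>c. ext_class R X Y (pullback_ext X a F)) = ext_class R X Y (pullback_ext X a E)"
    using E by blast
  then have eq: "a \<odot>\<^bsub>Ext1 R X Y\<^esub> c = ext_class R X Y (pullback_ext X a E)"
    by (simp add: Ext1_def)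
  show "a \<odot>\<^bsub>Ext1 R X Y\<^esub> c \<in> carrier (Ext1 R X Y)"
    unfolding eq by (rule ext_class_closed[OF se[OF E]])
  assume "class_over R Y c U h"
  then show "class_over R Y (a \<odot>\<^bsub>Ext1 R X Y\<^esub> c) U (\<lambda>x. h (a x))"
    unfolding eq class_over_ext_class_iff[OF se[OF E]]
    using ext_over_trans[OF over[OF E]] class_over_memD[OF c _ E] by blast
qed

lemma class_over_zero:
  assumes "left_module R X" "left_module R Y"
  shows "\<zero>\<^bsub>Ext1 R X Y\<^esub> \<in> carrier (Ext1 R X Y)"
    and "short_exact R S Y U \<Longrightarrow> class_over R Y \<zero>\<^bsub>Ext1 R X Y\<^esub> U (\<lambda>x. \<zero>\<^bsub>S\<^esub>)"
proof -
  have eq: "\<zero>\<^bsub>Ext1 R X Y\<^esub> = ext_class R X Y (split_ext X Y)" by (simp add: Ext1_def)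
  note se = short_exact_split[OF assms]
  show "\<zero>\<^bsub>Ext1 R X Y\<^esub> \<in> carrier (Ext1 R X Y)"
    unfolding eq by (rule ext_class_closed[OF se])
  show "class_over R Y \<zero>\<^bsub>Ext1 R X Y\<^esub> U (\<lambda>x. \<zero>\<^bsub>S\<^esub>)" if "short_exact R S Y U"
    unfolding eq class_over_ext_class_iff[OF se] using assms(1) that by (rule split_over_zero)
qed

text \<open>This is the structure under which the finite sums in \<open>module_basis\<close> can be
  unfolded one summand at a time. Negatives are supplied later by the action of the endomorphism
  -1.\<close>

lemma Ext1_abelian_monoid:
  fixes X :: "('r, 'x) module" and Y :: "('r, 'y) module"
  assumes X: "left_module R X" and Y: "left_module R Y"
  shows "abelian_monoid (Ext1 R X Y)"
proof -
  have R: "ring R" using X by (rule left_module_ring)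
  note add = class_over_add[OF R Y] and zero = class_over_zero[OF X Y]
  have common: "\<exists>(S :: ('r, nat \<Rightarrow> 'x) module)
      (U :: ('r, 'y, ('y \<times> (nat \<Rightarrow> 'y \<times> 'x)) set, nat \<Rightarrow> 'x) extension) h k l.
      short_exact R S Y U \<and> class_over R Y c U h \<and> class_over R Y d U k \<and> class_over R Y e U l \<and>
      h \<in> mod_hom R X S \<and> k \<in> mod_hom R X S \<and> l \<in> mod_hom R X S"
    if cde: "c \<in> carrier (Ext1 R X Y)" "d \<in> carrier (Ext1 R X Y)" "e \<in> carrier (Ext1 R X Y)"
    for c d e
  proof -
    let ?f = "\<lambda>i::nat. if i = 0 then c else if i = 1 then d else e"
    have "?f i \<in> carrier (Ext1 R X Y)" for i using cde by simp
    note common = Ext1_common_extension[where c = ?f, OF R Y this]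
    obtain S :: "('r, nat \<Rightarrow> 'x) module"
      and U :: "('r, 'y, ('y \<times> (nat \<Rightarrow> 'y \<times> 'x)) set, nat \<Rightarrow> 'x) extension" and h
      where U: "short_exact R S Y U" and h: "\<And>i. class_over R Y (?f i) U (h i)"
      using common by auto
    have "class_over R Y c U (h 0)" "class_over R Y d U (h 1)" "class_over R Y e U (h 2)"
      using h[of 0] h[of 1] h[of 2] by simp_all
    then show ?thesis using U class_over_hom[OF _ U] cde by blast
  qed
  show ?thesis
  proof (rule abelian_monoidI)
    fix c d e
    assume cde: "c \<in> carrier (Ext1 R X Y)" "d \<in> carrier (Ext1 R X Y)" "e \<in> carrier (Ext1 R X Y)"
    obtain S :: "('r, nat \<Rightarrow> 'x) module"
      and U :: "('r, 'y, ('y \<times> (nat \<Rightarrow> 'y \<times> 'x)) set, nat \<Rightarrow> 'x) extension" and h k l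
      where U: "short_exact R S Y U"
      and over: "class_over R Y c U h" "class_over R Y d U k" "class_over R Y e U l"
      and hom: "h \<in> mod_hom R X S" "k \<in> mod_hom R X S" "l \<in> mod_hom R X S"
      using common[OF cde] by auto
    interpret S: left_module R S by (rule short_exactD(1)[OF U])
    have 1: "c \<oplus>\<^bsub>Ext1 R X Y\<^esub> d \<oplus>\<^bsub>Ext1 R X Y\<^esub> e \<in> carrier (Ext1 R X Y)"
      and 2: "c \<oplus>\<^bsub>Ext1 R X Y\<^esub> (d \<oplus>\<^bsub>Ext1 R X Y\<^esub> e) \<in> carrier (Ext1 R X Y)"
      using cde add(1) by blast+
    have "class_over R Y (c \<oplus>\<^bsub>Ext1 R X Y\<^esub> d \<oplus>\<^bsub>Ext1 R X Y\<^esub> e) U (\<lambda>x. h x \<oplus>\<^bsub>S\<^esub> k x \<oplus>\<^bsub>S\<^esub> l x)"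
      using cde over by (intro add U)
    moreover have "class_over R Y (c \<oplus>\<^bsub>Ext1 R X Y\<^esub> (d \<oplus>\<^bsub>Ext1 R X Y\<^esub> e)) U (\<lambda>x. h x \<oplus>\<^bsub>S\<^esub> (k x \<oplus>\<^bsub>S\<^esub> l x))"
      using cde over by (intro add U)
    then have "class_over R Y (c \<oplus>\<^bsub>Ext1 R X Y\<^esub> (d \<oplus>\<^bsub>Ext1 R X Y\<^esub> e)) U (\<lambda>x. h x \<oplus>\<^bsub>S\<^esub> k x \<oplus>\<^bsub>S\<^esub> l x)"
      by (rule class_over_cong[OF 2]) (use hom[THEN mod_hom_closed] in \<open>auto simp: S.a_assoc\<close>)
    ultimately show "c \<oplus>\<^bsub>Ext1 R X Y\<^esub> d \<oplus>\<^bsub>Ext1 R X Y\<^esub> e = c \<oplus>\<^bsub>Ext1 R X Y\<^esub> (d \<oplus>\<^bsub>Ext1 R X Y\<^esub> e)"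
      by (rule class_over_unique[OF 1 2 U])
  next
    fix c d assume cd: "c \<in> carrier (Ext1 R X Y)" "d \<in> carrier (Ext1 R X Y)"
    obtain S :: "('r, nat \<Rightarrow> 'x) module"
      and U :: "('r, 'y, ('y \<times> (nat \<Rightarrow> 'y \<times> 'x)) set, nat \<Rightarrow> 'x) extension" and h k
      where U: "short_exact R S Y U" and over: "class_over R Y c U h" "class_over R Y d U k"
      and hom: "h \<in> mod_hom R X S" "k \<in> mod_hom R X S"
      using common[OF cd cd(1)] by auto
    interpret S: left_module R S by (rule short_exactD(1)[OF U])
    have 1: "c \<oplus>\<^bsub>Ext1 R X Y\<^esub> d \<in> carrier (Ext1 R X Y)" and 2: "d \<oplus>\<^bsub>Ext1 R X Y\<^esub> c \<in> carrier (Ext1 R X Y)"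
      using cd add(1) by blast+
    have "class_over R Y (c \<oplus>\<^bsub>Ext1 R X Y\<^esub> d) U (\<lambda>x. h x \<oplus>\<^bsub>S\<^esub> k x)"
      using cd over by (intro add U)
    moreover have "class_over R Y (d \<oplus>\<^bsub>Ext1 R X Y\<^esub> c) U (\<lambda>x. k x \<oplus>\<^bsub>S\<^esub> h x)"
      using cd over by (intro add U)
    then have "class_over R Y (d \<oplus>\<^bsub>Ext1 R X Y\<^esub> c) U (\<lambda>x. h x \<oplus>\<^bsub>S\<^esub> k x)"
      by (rule class_over_cong[OF 2]) (use hom[THEN mod_hom_closed] in \<open>auto simp: S.a_comm\<close>)
    ultimately show "c \<oplus>\<^bsub>Ext1 R X Y\<^esub> d = d \<oplus>\<^bsub>Ext1 R X Y\<^esub> c"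
      by (rule class_over_unique[OF 1 2 U])
  next
    fix c assume c: "c \<in> carrier (Ext1 R X Y)"
    obtain S :: "('r, nat \<Rightarrow> 'x) module"
      and U :: "('r, 'y, ('y \<times> (nat \<Rightarrow> 'y \<times> 'x)) set, nat \<Rightarrow> 'x) extension" and h
      where U: "short_exact R S Y U" and over: "class_over R Y c U h" and hom: "h \<in> mod_hom R X S"
      using common[OF c c c] by auto
    interpret S: left_module R S by (rule short_exactD(1)[OF U])
    have 1: "\<zero>\<^bsub>Ext1 R X Y\<^esub> \<oplus>\<^bsub>Ext1 R X Y\<^esub> c \<in> carrier (Ext1 R X Y)"
      using c zero(1) add(1) by blast
    have "class_over R Y (\<zero>\<^bsub>Ext1 R X Y\<^esub> \<oplus>\<^bsub>Ext1 R X Y\<^esub> c) U (\<lambda>x. \<zero>\<^bsub>S\<^esub> \<oplus>\<^bsub>S\<^esub> h x)"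
      using c over zero U by (intro add U)
    then have "class_over R Y (\<zero>\<^bsub>Ext1 R X Y\<^esub> \<oplus>\<^bsub>Ext1 R X Y\<^esub> c) U h"
      by (rule class_over_cong[OF 1]) (use hom[THEN mod_hom_closed] in \<open>auto\<close>)
    then show "\<zero>\<^bsub>Ext1 R X Y\<^esub> \<oplus>\<^bsub>Ext1 R X Y\<^esub> c = c"
      by (rule class_over_unique[OF 1 c U _ over])
  qed (use add(1) zero(1) in auto)
qed

text \<open>Scalars act by pull-back, so \<open>a j\<close> is applied before
  \<open>\<iota> j\<close>. Membership in \<open>Ext1\<close> is proved in the same induction
  because adding the next summand requires it.\<close>

lemma class_over_combination:
  assumes U: "short_exact R S Y U" and X: "left_module R X"
    and b: "\<And>j. j \<in> A \<Longrightarrow> b j \<in> carrier (Ext1 R X Y)"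
    and over: "\<And>j. j \<in> A \<Longrightarrow> class_over R Y (b j) U (\<iota> j)"
    and a: "\<And>j. j \<in> A \<Longrightarrow> a j \<in> mod_hom R X X" and "finite A"
  shows "(\<Oplus>\<^bsub>Ext1 R X Y\<^esub>j\<in>A. a j \<odot>\<^bsub>Ext1 R X Y\<^esub> b j) \<in> carrier (Ext1 R X Y) \<and>
    class_over R Y (\<Oplus>\<^bsub>Ext1 R X Y\<^esub>j\<in>A. a j \<odot>\<^bsub>Ext1 R X Y\<^esub> b j) U (\<lambda>x. \<Oplus>\<^bsub>S\<^esub>j\<in>A. \<iota> j (a j x))"
  using \<open>finite A\<close> b over a
proof (induction A)
  case empty
  have Y: "left_module R Y" by (rule short_exactD(2)[OF U])
  interpret Ext: abelian_monoid "Ext1 R X Y" by (rule Ext1_abelian_monoid[OF X Y])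
  interpret S: left_module R S by (rule short_exactD(1)[OF U])
  show ?case using class_over_zero[OF X Y] U by simp
next
  case (insert j A)
  have Y: "left_module R Y" by (rule short_exactD(2)[OF U])
  have R: "ring R" using X by (rule left_module_ring)
  interpret Ext: abelian_monoid "Ext1 R X Y" by (rule Ext1_abelian_monoid[OF X Y])
  interpret S: left_module R S by (rule short_exactD(1)[OF U])
  let ?c = "\<Oplus>\<^bsub>Ext1 R X Y\<^esub>i\<in>A. a i \<odot>\<^bsub>Ext1 R X Y\<^esub> b i"
  have IH: "?c \<in> carrier (Ext1 R X Y)" "class_over R Y ?c U (\<lambda>x. \<Oplus>\<^bsub>S\<^esub>j\<in>A. \<iota> j (a j x))"
    using insert.IH insert.prems by auto
  have ab: "a i \<odot>\<^bsub>Ext1 R X Y\<^esub> b i \<in> carrier (Ext1 R X Y)" if "i \<in> insert j A" for i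
    using insert.prems(1,3)[OF that] by (rule class_over_smult)
  have eq: "(\<Oplus>\<^bsub>Ext1 R X Y\<^esub>i\<in>insert j A. a i \<odot>\<^bsub>Ext1 R X Y\<^esub> b i) = (a j \<odot>\<^bsub>Ext1 R X Y\<^esub> b j) \<oplus>\<^bsub>Ext1 R X Y\<^esub> ?c"
    using insert.hyps ab by (intro Ext.finsum_insert) auto
  have c: "(a j \<odot>\<^bsub>Ext1 R X Y\<^esub> b j) \<oplus>\<^bsub>Ext1 R X Y\<^esub> ?c \<in> carrier (Ext1 R X Y)"
    using ab IH(1) by (intro class_over_add[OF R Y]) auto
  have "class_over R Y (a j \<odot>\<^bsub>Ext1 R X Y\<^esub> b j) U (\<lambda>x. \<iota> j (a j x))"
    using insert.prems by (intro class_over_smult(2)) auto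
  then have "class_over R Y ((a j \<odot>\<^bsub>Ext1 R X Y\<^esub> b j) \<oplus>\<^bsub>Ext1 R X Y\<^esub> ?c) U
      (\<lambda>x. \<iota> j (a j x) \<oplus>\<^bsub>S\<^esub> (\<Oplus>\<^bsub>S\<^esub>j\<in>A. \<iota> j (a j x)))"
    using ab IH by (intro class_over_add(2)[OF R Y _ _ U]) auto
  moreover have "\<iota> j (a j x) \<oplus>\<^bsub>S\<^esub> (\<Oplus>\<^bsub>S\<^esub>i\<in>A. \<iota> i (a i x)) = (\<Oplus>\<^bsub>S\<^esub>i\<in>insert j A. \<iota> i (a i x))"
    if x: "x \<in> carrier X" for x
  proof -
    have "\<iota> i (a i x) \<in> carrier S" if "i \<in> insert j A" for i
      using mod_hom_closed[OF class_over_hom[OF insert.prems(1)[OF that] U insert.prems(2)[OF that]]]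
        mod_hom_closed[OF insert.prems(3)[OF that] x] by blast
    then show ?thesis
      using insert.hyps by (intro S.finsum_insert[symmetric]) auto
  qed
  ultimately show ?case
    unfolding eq using c by (blast intro: class_over_cong[OF c])
qed

section \<open>Maps from a brick into a sum of bricks\<close>

lemma left_module_regular:
  assumes "ring R" shows "left_module R (regular_module R)"
proof -
  interpret ring R by fact
  have "abelian_group (regular_module R)"
    by (rule abelian_groupI) (auto simp: regular_module_def a_ac intro: l_neg a_inv_closed)
  then show ?thesis
    by (intro left_module.intro left_module_axioms.intro)
      (auto simp: regular_module_def l_distr r_distr m_assoc ring_axioms)
qed

text \<open>X is generated by the images of finitely many basis vectors. A component of
  \<open>h\<close> that vanishes on them is zero, and each image under \<open>h\<close> has finite
  support.\<close>

lemma finitely_presented_hom_finite_support: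
  assumes R: "ring R" and X: "left_module R X" and fp: "finitely_presented R X"
    and M: "\<And>p. p \<in> P \<Longrightarrow> left_module R (M p)" and h: "h \<in> mod_hom R X (direct_sum P M)"
  shows "finite {p \<in> P. \<exists>x\<in>carrier X. h x p \<noteq> \<zero>\<^bsub>M p\<^esub>}"
proof -
  interpret R: ring R by fact
  obtain n :: nat and \<pi> where \<pi>: "\<pi> \<in> mod_hom R (direct_sum {..<n} (\<lambda>_. regular_module R)) X"
    and surj: "\<pi> ` carrier (direct_sum {..<n} (\<lambda>_. regular_module R)) = carrier X"
    using fp by (auto simp: finitely_presented_def)
  interpret F: module_family R "{..<n}" "\<lambda>_. regular_module R"
    using R left_module_regular[OF R] by (rule module_family.intro)
  interpret D: module_family R P M
    using R M by (rule module_family.intro)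
  \<comment> \<open>The standard basis vectors of the free module that maps onto X.\<close>
  let ?e = "\<lambda>k. ds_inj {..<n} (\<lambda>_. regular_module R) k \<one>\<^bsub>R\<^esub>"
  have e: "?e k \<in> carrier (direct_sum {..<n} (\<lambda>_. regular_module R))" if "k < n" for k
    using that by (intro F.ds_inj_closed) (auto simp: regular_module_def)
  have he: "h (\<pi> (?e k)) \<in> carrier (direct_sum P M)" if "k < n" for k
    using mod_hom_closed[OF h mod_hom_closed[OF \<pi> e[OF that]]] .
  have "finite (\<Union>k<n. {p \<in> P. h (\<pi> (?e k)) p \<noteq> \<zero>\<^bsub>M p\<^esub>})"
    using he by (auto simp: direct_sum_simps)
  moreover have "h x p = \<zero>\<^bsub>M p\<^esub>"
    if p: "p \<in> P" "\<And>k. k < n \<Longrightarrow> h (\<pi> (?e k)) p = \<zero>\<^bsub>M p\<^esub>" and x: "x \<in> carrier X" for p x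
  proof -
    obtain u where u: "u \<in> carrier (direct_sum {..<n} (\<lambda>_. regular_module R))" "x = \<pi> u"
      using x surj by auto
    have hom: "(\<lambda>u. h (\<pi> u) p) \<in> mod_hom R (direct_sum {..<n} (\<lambda>_. regular_module R)) (M p)"
      using mod_hom_compose[OF mod_hom_compose[OF \<pi> h] D.proj_hom[OF p(1)]] .
    have "h (\<pi> u) p = \<zero>\<^bsub>M p\<^esub>"
    proof (rule F.direct_sum_hom_eq[OF M[OF p(1)] hom mod_hom_const_zero[OF M[OF p(1)]] _ u(1)])
      fix k r assume k: "k \<in> {..<n}" and r: "r \<in> carrier (regular_module R)"
      then have r': "r \<in> carrier R" by (simp add: regular_module_def)
      \<comment> \<open>Each element of a free summand is a scalar multiple of its basis vector,
        which reduces the vanishing of the component to the vectors \<open>?e k\<close>.\<close>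
      have "ds_inj {..<n} (\<lambda>_. regular_module R) k (r \<odot>\<^bsub>regular_module R\<^esub> \<one>\<^bsub>R\<^esub>)
          = r \<odot>\<^bsub>direct_sum {..<n} (\<lambda>_. regular_module R)\<^esub> ?e k"
        using r' by (intro mod_hom_smult[OF F.ds_inj_hom[OF k]]) (auto simp: regular_module_def)
      then have "ds_inj {..<n} (\<lambda>_. regular_module R) k r
          = r \<odot>\<^bsub>direct_sum {..<n} (\<lambda>_. regular_module R)\<^esub> ?e k"
        using r' by (simp add: regular_module_def)
      then show "h (\<pi> (ds_inj {..<n} (\<lambda>_. regular_module R) k r)) p = \<zero>\<^bsub>M p\<^esub>"
        using mod_hom_smult[OF hom r' e] k p(2) left_module.smult_r_zero[OF M[OF p(1)] r'] by simp
    qed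
    then show ?thesis using u by simp
  qed
  then have "{p \<in> P. \<exists>x\<in>carrier X. h x p \<noteq> \<zero>\<^bsub>M p\<^esub>} \<subseteq> (\<Union>k<n. {p \<in> P. h (\<pi> (?e k)) p \<noteq> \<zero>\<^bsub>M p\<^esub>})"
    by blast
  ultimately show ?thesis by (rule rev_finite_subset)
qed

text \<open>The lift of all canonical injections and the identity agree on every summand; evaluating
  this lift at \<open>u\<close> is the decomposition into coordinates.\<close>

lemma (in module_family) direct_sum_eq_finsum:
  assumes "u \<in> carrier (direct_sum I M)" "finite S" "{p \<in> I. u p \<noteq> \<zero>\<^bsub>M p\<^esub>} \<subseteq> S" "S \<subseteq> I"
  shows "u = (\<Oplus>\<^bsub>direct_sum I M\<^esub>p\<in>S. ds_inj I M p (u p))"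
proof -
  have "ds_lift (direct_sum I M) (ds_inj I M) u = u"
    using ds_lift_ds_inj[OF left_module_sum ds_inj_hom]
    by (intro direct_sum_hom_eq[OF left_module_sum ds_lift_hom[OF left_module_sum ds_inj_hom]
          mod_hom_id _ assms(1)])
  then show ?thesis
    using ds_lift_superset[OF left_module_sum ds_inj_hom assms] by simp
qed

section \<open>The universal sequences of a semibrick\<close>

locale universal_over_semibrick =
  fixes R :: "('r, 's) ring_scheme" and \<X> :: "('r, 'x) module set" and Y :: "('r, 'y) module"
    and I :: "('r, 'x) module \<Rightarrow> 'i set"
    and B :: "('r, 'x) module \<Rightarrow> 'i \<Rightarrow> ('r, 'y, 'e, 'x) extension"
    and E :: "('r, 'y, 'z, ('r, 'x) module \<times> 'i \<Rightarrow> 'x) extension"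
  assumes R: "ring R" and semibrick: "semibrick R \<X>" and Y: "left_module R Y"
    and universal_sequence: "universal_sequence R \<X> Y I B E"
begin

abbreviation "P \<equiv> SIGMA X:\<X>. I X"
abbreviation "S \<equiv> semibrick_sum \<X> I"
abbreviation "\<iota> X i \<equiv> ds_inj P fst (X, i)"

lemma brick: "X \<in> \<X> \<Longrightarrow> left_module R X" "X \<in> \<X> \<Longrightarrow> finitely_presented R X"
  using semibrick by (auto simp: semibrick_def brick_def)

lemma short_exact_B: "X \<in> \<X> \<Longrightarrow> i \<in> I X \<Longrightarrow> short_exact R X Y (B X i)"
  and basis: "X \<in> \<X> \<Longrightarrow>
    module_basis (End_ring R X) (Ext1 R X Y) (I X) (\<lambda>i. ext_class R X Y (B X i))"
  and short_exact_E: "short_exact R S Y E"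
  using universal_sequence by (auto simp: universal_sequence_def)

sublocale F: extension_family R P Y fst "\<lambda>(X, i). B X i"
  using R Y short_exact_B by (intro extension_family.intro) auto

lemma short_exact_F: "short_exact R S Y F.universal"
  using F.short_exact_universal by (simp add: semibrick_sum_def)

text \<open>\<open>E\<close> is only equivalent to the explicit push-out. These two morphisms carry
  both properties of the push-out, its maps from the basis sequences and its universal property,
  over to \<open>E\<close>.\<close>

lemma E_over_universal: "ext_over R Y E F.universal (\<lambda>x. x)"
  and universal_over_E: "ext_over R Y F.universal E (\<lambda>x. x)"
proof -
  have "ext_equiv R Y F.universal E"
    using universal_sequence by (simp add: universal_sequence_def F.universal_def Let_def)
  then show "ext_over R Y F.universal E (\<lambda>x. x)"
    using ext_equiv_iff_over[OF short_exact_F short_exact_E] by simp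
  then show "ext_over R Y E F.universal (\<lambda>x. x)"
    by (rule ext_over_id_sym[OF short_exact_F short_exact_E])
qed

lemma B_over_E:
  assumes "X \<in> \<X>" "i \<in> I X" shows "ext_over R Y (B X i) E (\<iota> X i)"
  using ext_over_trans[OF F.over_universal universal_over_E, of "(X, i)"] assms by simp

lemma E_over:
  assumes "short_exact R T Y V" "h \<in> mod_hom R S T"
    and "\<And>X i. X \<in> \<X> \<Longrightarrow> i \<in> I X \<Longrightarrow> ext_over R Y (B X i) V (\<lambda>x. h (\<iota> X i x))"
  shows "ext_over R Y E V h"
proof -
  have "ext_over R Y F.universal V h"
    using assms by (intro F.universal_over[OF assms(1)]) (auto simp: semibrick_sum_def)
  from ext_over_trans[OF E_over_universal this] show ?thesis .
qed

lemma class_B_closed: "X \<in> \<X> \<Longrightarrow> i \<in> I X \<Longrightarrow> ext_class R X Y (B X i) \<in> carrier (Ext1 R X Y)"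
  by (rule ext_class_closed[OF short_exact_B])

lemma class_B_over: "X \<in> \<X> \<Longrightarrow> i \<in> I X \<Longrightarrow> class_over R Y (ext_class R X Y (B X i)) E (\<iota> X i)"
  using B_over_E by (simp add: class_over_ext_class_iff[OF short_exact_B])

sublocale S: left_module R S
  by (rule short_exactD(1)[OF short_exact_E])

lemma combination_over:
  assumes X: "X \<in> \<X>" and A: "A \<subseteq> I X" "finite A" and a: "\<And>j. j \<in> A \<Longrightarrow> a j \<in> mod_hom R X X"
  defines "c \<equiv> \<Oplus>\<^bsub>Ext1 R X Y\<^esub>j\<in>A. a j \<odot>\<^bsub>Ext1 R X Y\<^esub> ext_class R X Y (B X j)"
  shows "c \<in> carrier (Ext1 R X Y)" "class_over R Y c E (\<lambda>x. \<Oplus>\<^bsub>S\<^esub>j\<in>A. \<iota> X j (a j x))"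
proof -
  have "c \<in> carrier (Ext1 R X Y) \<and> class_over R Y c E (\<lambda>x. \<Oplus>\<^bsub>S\<^esub>j\<in>A. \<iota> X j (a j x))"
    unfolding c_def
    by (rule class_over_combination[OF short_exact_E brick(1)[OF X]])
      (use A class_B_closed[OF X] class_B_over[OF X] a in auto)
  then show "c \<in> carrier (Ext1 R X Y)" "class_over R Y c E (\<lambda>x. \<Oplus>\<^bsub>S\<^esub>j\<in>A. \<iota> X j (a j x))"
    by auto
qed

text \<open>Linear independence as a statement about maps: the components of \<open>h\<close> at the
  copies of X are the coefficients of a linear relation among the basis classes, and those at all
  other bricks vanish because the bricks are Hom-orthogonal.\<close>

lemma zero_class_over_imp_zero:
  assumes X: "X \<in> \<X>" and h: "h \<in> mod_hom R X S" and over: "class_over R Y \<zero>\<^bsub>Ext1 R X Y\<^esub> E h"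
    and x: "x \<in> carrier X"
  shows "h x = \<zero>\<^bsub>S\<^esub>"
proof -
  let ?b = "\<lambda>i. ext_class R X Y (B X i)"
  have h': "h \<in> mod_hom R X (direct_sum P fst)" using h by (simp add: semibrick_sum_def)
  \<comment> \<open>The restriction makes the component an element of \<open>End_ring\<close>, whose
    members are extensional, and makes being zero there the same as vanishing on X.\<close>
  define a where "a j = (\<lambda>x\<in>carrier X. h x (X, j))" for j
  have a: "a j \<in> mod_hom R X X" if "j \<in> I X" for j
  proof (rule mod_hom_cong[OF brick(1)[OF X]])
    show "(\<lambda>x. h x (X, j)) \<in> mod_hom R X X"
      using mod_hom_compose[OF h' F.FX.proj_hom[of "(X, j)"]] X that by simp
  qed (simp add: a_def)
  have a_End: "a \<in> I X \<rightarrow> carrier (End_ring R X)"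
    using a by (auto simp: End_ring_def a_def)
  define J where "J = {j \<in> I X. a j \<noteq> \<zero>\<^bsub>End_ring R X\<^esub>}"
  have J: "j \<in> J \<longleftrightarrow> j \<in> I X \<and> (\<exists>x\<in>carrier X. h x (X, j) \<noteq> \<zero>\<^bsub>X\<^esub>)" for j
    by (auto simp: J_def a_def End_ring_def fun_eq_iff)
  have "finite {p \<in> P. \<exists>x\<in>carrier X. h x p \<noteq> \<zero>\<^bsub>fst p\<^esub>}"
    using R brick[OF X] F.FX.M h' by (rule finitely_presented_hom_finite_support)
  then have "finite ((\<lambda>j. (X, j)) ` J)"
    by (rule rev_finite_subset) (use X in \<open>auto simp: J\<close>)
  then have fin: "finite J" by (rule finite_imageD) (auto simp: inj_on_def)
  have h_eq: "(\<Oplus>\<^bsub>S\<^esub>j\<in>J. \<iota> X j (a j x)) = h x" if x: "x \<in> carrier X" for x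
  proof -
    have hx: "h x \<in> carrier (direct_sum P fst)" using h' x by (rule mod_hom_closed)
    have supp: "{p \<in> P. h x p \<noteq> \<zero>\<^bsub>fst p\<^esub>} \<subseteq> (\<lambda>j. (X, j)) ` J"
    proof
      fix p assume "p \<in> {p \<in> P. h x p \<noteq> \<zero>\<^bsub>fst p\<^esub>}"
      then obtain X' j where p: "p = (X', j)" "X' \<in> \<X>" "j \<in> I X'" "h x (X', j) \<noteq> \<zero>\<^bsub>X'\<^esub>" by auto
      have "(\<lambda>x. h x (X', j)) \<in> mod_hom R X X'"
        using mod_hom_compose[OF h' F.FX.proj_hom[of "(X', j)"]] p by simp
      \<comment> \<open>A component into a different brick would be a homomorphism that is nonzero
        at \<open>x\<close>, against the semibrick condition.\<close>
      then have "X' = X"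
        using semibrick X p(2,4) x unfolding semibrick_def by metis
      then have "j \<in> J" using p x by (auto simp: J)
      then show "p \<in> (\<lambda>j. (X, j)) ` J" using p \<open>X' = X\<close> by blast
    qed
    have "h x = (\<Oplus>\<^bsub>S\<^esub>p\<in>(\<lambda>j. (X, j)) ` J. ds_inj P fst p (h x p))"
      unfolding semibrick_sum_def
      by (rule F.FX.direct_sum_eq_finsum[OF hx _ supp]) (use fin X in \<open>auto simp: J\<close>)
    also have "\<dots> = (\<Oplus>\<^bsub>S\<^esub>j\<in>J. \<iota> X j (h x (X, j)))"
    proof (rule S.add.finprod_reindex)
      show "(\<lambda>p. ds_inj P fst p (h x p)) \<in> (\<lambda>j. (X, j)) ` J \<rightarrow> carrier S"
        using F.FX.ds_inj_closed direct_sum_apply_closed[OF hx] X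
        by (auto simp: J semibrick_sum_def)
    qed (auto simp: inj_on_def)
    also have "\<dots> = (\<Oplus>\<^bsub>S\<^esub>j\<in>J. \<iota> X j (a j x))"
      using x by (simp add: a_def)
    finally show ?thesis by simp
  qed
  let ?c = "\<Oplus>\<^bsub>Ext1 R X Y\<^esub>j\<in>J. a j \<odot>\<^bsub>Ext1 R X Y\<^esub> ?b j"
  have c: "?c \<in> carrier (Ext1 R X Y)" "class_over R Y ?c E (\<lambda>x. \<Oplus>\<^bsub>S\<^esub>j\<in>J. \<iota> X j (a j x))"
    using a fin by (intro combination_over[OF X]; auto simp: J_def)+
  \<comment> \<open>The combination \<open>?c\<close> and the zero class now lie over the same map,
    so they are equal: this is the relation to which linear independence applies.\<close>
  have "class_over R Y ?c E h"
    using c h_eq by (rule class_over_cong)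
  then have "?c = \<zero>\<^bsub>Ext1 R X Y\<^esub>"
    using c(1) class_over_zero(1)[OF brick(1)[OF X] Y] short_exact_E over
    by (intro class_over_unique[of _ R X Y])
  then have "a j = \<zero>\<^bsub>End_ring R X\<^esub>" if "j \<in> I X" for j
    using conjunct1[OF conjunct2[OF basis[OF X, unfolded module_basis_def]], rule_format,
        OF a_End fin[unfolded J_def] _ that] unfolding J_def by blast
  then have "J = {}" by (auto simp: J_def)
  then show ?thesis using h_eq[OF x] by simp
qed

text \<open>Composing with the endomorphism shows that each basis class lies over \<iota> and also
  over \<iota> followed by \<open>g\<close>. Subtracting the class from itself in these two ways
  puts the zero class over the difference of the two maps, which is therefore zero; so
  \<open>g\<close> fixes every summand.\<close>

lemma endo_over_identity:
  assumes over: "ext_over R Y E E g" and u: "u \<in> carrier S"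
  shows "g u = u"
proof -
  have g: "g \<in> mod_hom R S S"
    by (rule ext_over_hom[OF short_exact_E short_exact_E over])
  have SD: "S = direct_sum P fst" by (simp add: semibrick_sum_def)
  show ?thesis
  proof (rule F.FX.direct_sum_hom_eq[OF F.FX.left_module_sum])
    show "g \<in> mod_hom R (direct_sum P fst) (direct_sum P fst)" using g by (simp add: SD)
    show "u \<in> carrier (direct_sum P fst)" using u by (simp add: SD)
    fix p x assume "p \<in> P" "x \<in> carrier (fst p)"
    then obtain X i where p: "p = (X, i)" "X \<in> \<X>" "i \<in> I X" and x: "x \<in> carrier X" by auto
    interpret X: left_module R X by (rule brick(1)[OF p(2)])
    let ?c = "ext_class R X Y (B X i)"
    \<comment> \<open>The endomorphism -1 of X; pulling back along it produces the negative of the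
      basis class.\<close>
    let ?m = "\<lambda>x. \<ominus>\<^bsub>X\<^esub> x"
    let ?d = "?m \<odot>\<^bsub>Ext1 R X Y\<^esub> ?c"
    have m: "?m \<in> mod_hom R X X"
      by (rule mod_hom_uminus[OF brick(1)[OF p(2)] mod_hom_id])
    note c = class_B_closed[OF p(2,3)] and c\<iota> = class_B_over[OF p(2,3)]
    have d: "?d \<in> carrier (Ext1 R X Y)" "class_over R Y ?d E (\<lambda>x. \<iota> X i (?m x))"
      using class_over_smult[OF c m] c\<iota> by auto
    have \<iota>: "\<iota> X i \<in> mod_hom R X S"
      by (rule class_over_hom[OF c short_exact_E c\<iota>])
    have \<iota>m: "\<iota> X i (?m x) = \<ominus>\<^bsub>S\<^esub> \<iota> X i x" if "x \<in> carrier X" for x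
      using that by (rule mod_hom_minus[OF brick(1)[OF p(2)] S.left_module_axioms \<iota>])
    have cg: "class_over R Y ?c E (\<lambda>x. g (\<iota> X i x))"
      using ext_over_trans[OF B_over_E[OF p(2,3)] over]
      by (simp add: class_over_ext_class_iff[OF short_exact_B[OF p(2,3)]])
    note cd = class_over_add[OF R Y c d(1)]
    have "class_over R Y (?c \<oplus>\<^bsub>Ext1 R X Y\<^esub> ?d) E (\<lambda>x. \<zero>\<^bsub>S\<^esub>)"
      by (rule class_over_cong[OF cd(1) cd(2)[OF short_exact_E c\<iota> d(2)]])
        (simp add: \<iota>m S.r_neg mod_hom_closed[OF \<iota>])
    then have "?c \<oplus>\<^bsub>Ext1 R X Y\<^esub> ?d = \<zero>\<^bsub>Ext1 R X Y\<^esub>"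
      using class_over_zero[OF brick(1)[OF p(2)] Y] short_exact_E
      by (intro class_over_unique[OF cd(1) _ short_exact_E]) auto
    \<comment> \<open>The same sum \<open>?c + ?d\<close>, already known to be zero, is now computed
      with \<open>?c\<close> placed over \<iota> followed by \<open>g\<close>.\<close>
    then have over0: "class_over R Y \<zero>\<^bsub>Ext1 R X Y\<^esub> E (\<lambda>x. g (\<iota> X i x) \<oplus>\<^bsub>S\<^esub> \<iota> X i (?m x))"
      using cd(2)[OF short_exact_E cg d(2)] by simp
    have "g (\<iota> X i x) \<oplus>\<^bsub>S\<^esub> \<iota> X i (?m x) = \<zero>\<^bsub>S\<^esub>"
      using class_over_hom[OF _ short_exact_E over0] class_over_zero(1)[OF brick(1)[OF p(2)] Y] over0
      by (intro zero_class_over_imp_zero[OF p(2) _ over0 x]) auto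
    then have "g (\<iota> X i x) = \<iota> X i x"
      using x mod_hom_closed[OF \<iota> x] mod_hom_closed[OF g]
      by (metis S.a_inv_closed S.minus_equality S.minus_minus \<iota>m)
    then show "g (ds_inj P fst p x) = ds_inj P fst p x" by (simp add: p)
  qed (rule mod_hom_id)
qed

text \<open>Spanning writes the class of \<open>C\<close> as a combination of basis classes, and the
  coefficients are the components of a suitable \<open>h\<close>. As the middle term of
  \<open>C\<close> is not tied to the type used for \<open>B\<close>, this applies to the members of
  another basis.\<close>

lemma over_E_from_basis:
  assumes X: "X \<in> \<X>" and C: "short_exact R X Y C"
  shows "\<exists>h. ext_over R Y C E h"
proof -
  let ?b = "\<lambda>i. ext_class R X Y (B X i)"
  obtain a where a: "a \<in> I X \<rightarrow> carrier (End_ring R X)"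
    and fin: "finite {i \<in> I X. a i \<noteq> \<zero>\<^bsub>End_ring R X\<^esub>}"
    and eq: "ext_class R X Y C =
      (\<Oplus>\<^bsub>Ext1 R X Y\<^esub>i\<in>{i \<in> I X. a i \<noteq> \<zero>\<^bsub>End_ring R X\<^esub>}. a i \<odot>\<^bsub>Ext1 R X Y\<^esub> ?b i)"
    using conjunct2[OF conjunct2[OF basis[OF X, unfolded module_basis_def]], rule_format,
        OF ext_class_closed[OF C]] by auto
  have "class_over R Y (ext_class R X Y C) E
      (\<lambda>x. \<Oplus>\<^bsub>S\<^esub>i\<in>{i \<in> I X. a i \<noteq> \<zero>\<^bsub>End_ring R X\<^esub>}. \<iota> X i (a i x))"
    unfolding eq using a fin by (intro combination_over[OF X]) (auto simp: End_ring_def)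
  then show ?thesis using class_over_ext_class_iff[OF C] by blast
qed

end

section \<open>Comparison of two universal sequences\<close>

lemma universal_over_universal:
  assumes "universal_over_semibrick R \<X> Y I B E" "universal_over_semibrick R \<X> Y I B' E'"
  shows "\<exists>g. ext_over R Y E' E g"
proof -
  interpret E: universal_over_semibrick R \<X> Y I B E by fact
  interpret E': universal_over_semibrick R \<X> Y I B' E' by fact
  \<comment> \<open>The second basis enters only through its sequences, each of which is some
    extension of a brick by Y; the first basis spans their classes.\<close>
  have "\<exists>h. ext_over R Y (B' X i) E h" if "X \<in> \<X>" "i \<in> I X" for X i
    using E.over_E_from_basis[OF that(1) E'.short_exact_B[OF that]] .
  then have "\<forall>p\<in>Sigma \<X> I. \<exists>h. ext_over R Y (B' (fst p) (snd p)) E h" by auto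
  from bchoice[OF this] obtain h
    where "\<forall>p\<in>Sigma \<X> I. ext_over R Y (B' (fst p) (snd p)) E (h p)" ..
  then have h: "ext_over R Y (B' X i) E (h (X, i))" if "X \<in> \<X>" "i \<in> I X" for X i
    using that by auto
  have hom: "h p \<in> mod_hom R (fst p) (semibrick_sum \<X> I)" if "p \<in> Sigma \<X> I" for p
    using that ext_over_hom[OF E'.short_exact_B E.short_exact_E h] by auto
  note S = short_exactD(1)[OF E.short_exact_E]
  obtain g where g: "g \<in> mod_hom R (direct_sum (Sigma \<X> I) fst) (semibrick_sum \<X> I)"
    and gh: "\<And>p x. p \<in> Sigma \<X> I \<Longrightarrow> x \<in> carrier (fst p) \<Longrightarrow> g (ds_inj (Sigma \<X> I) fst p x) = h p x"
    using E.F.FX.direct_sum_lift[OF S hom] by blast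
  \<comment> \<open>The chosen maps are the restrictions of \<open>g\<close> to the summands, so the
    universal property of \<open>E'\<close> assembles the morphisms from its basis sequences into
    one.\<close>
  have "ext_over R Y E' E g"
  proof (rule E'.E_over[OF E.short_exact_E])
    show "g \<in> mod_hom R (semibrick_sum \<X> I) (semibrick_sum \<X> I)"
      using g by (simp add: semibrick_sum_def)
    fix X i assume Xi: "X \<in> \<X>" "i \<in> I X"
    show "ext_over R Y (B' X i) E (\<lambda>x. g (ds_inj (Sigma \<X> I) fst (X, i) x))"
      by (rule ext_over_cong[OF E'.short_exact_B[OF Xi] h[OF Xi]]) (use Xi gh in auto)
  qed
  then show ?thesis by blast
qed

theorem proposition4p3:
  fixes R :: "('r, 's) ring_scheme"
    and \<X> :: "('r, 'x) module set"
    and Y :: "('r, 'y) module"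
    and I :: "('r, 'x) module \<Rightarrow> 'i set"
    and B :: "('r, 'x) module \<Rightarrow> 'i \<Rightarrow> ('r, 'y, 'e, 'x) extension"
    and B' :: "('r, 'x) module \<Rightarrow> 'i \<Rightarrow> ('r, 'y, 'f, 'x) extension"
    and Z :: "('r, 'z) module" and Z' :: "('r, 'w) module"
    and \<alpha> :: "'y \<Rightarrow> 'z" and \<alpha>' :: "'y \<Rightarrow> 'w"
    and \<beta> :: "'z \<Rightarrow> ('r, 'x) module \<times> 'i \<Rightarrow> 'x"
    and \<beta>' :: "'w \<Rightarrow> ('r, 'x) module \<times> 'i \<Rightarrow> 'x"
  assumes "ring R"
    and "semibrick R \<X>"
    and "left_module R Y"
    and "universal_sequence R \<X> Y I B \<lparr>inc = \<alpha>, mid = Z, prj = \<beta>\<rparr>"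
    and "universal_sequence R \<X> Y I B' \<lparr>inc = \<alpha>', mid = Z', prj = \<beta>'\<rparr>"
  shows "\<exists>f \<in> mod_iso R Z' Z. \<exists>g \<in> mod_iso R (semibrick_sum \<X> I) (semibrick_sum \<X> I).
           (\<forall>y\<in>carrier Y. f (\<alpha>' y) = \<alpha> y) \<and>
           (\<forall>z\<in>carrier Z'. \<beta> (f z) = g (\<beta>' z))"
proof -
  let ?E = "\<lparr>inc = \<alpha>, mid = Z, prj = \<beta>\<rparr>" and ?E' = "\<lparr>inc = \<alpha>', mid = Z', prj = \<beta>'\<rparr>"
  let ?S = "semibrick_sum \<X> I"
  have uE: "universal_over_semibrick R \<X> Y I B ?E"
    and uE': "universal_over_semibrick R \<X> Y I B' ?E'"
    using assms by (auto intro: universal_over_semibrick.intro)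
  interpret E: universal_over_semibrick R \<X> Y I B ?E by (rule uE)
  interpret E': universal_over_semibrick R \<X> Y I B' ?E' by (rule uE')
  obtain g f where f: "ext_map R Y ?E' ?E g f"
    using universal_over_universal[OF uE uE'] by (auto simp: ext_over_def)
  obtain g' f' where f': "ext_map R Y ?E ?E' g' f'"
    using universal_over_universal[OF uE' uE] by (auto simp: ext_over_def)
  have ff': "ext_map R Y ?E ?E (\<lambda>x. g (g' x)) (\<lambda>x. f (f' x))"
    and f'f: "ext_map R Y ?E' ?E' (\<lambda>x. g' (g x)) (\<lambda>x. f' (f x))"
    using ext_map_compose f f' by blast+
  \<comment> \<open>Each round trip is an endomorphism of one universal sequence, which makes
    \<open>g\<close> and \<open>g'\<close> mutually inverse on the right-hand term.\<close>
  have gg': "g (g' u) = u" and g'g: "g' (g u) = u" if "u \<in> carrier ?S" for u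
    using E.endo_over_identity[OF _ that] E'.endo_over_identity[OF _ that] ff' f'f
    unfolding ext_over_def by blast+
  have g: "g \<in> mod_hom R ?S ?S" and g': "g' \<in> mod_hom R ?S ?S"
    using ext_over_hom[OF E'.short_exact_E E.short_exact_E]
      ext_over_hom[OF E.short_exact_E E'.short_exact_E] f f' unfolding ext_over_def by blast+
  have "bij_betw g (carrier ?S) (carrier ?S)"
    using gg' g'g mod_hom_closed[OF g] mod_hom_closed[OF g'] by (intro bij_betw_byWitness[of _ g']) auto
  \<comment> \<open>The maps \<open>f\<close> and \<open>f'\<close> need not be mutually inverse: a
    round trip on a middle term may differ from the identity by a homomorphism from the right-hand
    term to Y. The five lemma still makes both round trips bijective.\<close>
  moreover have "(\<lambda>x. f (f' x)) \<in> mod_iso R (mid ?E) (mid ?E)"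
    by (rule ext_map_id_imp_iso[OF E.short_exact_E E.short_exact_E
          ext_map_cong[OF E.short_exact_E ff' gg']])
  then have 1: "bij_betw (\<lambda>x. f (f' x)) (carrier Z) (carrier Z)"
    by (simp add: mod_iso_def)
  have "(\<lambda>x. f' (f x)) \<in> mod_iso R (mid ?E') (mid ?E')"
    by (rule ext_map_id_imp_iso[OF E'.short_exact_E E'.short_exact_E
          ext_map_cong[OF E'.short_exact_E f'f g'g]])
  then have 2: "bij_betw (\<lambda>x. f' (f x)) (carrier Z') (carrier Z')"
    by (simp add: mod_iso_def)
  have fh: "f \<in> mod_hom R Z' Z" and f'h: "f' \<in> mod_hom R Z Z'"
    using f f' by (auto simp: ext_map_def)
  \<comment> \<open>Injectivity of \<open>f\<close> comes from \<open>f'\<close> after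
    \<open>f\<close>, surjectivity from \<open>f\<close> after \<open>f'\<close>.\<close>
  have "inj_on f (carrier Z')"
    using 2 by (auto simp: bij_betw_def inj_on_def)
  moreover have "carrier Z \<subseteq> f ` carrier Z'"
    using 1 mod_hom_closed[OF f'h] by (force simp: bij_betw_def)
  ultimately have "f \<in> mod_iso R Z' Z" "g \<in> mod_iso R ?S ?S"
    using fh g mod_hom_closed[OF fh] by (auto simp: mod_iso_def bij_betw_def)
  then show ?thesis
    using f by (auto simp: ext_map_def)
qed

end
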